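(* Let $n\ge2$, $p>n$ and $s_0\in(\frac np,1)$. (a) There exists a constant $C$, independent of $s$ and $f$, such that for every $s\in(s_0,1)$ and every $f\in W^{s,p}$ with $|\operatorname{supp} f|<\infty$, $$\|f\|_{L^\infty}\le C\,|\operatorname{supp}f|^{\frac sn-\frac1p}(1-s)^{\frac1p}\,|\Pi^{*,s}_pf|^{-\frac sn}.$$ (b) There is a constant $c$ depending only on $n$ and $p$ such that for every nonzero $f\in W^1_p$ with $|\operatorname{supp}f|<\infty$ and every $s\in(0,1)$, $$(s(1-s))^{\frac1p}|\operatorname{supp}f|^{\frac sn}|\Pi^{*,s}_pf|^{-\frac sn}\le c\,|\operatorname{supp}f|^{\frac1n}|\Pi^*_pf|^{-\frac1n}.$$ (c) For every such $f$, $$\lim_{s\to1-}(1-s)^{\frac1p}|\operatorname{supp}f|^{\frac sn-\frac1p}|\Pi^{*,s}_pf|^{-\frac sn}=p^{-\frac1p}|\operatorname{supp}f|^{\frac1n-\frac1p}|\Pi^*_pf|^{-\frac1n}.$$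
   Context: $\Delta_hf(x)=f(x+h)-f(x)$. $W^{s,p}$ ($s\in(0,1)$) is the space of $f\in L^p$ with finite Gagliardo seminorm $\|f\|_{W^{s,p}}=(\int\int\frac{|f(x)-f(y)|^p}{|x-y|^{sp+n}}dxdy)^{1/p}$. The fractional polar projection body $\Pi^{*,s}_pf$ is the star-shaped set with gauge $\|\xi\|^{sp}_{\Pi^{*,s}_pf}=\int_0^\infty t^{-sp}\int_{\mathbb{R}^n}|f(x+t\xi)-f(x)|^pdx\frac{dt}{t}$. $\Pi^*_pf$ is the star body with gauge $\|\xi\|^p_{\Pi^*_pf}=\int|\nabla f(x)\cdot\xi|^pdx$. Volume of a star-shaped set $K$: $|K|=\frac1n\int_{\mathbb{S}^{n-1}}\|\xi\|_K^{-n}d\sigma(\xi)$. *)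

theory Defs
  imports "HOL-Analysis.Analysis" "HOL-Probability.Essential_Supremum"
begin

definition Lp_fun :: "real \<Rightarrow> ('a::euclidean_space \<Rightarrow> real) \<Rightarrow> bool" where
  "Lp_fun p f \<longleftrightarrow> f \<in> borel_measurable lebesgue \<and> integrable lebesgue (\<lambda>x. \<bar>f x\<bar> powr p)"

text \<open>Support set of f; its volume is the Lebesgue measure (a.e.-invariant).\<close>
definition supp_set :: "('a::euclidean_space \<Rightarrow> real) \<Rightarrow> 'a set" where
  "supp_set f = {x. f x \<noteq> 0}"

definition Linf_norm :: "('a::euclidean_space \<Rightarrow> real) \<Rightarrow> ereal" where
  "Linf_norm f = esssup lebesgue (\<lambda>x. ereal \<bar>f x\<bar>)"

definition gagliardo :: "real \<Rightarrow> real \<Rightarrow> ('a::euclidean_space \<Rightarrow> real) \<Rightarrow> ennreal" where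
  "gagliardo s p f = (\<integral>\<^sup>+ x. \<integral>\<^sup>+ y. ennreal (\<bar>f x - f y\<bar> powr p / norm (x - y) powr (s * p + real DIM('a))) \<partial>lebesgue \<partial>lebesgue)"

definition W_frac :: "real \<Rightarrow> real \<Rightarrow> ('a::euclidean_space \<Rightarrow> real) \<Rightarrow> bool" where
  "W_frac s p f \<longleftrightarrow> Lp_fun p f \<and> gagliardo s p f < \<infinity>"

text \<open>The sp-th power of the gauge of the fractional polar projection body.\<close>
definition frac_gauge_pow :: "real \<Rightarrow> real \<Rightarrow> ('a::euclidean_space \<Rightarrow> real) \<Rightarrow> 'a \<Rightarrow> ennreal" where
  "frac_gauge_pow s p f \<xi> = (\<integral>\<^sup>+ t. indicator {0<..} t * ennreal (t powr (- s * p) / t) *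
       (\<integral>\<^sup>+ x. ennreal (\<bar>f (x + t *\<^sub>R \<xi>) - f x\<bar> powr p) \<partial>lebesgue) \<partial>lebesgue)"

text \<open>The star-shaped set with that gauge: {xi. gauge(xi) <= 1}, equivalently gauge^{sp} <= 1.\<close>
definition frac_polar_proj_body :: "real \<Rightarrow> real \<Rightarrow> ('a::euclidean_space \<Rightarrow> real) \<Rightarrow> 'a set" where
  "frac_polar_proj_body s p f = {\<xi>. frac_gauge_pow s p f \<xi> \<le> 1}"

definition vol :: "'a::euclidean_space set \<Rightarrow> real" where
  "vol K = measure lebesgue K"

coinductive smooth_fun :: "('a::euclidean_space \<Rightarrow> real) \<Rightarrow> bool" where
  "(\<forall>x. f differentiable (at x)) \<Longrightarrow>
   (\<forall>i\<in>Basis. smooth_fun (\<lambda>x. frechet_derivative f (at x) i)) \<Longrightarrow> smooth_fun f"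

definition test_fun :: "('a::euclidean_space \<Rightarrow> real) \<Rightarrow> bool" where
  "test_fun \<phi> \<longleftrightarrow> smooth_fun \<phi> \<and> bounded {x. \<phi> x \<noteq> 0}"

definition weak_gradient :: "('a::euclidean_space \<Rightarrow> real) \<Rightarrow> ('a \<Rightarrow> 'a) \<Rightarrow> bool" where
  "weak_gradient f g \<longleftrightarrow> (\<forall>\<phi>. test_fun \<phi> \<longrightarrow> (\<forall>i\<in>Basis.
      (\<integral>x. f x * frechet_derivative \<phi> (at x) i \<partial>lebesgue) = - (\<integral>x. (g x \<bullet> i) * \<phi> x \<partial>lebesgue)))"

definition W1p_grad :: "real \<Rightarrow> ('a::euclidean_space \<Rightarrow> real) \<Rightarrow> ('a \<Rightarrow> 'a) \<Rightarrow> bool" where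
  "W1p_grad p f g \<longleftrightarrow> Lp_fun p f \<and> g \<in> borel_measurable lebesgue \<and>
      integrable lebesgue (\<lambda>x. norm (g x) powr p) \<and> weak_gradient f g"

definition polar_proj_body :: "real \<Rightarrow> ('a::euclidean_space \<Rightarrow> 'a) \<Rightarrow> 'a set" where
  "polar_proj_body p g = {\<xi>. (\<integral>\<^sup>+ x. ennreal (\<bar>g x \<bullet> \<xi>\<bar> powr p) \<partial>lebesgue) \<le> 1}"

end

theory Submission
  imports Defs "HOL-Probability.Probability_Measure"
begin

text \<open>
  Let \<open>\<phi>(z)\<close> be the \<open>p\<close>-th power of the \<open>L\<^sup>p\<close> norm of \<open>f(\<cdot> + z) - f\<close>, so that the fractional
  gauge is \<open>H(\<xi>) = \<integral>\<^sub>0\<^sup>\<infinity> t powr (- s p - 1) \<phi>(t \<xi>) dt\<close>. Since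
  \<open>\<phi>(z + w) \<le> 2 powr (p - 1) (\<phi>(z) + \<phi>(w))\<close>, the gauge \<open>H\<close> has the same property, and summing over
  dyadic scales gives \<open>\<phi> \<le> C (1 - s) H\<close>. Part (a) then is Campanato's proof of Morrey's inequality
  with the level sets \<open>{H \<le> c}\<close> in place of Euclidean balls; by homogeneity their volume is
  \<open>c powr (n / (s p)) |K|\<close>, and neither rearrangement nor convexity of the body \<open>K = {H \<le> 1}\<close> is
  needed.

  For the other parts, \<open>f(x + z) - f(x) = \<integral>\<^sub>0\<^sup>1 \<nabla>f(x + t z) \<bullet> z dt\<close> almost everywhere, so
  \<open>\<phi>(z) \<le> \<integral> |\<nabla>f \<bullet> z| powr p\<close>, and \<open>\<phi>(t \<xi>) / t powr p\<close> has lower limit at least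
  \<open>\<integral> |\<nabla>f \<bullet> \<xi>| powr p\<close> as \<open>t \<rightarrow> 0\<close>. Splitting the integral in \<open>H\<close> at the optimal \<open>t\<close> bounds \<open>H\<close> by
  the gradient gauge and the norm of \<open>f\<close>, hence \<open>|K| powr (- s / n)\<close> from above. For (b) the norm is
  absorbed by a Poincare inequality, which holds because shifts that change \<open>f\<close> little must keep much
  of its support inside itself. For (c) the same bound is sharp in the limit; conversely the sets
  \<open>{p (1 - s) H \<le> 1}\<close> lie in a common set of finite measure and their indicators converge to zero
  outside of the polar projection body.
\<close>

declare closed_cball[THEN borel_closed, measurable]

section \<open>Affine changes of variables and homogeneous functions\<close>

lemma nn_integral_lborel_affine:
  fixes u :: "'a::euclidean_space \<Rightarrow> ennreal"
  assumes [measurable]: "u \<in> borel_measurable borel" and "c \<noteq> 0"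
  shows "(\<integral>\<^sup>+x. u x \<partial>lborel) = ennreal (\<bar>c\<bar> ^ DIM('a)) * (\<integral>\<^sup>+x. u (a + c *\<^sub>R x) \<partial>lborel)"
  by (subst lborel_affine[OF \<open>c \<noteq> 0\<close>, of a])
     (simp add: nn_integral_density nn_integral_distr nn_integral_cmult)

lemma nn_integral_lborel_translate:
  fixes u :: "'a::euclidean_space \<Rightarrow> ennreal"
  assumes "u \<in> borel_measurable borel"
  shows "(\<integral>\<^sup>+x. u (x + a) \<partial>lborel) = (\<integral>\<^sup>+x. u x \<partial>lborel)"
  using nn_integral_lborel_affine[OF assms, of 1 a] by (simp add: add.commute)

lemma integral_lborel_translate:
  fixes u :: "'a::euclidean_space \<Rightarrow> real"
  assumes [measurable]: "u \<in> borel_measurable borel"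
  shows "(\<integral>x. u (x + a) \<partial>lborel) = (\<integral>x. u x \<partial>lborel)"
proof -
  have "(\<integral>x. u x \<partial>distr lborel borel ((+) a)) = (\<integral>x. u (a + x) \<partial>lborel)"
    by (rule integral_distr) auto
  then show ?thesis by (simp add: lborel_distr_plus add.commute)
qed

lemma AE_lborel_translate:
  fixes P :: "'a::euclidean_space \<Rightarrow> bool"
  assumes "AE x in lborel. P x"
  shows "AE x in lborel. P (x + a)"
proof -
  obtain N where N_null: "N \<in> null_sets lborel" "{x. \<not> P x} \<subseteq> N"
    using assms unfolding eventually_ae_filter by auto
  show ?thesis
    using null_sets_translation[OF N_null(1), of "-a"] N_null(2)
    by (intro AE_I'[of "{x. x - (-a) \<in> N}"]) auto
qed

lemma emeasure_lborel_homogeneous_sublevel: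
  fixes H :: "'a::euclidean_space \<Rightarrow> ennreal"
  assumes [measurable]: "H \<in> borel_measurable borel"
    and homogeneous: "\<And>r \<xi>. r > 0 \<Longrightarrow> H (r *\<^sub>R \<xi>) = ennreal (r powr q) * H \<xi>"
    and "q \<noteq> 0" "c > 0"
  shows "emeasure lborel {\<xi>. H \<xi> \<le> ennreal c} =
    ennreal (c powr (real DIM('a) / q)) * emeasure lborel {\<xi>. H \<xi> \<le> 1}"
proof -
  define r where "r = c powr (1 / q)"
  have r_root: "r > 0" "r powr q = c"
    using assms by (auto simp: r_def powr_powr)
  have r_power: "r ^ DIM('a) = c powr (real DIM('a) / q)"
    using \<open>c > 0\<close> by (simp add: r_def powr_powr flip: powr_realpow)
  have level_iff: "H (r *\<^sub>R \<xi>) \<le> ennreal c \<longleftrightarrow> H \<xi> \<le> 1" for \<xi>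
    using homogeneous[OF r_root(1), of \<xi>] r_root \<open>c > 0\<close> ennreal_mult_le_mult_iff[of "ennreal c" "H \<xi>" 1]
    by simp
  have "emeasure lborel {\<xi>. H \<xi> \<le> ennreal c} = (\<integral>\<^sup>+\<xi>. indicator {\<xi>. H \<xi> \<le> ennreal c} \<xi> \<partial>lborel)"
    by (rule nn_integral_indicator[symmetric]) measurable
  also have "\<dots> = ennreal (\<bar>r\<bar> ^ DIM('a)) * (\<integral>\<^sup>+\<xi>. indicator {\<xi>. H \<xi> \<le> ennreal c} (0 + r *\<^sub>R \<xi>) \<partial>lborel)"
    using r_root by (intro nn_integral_lborel_affine) auto
  also have "(\<lambda>\<xi>. indicator {\<xi>. H \<xi> \<le> ennreal c} (0 + r *\<^sub>R \<xi>)) =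
      (indicator {\<xi>. H \<xi> \<le> 1} :: 'a \<Rightarrow> ennreal)"
    by (auto simp: level_iff indicator_def)
  finally show ?thesis using r_root(1) r_power by simp
qed

section \<open>Powers and means\<close>

lemma le_one_plus_powr:
  fixes t p :: real
  assumes "t \<ge> 0" "p \<ge> 1"
  shows "t \<le> 1 + t powr p"
  using assms powr_mono[of 1 p t] by (cases "t \<le> 1") (auto simp: add_increasing2)

lemma convex_on_abs_powr:
  fixes p :: real
  assumes "p \<ge> 1"
  shows "convex_on UNIV (\<lambda>x::real. \<bar>x\<bar> powr p)"
proof (rule convex_onI)
  fix t x y :: real
  assume t_bounds: "0 < t" "t < 1"
  have powr_le_self: "u powr p \<le> u" if "0 < u" "u < 1" for u :: real
    using powr_mono'[of 1 p u] that assms by simp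
  have convex_nonneg: "((1 - t) * a + t * b) powr p \<le> (1 - t) * a powr p + t * b powr p"
    if "a \<ge> 0" "b \<ge> 0" for a b :: real
  proof (cases "a = 0 \<or> b = 0")
    case True
    then show ?thesis
      using that t_bounds powr_le_self[of t] powr_le_self[of "1 - t"]
      by (auto simp: powr_mult mult_right_mono)
  next
    case False
    then show ?thesis
      using that t_bounds convex_onD[OF powr_convex[OF assms], of t a b] by simp
  qed
  have "\<bar>(1 - t) *\<^sub>R x + t *\<^sub>R y\<bar> powr p \<le> ((1 - t) * \<bar>x\<bar> + t * \<bar>y\<bar>) powr p"
    using t_bounds assms abs_triangle_ineq[of "(1 - t) * x" "t * y"]
    by (intro powr_mono2) (auto simp: abs_mult)
  also have "\<dots> \<le> (1 - t) * \<bar>x\<bar> powr p + t * \<bar>y\<bar> powr p"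
    by (rule convex_nonneg) auto
  finally show "\<bar>(1 - t) *\<^sub>R x + t *\<^sub>R y\<bar> powr p \<le> (1 - t) * \<bar>x\<bar> powr p + t * \<bar>y\<bar> powr p" .
qed simp

lemma abs_add_powr_le:
  fixes a b p :: real
  assumes "p \<ge> 1"
  shows "\<bar>a + b\<bar> powr p \<le> 2 powr (p - 1) * (\<bar>a\<bar> powr p + \<bar>b\<bar> powr p)"
  using convex_onD[OF convex_on_abs_powr[OF assms], of "1/2" "2 * a" "2 * b"]
  by (simp add: abs_mult powr_mult powr_diff field_simps)

lemma (in finite_measure) integrable_if_powr_integral_finite:
  fixes X :: "'a \<Rightarrow> real"
  assumes [measurable]: "X \<in> borel_measurable M" and "p \<ge> 1"
    and powr_integral_finite: "(\<integral>\<^sup>+x. ennreal (\<bar>X x\<bar> powr p) \<partial>M) < \<infinity>"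
  shows "integrable M X"
proof (rule Bochner_Integration.integrable_bound)
  have "integrable M (\<lambda>x. \<bar>X x\<bar> powr p)"
    using powr_integral_finite by (intro integrableI_nonneg) auto
  then show "integrable M (\<lambda>x. 1 + \<bar>X x\<bar> powr p)" by simp
  show "AE x in M. norm (X x) \<le> norm (1 + \<bar>X x\<bar> powr p)"
    using \<open>p \<ge> 1\<close> by (simp add: le_one_plus_powr)
qed measurable

lemma (in prob_space) abs_expectation_powr_le:
  assumes p_ge_1: "p \<ge> 1" and [measurable]: "X \<in> borel_measurable M"
  shows "ennreal (\<bar>expectation X\<bar> powr p) \<le> (\<integral>\<^sup>+x. ennreal (\<bar>X x\<bar> powr p) \<partial>M)"
proof (cases "(\<integral>\<^sup>+x. ennreal (\<bar>X x\<bar> powr p) \<partial>M) < \<infinity>")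
  case True
  then have integrable_powr: "integrable M (\<lambda>x. \<bar>X x\<bar> powr p)"
    by (intro integrableI_nonneg) auto
  have "\<bar>expectation X\<bar> powr p \<le> expectation (\<lambda>x. \<bar>X x\<bar> powr p)"
    by (rule jensens_inequality[where I = UNIV])
       (auto intro: integrable_if_powr_integral_finite p_ge_1 True integrable_powr
             convex_on_abs_powr[OF p_ge_1])
  then have "ennreal (\<bar>expectation X\<bar> powr p) \<le> ennreal (expectation (\<lambda>x. \<bar>X x\<bar> powr p))"
    by (rule ennreal_leI)
  also have "\<dots> = (\<integral>\<^sup>+x. ennreal (\<bar>X x\<bar> powr p) \<partial>M)"
    by (rule nn_integral_eq_integral[OF integrable_powr, symmetric]) auto
  finally show ?thesis .
qed (simp add: not_less top_unique)

lemma
  assumes "0 < emeasure M A" "emeasure M A < \<infinity>"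
  shows emeasure_eq_measure_if_pos_finite: "emeasure M A = ennreal (measure M A)"
    and measure_pos_if_pos_finite: "measure M A > 0"
  using assms
  by (auto intro: emeasure_eq_ennreal_measure simp: less_top[symmetric] measure_def enn2real_positive_iff)

definition mean_on :: "'a::euclidean_space set \<Rightarrow> ('a \<Rightarrow> real) \<Rightarrow> real" where
  "mean_on A u = (\<integral>x\<in>A. u x \<partial>lborel) / measure lborel A"

lemma mean_on_eq_integral_uniform_measure:
  fixes u :: "'a::euclidean_space \<Rightarrow> real"
  assumes [measurable]: "u \<in> borel_measurable borel"
    and A_measure: "0 < emeasure lborel A" "emeasure lborel A < \<infinity>"
  shows "mean_on A u = (\<integral>x. u x \<partial>uniform_measure lborel A)"
proof -
  have [measurable]: "A \<in> sets borel" using A_measure(1) emeasure_neq_0_sets[of lborel A] by auto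
  have "uniform_measure lborel A = density lborel (\<lambda>x. ennreal (indicator A x / measure lborel A))"
    unfolding uniform_measure_def emeasure_eq_measure_if_pos_finite[OF A_measure]
    using measure_pos_if_pos_finite[OF A_measure]
    by (intro arg_cong2[where f = density])
      (auto simp: fun_eq_iff divide_ennreal simp flip: ennreal_1 split: split_indicator)
  then show ?thesis
    by (simp add: mean_on_def set_lebesgue_integral_def integral_density)
qed

lemma mean_on_diff_const_powr_le:
  fixes u :: "'a::euclidean_space \<Rightarrow> real"
  assumes p_ge_1: "p \<ge> 1" and [measurable]: "u \<in> borel_measurable borel"
    and A_measure: "0 < emeasure lborel A" "emeasure lborel A < \<infinity>"
    and powr_integral_finite: "(\<integral>\<^sup>+x\<in>A. ennreal (\<bar>u x\<bar> powr p) \<partial>lborel) < \<infinity>"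
  shows "ennreal (\<bar>mean_on A u - c\<bar> powr p) \<le>
      (\<integral>\<^sup>+x\<in>A. ennreal (\<bar>u x - c\<bar> powr p) \<partial>lborel) / emeasure lborel A"
proof -
  have [measurable]: "A \<in> sets borel" using A_measure(1) emeasure_neq_0_sets[of lborel A] by auto
  interpret uniform: prob_space "uniform_measure lborel A"
    using A_measure by (intro prob_space_uniform_measure) auto
  have "(\<integral>\<^sup>+x. ennreal (\<bar>u x\<bar> powr p) \<partial>uniform_measure lborel A) < \<infinity>"
    using powr_integral_finite A_measure
    by (auto simp: nn_integral_uniform_measure ennreal_divide_eq_top_iff simp flip: less_top)
  then have "integrable (uniform_measure lborel A) u"
    using p_ge_1 by (intro uniform.integrable_if_powr_integral_finite[of _ p]) auto
  then have "mean_on A u - c = (\<integral>x. u x - c \<partial>uniform_measure lborel A)"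
    using A_measure measure_pos_if_pos_finite[OF A_measure]
    by (simp add: mean_on_eq_integral_uniform_measure)
  then have "ennreal (\<bar>mean_on A u - c\<bar> powr p) \<le>
      (\<integral>\<^sup>+x. ennreal (\<bar>u x - c\<bar> powr p) \<partial>uniform_measure lborel A)"
    using uniform.abs_expectation_powr_le[OF p_ge_1, of "\<lambda>x. u x - c"] by simp
  then show ?thesis by (simp add: nn_integral_uniform_measure)
qed

section \<open>Shift energies\<close>

definition Lp_pow :: "real \<Rightarrow> ('a::euclidean_space \<Rightarrow> real) \<Rightarrow> ennreal" where
  "Lp_pow p u = (\<integral>\<^sup>+x. ennreal (\<bar>u x\<bar> powr p) \<partial>lborel)"

definition shift_energy :: "real \<Rightarrow> ('a::euclidean_space \<Rightarrow> real) \<Rightarrow> 'a \<Rightarrow> ennreal" where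
  "shift_energy p f z = Lp_pow p (\<lambda>x. f (x + z) - f x)"

lemma Lp_pow_measurable [measurable (raw)]:
  fixes u :: "'b \<Rightarrow> 'a::euclidean_space \<Rightarrow> real"
  assumes [measurable]: "(\<lambda>(y, x). u y x) \<in> borel_measurable (M \<Otimes>\<^sub>M borel)"
  shows "(\<lambda>y. Lp_pow p (u y)) \<in> borel_measurable M"
  unfolding Lp_pow_def by measurable

lemma Lp_pow_cong_AE: "AE x in lborel. u x = v x \<Longrightarrow> Lp_pow p u = Lp_pow p v"
  unfolding Lp_pow_def by (rule nn_integral_cong_AE) auto

lemma Lp_pow_translate:
  assumes [measurable]: "u \<in> borel_measurable borel"
  shows "Lp_pow p (\<lambda>x. u (x + a)) = Lp_pow p u"
  unfolding Lp_pow_def by (rule nn_integral_lborel_translate) measurable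

lemma set_nn_integral_le_Lp_pow: "(\<integral>\<^sup>+x\<in>A. ennreal (\<bar>u x\<bar> powr p) \<partial>lborel) \<le> Lp_pow p u"
  unfolding Lp_pow_def by (intro nn_integral_mono) (auto split: split_indicator)

lemma set_nn_integral_shift_le_Lp_pow:
  assumes "u \<in> borel_measurable borel"
  shows "(\<integral>\<^sup>+z\<in>A. ennreal (\<bar>u (x + z)\<bar> powr p) \<partial>lborel) \<le> Lp_pow p u"
  using set_nn_integral_le_Lp_pow[of "\<lambda>z. u (z + x)" p A]
  by (simp add: Lp_pow_translate[OF assms] add.commute)

lemma Lp_pow_cmult:
  assumes [measurable]: "u \<in> borel_measurable borel"
  shows "Lp_pow p (\<lambda>x. c * u x) = ennreal (\<bar>c\<bar> powr p) * Lp_pow p u"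
  unfolding Lp_pow_def
  by (subst nn_integral_cmult[symmetric]) (auto simp: abs_mult powr_mult ennreal_mult)

lemma Lp_pow_add_le:
  assumes [measurable]: "u \<in> borel_measurable borel" "v \<in> borel_measurable borel" and p_ge_1: "p \<ge> 1"
  shows "Lp_pow p (\<lambda>x. u x + v x) \<le> ennreal (2 powr (p - 1)) * (Lp_pow p u + Lp_pow p v)"
proof -
  have "Lp_pow p (\<lambda>x. u x + v x) \<le>
      (\<integral>\<^sup>+x. ennreal (2 powr (p - 1)) * (ennreal (\<bar>u x\<bar> powr p) + ennreal (\<bar>v x\<bar> powr p)) \<partial>lborel)"
    unfolding Lp_pow_def
    using abs_add_powr_le[OF p_ge_1]
    by (intro nn_integral_mono) (auto simp flip: ennreal_plus ennreal_mult' intro!: ennreal_leI)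
  also have "\<dots> = ennreal (2 powr (p - 1)) * (Lp_pow p u + Lp_pow p v)"
    by (simp add: nn_integral_cmult nn_integral_add Lp_pow_def)
  finally show ?thesis .
qed

lemma Lp_pow_eq_0_iff:
  assumes [measurable]: "u \<in> borel_measurable borel"
  shows "Lp_pow p u = 0 \<longleftrightarrow> emeasure lborel (supp_set u) = 0"
proof -
  have "supp_set u \<in> sets lborel" unfolding supp_set_def by measurable
  then have "emeasure lborel (supp_set u) = 0 \<longleftrightarrow> (AE x in lborel. u x = 0)"
    by (subst AE_iff_measurable[of "supp_set u"]) (auto simp: supp_set_def)
  then show ?thesis unfolding Lp_pow_def by (simp add: nn_integral_0_iff_AE)
qed

lemma integrable_mult_if_powr_integral_finite:
  fixes f \<eta> :: "'a::euclidean_space \<Rightarrow> real"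
  assumes [measurable]: "f \<in> borel_measurable borel" "\<eta> \<in> borel_measurable borel" "A \<in> sets borel"
    and p_ge_1: "p \<ge> 1" and A_measure: "emeasure lborel A < \<infinity>"
    and powr_integral_finite: "(\<integral>\<^sup>+x\<in>A. ennreal (\<bar>f x\<bar> powr p) \<partial>lborel) < \<infinity>"
    and bound: "\<And>x. \<bar>\<eta> x\<bar> \<le> C * indicator A x"
  shows "integrable lborel (\<lambda>x. f x * \<eta> x)"
proof (rule Bochner_Integration.integrable_bound)
  have "(\<integral>\<^sup>+x. ennreal (indicator A x * \<bar>f x\<bar> powr p) \<partial>lborel) < \<infinity>"
    using powr_integral_finite by (simp add: ennreal_mult' ennreal_indicator mult.commute)
  then have "integrable lborel (\<lambda>x. indicator A x * \<bar>f x\<bar> powr p)"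
    by (intro integrableI_nonneg) auto
  then show "integrable lborel (\<lambda>x. C * (indicator A x + indicator A x * \<bar>f x\<bar> powr p))"
    using A_measure
    by (intro integrable_mult_right Bochner_Integration.integrable_add integrable_real_indicator) auto
  show "AE x in lborel. norm (f x * \<eta> x) \<le> norm (C * (indicator A x + indicator A x * \<bar>f x\<bar> powr p))"
  proof (rule AE_I2)
    fix x
    have "\<bar>f x\<bar> * \<bar>\<eta> x\<bar> \<le> (1 + \<bar>f x\<bar> powr p) * (C * indicator A x)"
      using p_ge_1 bound[of x] by (intro mult_mono le_one_plus_powr) auto
    also have "\<dots> = C * (indicator A x + indicator A x * \<bar>f x\<bar> powr p)"
      by (simp add: algebra_simps)
    also have "\<dots> \<le> \<bar>C * (indicator A x + indicator A x * \<bar>f x\<bar> powr p)\<bar>"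
      by (rule abs_ge_self)
    finally show "norm (f x * \<eta> x) \<le> norm (C * (indicator A x + indicator A x * \<bar>f x\<bar> powr p))"
      by (simp only: real_norm_def abs_mult)
  qed
qed measurable

lemma shift_energy_cong_AE:
  assumes "AE x in lborel. f x = f' x"
  shows "shift_energy p f z = shift_energy p f' z"
  unfolding shift_energy_def
  using assms AE_lborel_translate[OF assms, of z] by (intro Lp_pow_cong_AE) auto

lemma shift_energy_measurable [measurable]:
  assumes [measurable]: "f \<in> borel_measurable borel"
  shows "shift_energy p f \<in> borel_measurable borel"
  unfolding shift_energy_def[abs_def] by measurable

lemma shift_energy_add_le:
  assumes [measurable]: "f \<in> borel_measurable borel" and "p \<ge> 1"
  shows "shift_energy p f (z + w) \<le> ennreal (2 powr (p - 1)) * (shift_energy p f z + shift_energy p f w)"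
proof -
  let ?u = "\<lambda>x. f ((x + w) + z) - f (x + w)"
  have "shift_energy p f (z + w) = Lp_pow p (\<lambda>x. ?u x + (f (x + w) - f x))"
    by (simp add: shift_energy_def add_ac)
  also have "\<dots> \<le> ennreal (2 powr (p - 1)) * (Lp_pow p ?u + shift_energy p f w)"
    unfolding shift_energy_def using assms by (intro Lp_pow_add_le) auto
  also have "Lp_pow p ?u = shift_energy p f z"
    unfolding shift_energy_def by (rule Lp_pow_translate[of "\<lambda>x. f (x + z) - f x"]) measurable
  finally show ?thesis .
qed

lemma shift_energy_minus:
  assumes [measurable]: "f \<in> borel_measurable borel"
  shows "shift_energy p f (- z) = shift_energy p f z"
  using Lp_pow_translate[of "\<lambda>x. f (x + - z) - f x" p z]
  by (simp add: shift_energy_def Lp_pow_def abs_minus_commute)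

lemma ennreal_two_powr_mult_add:
  "ennreal (2 powr (p - 1)) * (a + a) = ennreal (2 powr p) * a"
proof -
  have "ennreal (2 powr (p - 1)) * 2 = ennreal (2 powr (p - 1) * 2)"
    by (simp add: ennreal_mult)
  also have "2 powr (p - 1) * 2 = (2 :: real) powr p"
    by (simp add: powr_diff)
  finally show ?thesis by (metis mult_2 mult.assoc)
qed

lemma shift_energy_double_le:
  assumes "f \<in> borel_measurable borel" and "p \<ge> 1"
  shows "shift_energy p f (2 *\<^sub>R z) \<le> ennreal (2 powr p) * shift_energy p f z"
  using shift_energy_add_le[OF assms, of z z] by (simp add: scaleR_2 ennreal_two_powr_mult_add)

lemma shift_energy_le_Lp_pow:
  assumes [measurable]: "f \<in> borel_measurable borel" and "p \<ge> 1"
  shows "shift_energy p f z \<le> ennreal (2 powr p) * Lp_pow p f"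
proof -
  have "shift_energy p f z \<le>
      ennreal (2 powr (p - 1)) * (Lp_pow p (\<lambda>x. f (x + z)) + Lp_pow p (\<lambda>x. - f x))"
    using Lp_pow_add_le[of "\<lambda>x. f (x + z)" "\<lambda>x. - f x" p] assms by (simp add: shift_energy_def)
  also have "Lp_pow p (\<lambda>x. - f x) = Lp_pow p f" by (simp add: Lp_pow_def)
  finally show ?thesis by (simp add: Lp_pow_translate ennreal_two_powr_mult_add)
qed

lemma nn_integral_set_shift_energy:
  fixes f :: "'a::euclidean_space \<Rightarrow> real"
  assumes [measurable]: "f \<in> borel_measurable borel" "E \<in> sets borel"
  shows "(\<integral>\<^sup>+x. (\<integral>\<^sup>+z\<in>E. ennreal (\<bar>f (x + z) - f x\<bar> powr p) \<partial>lborel) \<partial>lborel) =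
      (\<integral>\<^sup>+z\<in>E. shift_energy p f z \<partial>lborel)"
proof -
  have "(\<integral>\<^sup>+x. (\<integral>\<^sup>+z\<in>E. ennreal (\<bar>f (x + z) - f x\<bar> powr p) \<partial>lborel) \<partial>lborel) =
      (\<integral>\<^sup>+z. \<integral>\<^sup>+x. ennreal (\<bar>f (x + z) - f x\<bar> powr p) * indicator E z \<partial>lborel \<partial>lborel)"
    by (rule lborel_pair.Fubini') measurable
  then show ?thesis by (simp add: nn_integral_multc shift_energy_def Lp_pow_def)
qed

text \<open>For fixed \<open>x\<close>, the shifts \<open>z \<in> E\<close> that keep \<open>x + z\<close> inside the support of \<open>f\<close>
  have total measure at most that of the support; every other shift contributes at least \<open>\<bar>f x\<bar> powr p\<close>.\<close>
lemma Lp_pow_times_emeasure_le: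
  fixes f :: "'a::euclidean_space \<Rightarrow> real"
  assumes [measurable]: "f \<in> borel_measurable borel" "E \<in> sets borel"
  shows "Lp_pow p f * emeasure lborel E \<le>
    (\<integral>\<^sup>+z\<in>E. shift_energy p f z \<partial>lborel) + Lp_pow p f * emeasure lborel (supp_set f)"
proof -
  let ?u = "\<lambda>x. ennreal (\<bar>f x\<bar> powr p)"
  have [measurable]: "supp_set f \<in> sets borel" unfolding supp_set_def by measurable
  have "Lp_pow p f * emeasure lborel E = (\<integral>\<^sup>+x. \<integral>\<^sup>+z. ?u x * indicator E z \<partial>lborel \<partial>lborel)"
    by (simp add: nn_integral_cmult nn_integral_multc Lp_pow_def)
  also have "\<dots> \<le> (\<integral>\<^sup>+x. \<integral>\<^sup>+z. ennreal (\<bar>f (x + z) - f x\<bar> powr p) * indicator E z +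
      ?u x * indicator (supp_set f) (z + x) \<partial>lborel \<partial>lborel)"
    by (intro nn_integral_mono) (auto simp: supp_set_def add.commute split: split_indicator)
  also have "\<dots> = (\<integral>\<^sup>+z\<in>E. shift_energy p f z \<partial>lborel) +
      (\<integral>\<^sup>+x. ?u x * (\<integral>\<^sup>+z. indicator (supp_set f) (z + x) \<partial>lborel) \<partial>lborel)"
    by (simp add: nn_integral_add nn_integral_cmult nn_integral_set_shift_energy)
  also have "(\<integral>\<^sup>+x. ?u x * (\<integral>\<^sup>+z. indicator (supp_set f) (z + x) \<partial>lborel) \<partial>lborel) =
      Lp_pow p f * emeasure lborel (supp_set f)"
    by (subst nn_integral_lborel_translate) (simp_all add: nn_integral_multc Lp_pow_def)
  finally show ?thesis .
qed

definition small_shifts :: "real \<Rightarrow> ('a::euclidean_space \<Rightarrow> real) \<Rightarrow> 'a set" where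
  "small_shifts p f = {z. shift_energy p f z \<le> Lp_pow p f / 2}"

lemma small_shifts_sets [measurable]:
  assumes [measurable]: "f \<in> borel_measurable borel"
  shows "small_shifts p f \<in> sets borel"
  unfolding small_shifts_def by measurable

lemma emeasure_bounded_small_shifts_le:
  fixes f :: "'a::euclidean_space \<Rightarrow> real"
  assumes [measurable]: "f \<in> borel_measurable borel" "E \<in> sets borel"
    and E_bounded_subset: "bounded E" "E \<subseteq> small_shifts p f"
    and Lp_nonzero_finite: "Lp_pow p f \<noteq> 0" "Lp_pow p f < \<infinity>"
  shows "emeasure lborel E \<le> 2 * emeasure lborel (supp_set f)"
proof -
  define h where "h = Lp_pow p f / 2"
  have "h + h = Lp_pow p f * 2 / 2"
    unfolding h_def by (simp only: mult_2_right[symmetric] ennreal_divide_times ennreal_times_divide)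
  then have half_Lp_pow: "h \<noteq> 0" "h < \<infinity>" "Lp_pow p f = h + h"
    using Lp_nonzero_finite
    by (auto simp: h_def divide_less_ennreal ennreal_mult_less_top mult_divide_eq_ennreal)
  have "h * emeasure lborel E < \<infinity>"
    using half_Lp_pow emeasure_bounded_finite[OF E_bounded_subset(1)]
    by (simp add: ennreal_mult_less_top)
  have "h * emeasure lborel E + h * emeasure lborel E \<le>
      (\<integral>\<^sup>+z\<in>E. shift_energy p f z \<partial>lborel) + Lp_pow p f * emeasure lborel (supp_set f)"
    using Lp_pow_times_emeasure_le[of f E p] by (simp add: half_Lp_pow(3) distrib_right)
  also have "(\<integral>\<^sup>+z\<in>E. shift_energy p f z \<partial>lborel) \<le> (\<integral>\<^sup>+z\<in>E. h \<partial>lborel)"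
    using E_bounded_subset(2)
    by (intro nn_integral_mono) (auto simp: small_shifts_def h_def split: split_indicator)
  also have "\<dots> = h * emeasure lborel E"
    by (simp add: nn_integral_cmult)
  finally have "h * emeasure lborel E \<le> Lp_pow p f * emeasure lborel (supp_set f)"
    using \<open>h * emeasure lborel E < \<infinity>\<close> by (auto simp: add_right_mono ennreal_add_left_cancel_le)
  also have "\<dots> = h * (2 * emeasure lborel (supp_set f))"
    by (simp add: half_Lp_pow(3) distrib_left distrib_right mult_2)
  finally show ?thesis using half_Lp_pow by (subst (asm) ennreal_mult_le_mult_iff) auto
qed

lemma emeasure_small_shifts_le:
  fixes f :: "'a::euclidean_space \<Rightarrow> real"
  assumes [measurable]: "f \<in> borel_measurable borel"
    and Lp_nonzero_finite: "Lp_pow p f \<noteq> 0" "Lp_pow p f < \<infinity>"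
  shows "emeasure lborel (small_shifts p f) \<le> 2 * emeasure lborel (supp_set f)"
proof -
  have "emeasure lborel (small_shifts p f) = emeasure lborel (\<Union>n. small_shifts p f \<inter> ball 0 (real n))"
    by (rule arg_cong[where f = "emeasure lborel"]) (auto simp: reals_Archimedean2)
  also have "\<dots> = (SUP n. emeasure lborel (small_shifts p f \<inter> ball 0 (real n)))"
    by (rule SUP_emeasure_incseq[symmetric]) (auto simp: incseq_def)
  also have "\<dots> \<le> 2 * emeasure lborel (supp_set f)"
    by (intro SUP_least emeasure_bounded_small_shifts_le[OF assms(1) _ _ _ Lp_nonzero_finite]) auto
  finally show ?thesis .
qed

section \<open>Means of shifts\<close>

lemma nn_integral_pairs_le_shift_energy:
  fixes f :: "'a::euclidean_space \<Rightarrow> real"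
  assumes [measurable]: "f \<in> borel_measurable borel" "A \<in> sets borel" "D \<in> sets borel" "B \<in> sets borel"
    and diff_in_B: "\<And>z w. z \<in> A \<Longrightarrow> w \<in> D \<Longrightarrow> z - w \<in> B"
  shows "(\<integral>\<^sup>+z\<in>A. (\<integral>\<^sup>+w\<in>D. ennreal (\<bar>f (x + z) - f (x + w)\<bar> powr p) \<partial>lborel) \<partial>lborel) \<le>
    (\<integral>\<^sup>+z\<in>B. shift_energy p f z \<partial>lborel)"
proof -
  let ?u = "\<lambda>z w. ennreal (\<bar>f (x + z) - f (x + w)\<bar> powr p)"
  have "(\<integral>\<^sup>+z\<in>A. (\<integral>\<^sup>+w\<in>D. ?u z w \<partial>lborel) \<partial>lborel) \<le>
      (\<integral>\<^sup>+z. \<integral>\<^sup>+w. ?u z w * indicator B (z - w) \<partial>lborel \<partial>lborel)"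
    using diff_in_B
    by (subst nn_integral_multc[symmetric]) (auto intro!: nn_integral_mono split: split_indicator)
  also have "\<dots> = (\<integral>\<^sup>+w. \<integral>\<^sup>+z. ?u z w * indicator B (z - w) \<partial>lborel \<partial>lborel)"
    by (rule lborel_pair.Fubini') measurable
  also have "\<dots> = (\<integral>\<^sup>+w. \<integral>\<^sup>+z. ?u (z + w) w * indicator B ((z + w) - w) \<partial>lborel \<partial>lborel)"
    by (intro nn_integral_cong nn_integral_lborel_translate[symmetric]) measurable
  also have "\<dots> = (\<integral>\<^sup>+w. (\<integral>\<^sup>+z\<in>B. ennreal (\<bar>f ((w + x) + z) - f (w + x)\<bar> powr p) \<partial>lborel) \<partial>lborel)"
    by (simp add: add_ac)
  also have "\<dots> = (\<integral>\<^sup>+w. (\<integral>\<^sup>+z\<in>B. ennreal (\<bar>f (w + z) - f w\<bar> powr p) \<partial>lborel) \<partial>lborel)"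
    by (rule nn_integral_lborel_translate) measurable
  finally show ?thesis by (simp add: nn_integral_set_shift_energy)
qed

lemma mean_shift_diff_powr_le:
  fixes f :: "'a::euclidean_space \<Rightarrow> real" and c :: ennreal
  assumes [measurable]: "f \<in> borel_measurable borel" and p_ge_1: "p \<ge> 1" and Lp_finite: "Lp_pow p f < \<infinity>"
    and A_measure: "0 < emeasure lborel A" "emeasure lborel A < \<infinity>"
    and D_measure: "0 < emeasure lborel D" "emeasure lborel D < \<infinity>"
    and [measurable]: "B \<in> sets borel"
    and diff_in_B: "\<And>z w. z \<in> A \<Longrightarrow> w \<in> D \<Longrightarrow> z - w \<in> B"
    and shift_energy_small: "\<And>z. z \<in> B \<Longrightarrow> shift_energy p f z \<le> c"
  shows "ennreal (\<bar>mean_on A (\<lambda>z. f (x + z)) - mean_on D (\<lambda>z. f (x + z))\<bar> powr p) \<le>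
    c * emeasure lborel B / emeasure lborel D / emeasure lborel A"
proof -
  have [measurable]: "A \<in> sets borel" "D \<in> sets borel"
    using A_measure(1) D_measure(1) emeasure_neq_0_sets[of lborel A] emeasure_neq_0_sets[of lborel D]
    by auto
  let ?u = "\<lambda>z w. ennreal (\<bar>f (x + z) - f (x + w)\<bar> powr p)"
  have powr_integral_finite: "(\<integral>\<^sup>+z\<in>E. ennreal (\<bar>f (x + z)\<bar> powr p) \<partial>lborel) < \<infinity>" for E
    by (rule le_less_trans[OF set_nn_integral_shift_le_Lp_pow Lp_finite]) measurable
  have "(\<integral>\<^sup>+z\<in>B. shift_energy p f z \<partial>lborel) \<le> (\<integral>\<^sup>+z\<in>B. c \<partial>lborel)"
    using shift_energy_small by (intro nn_integral_mono) (auto split: split_indicator)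
  then have double_integral: "(\<integral>\<^sup>+z\<in>A. (\<integral>\<^sup>+w\<in>D. ?u z w \<partial>lborel) \<partial>lborel) \<le> c * emeasure lborel B"
    using nn_integral_pairs_le_shift_energy[of f A D B x p] diff_in_B by (simp add: nn_integral_cmult)
  have mean_dist_le: "ennreal (\<bar>f (x + z) - mean_on D (\<lambda>w. f (x + w))\<bar> powr p) \<le>
      (\<integral>\<^sup>+w\<in>D. ?u z w \<partial>lborel) / emeasure lborel D" for z
    using mean_on_diff_const_powr_le[OF p_ge_1 _ D_measure powr_integral_finite, of "f (x + z)"]
    by (simp add: abs_minus_commute)
  have "ennreal (\<bar>mean_on A (\<lambda>z. f (x + z)) - mean_on D (\<lambda>w. f (x + w))\<bar> powr p) \<le>
      (\<integral>\<^sup>+z\<in>A. ennreal (\<bar>f (x + z) - mean_on D (\<lambda>w. f (x + w))\<bar> powr p) \<partial>lborel) / emeasure lborel A"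
    by (rule mean_on_diff_const_powr_le[OF p_ge_1 _ A_measure powr_integral_finite]) measurable
  also have "\<dots> \<le> (\<integral>\<^sup>+z\<in>A. (\<integral>\<^sup>+w\<in>D. ?u z w \<partial>lborel) / emeasure lborel D \<partial>lborel) / emeasure lborel A"
    by (intro divide_right_mono_ennreal nn_integral_mono mult_right_mono mean_dist_le) auto
  also have "\<dots> = (\<integral>\<^sup>+z\<in>A. (\<integral>\<^sup>+w\<in>D. ?u z w \<partial>lborel) \<partial>lborel) / emeasure lborel D / emeasure lborel A"
    by (subst nn_integral_divide[symmetric]) (auto simp: divide_ennreal_def mult_ac)
  also have "\<dots> \<le> c * emeasure lborel B / emeasure lborel D / emeasure lborel A"
    by (intro divide_right_mono_ennreal double_integral)
  finally show ?thesis .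
qed

text \<open>A substitute for the Lebesgue differentiation theorem: the means converge to \<open>f\<close> in \<open>L\<^sup>p\<close>.\<close>
lemma AE_abs_le_if_means_le:
  fixes f :: "'a::euclidean_space \<Rightarrow> real" and c :: "nat \<Rightarrow> ennreal"
  assumes [measurable]: "f \<in> borel_measurable borel" and p_ge_1: "p \<ge> 1" and Lp_finite: "Lp_pow p f < \<infinity>"
    and B_measure: "\<And>j. 0 < emeasure lborel (B j)" "\<And>j. emeasure lborel (B j) < \<infinity>"
    and shift_energy_small: "\<And>j z. z \<in> B j \<Longrightarrow> shift_energy p f z \<le> c j" and "c \<longlonglongrightarrow> 0"
    and means: "\<And>j x. \<bar>mean_on (B j) (\<lambda>z. f (x + z))\<bar> \<le> S"
  shows "AE x in lborel. \<bar>f x\<bar> \<le> S"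
proof -
  define excess where "excess x = max 0 (\<bar>f x\<bar> - S)" for x
  have [measurable]: "excess \<in> borel_measurable borel" unfolding excess_def[abs_def] by measurable
  have "Lp_pow p excess \<le> c j" for j
  proof -
    have [measurable]: "B j \<in> sets borel"
      using B_measure(1)[of j] emeasure_neq_0_sets[of lborel "B j"] by auto
    have "Lp_pow p excess \<le>
        (\<integral>\<^sup>+x. (\<integral>\<^sup>+z\<in>B j. ennreal (\<bar>f (x + z) - f x\<bar> powr p) \<partial>lborel) / emeasure lborel (B j) \<partial>lborel)"
      unfolding Lp_pow_def
    proof (rule nn_integral_mono)
      fix x
      have powr_integral_finite: "(\<integral>\<^sup>+z\<in>B j. ennreal (\<bar>f (x + z)\<bar> powr p) \<partial>lborel) < \<infinity>"
        by (rule le_less_trans[OF set_nn_integral_shift_le_Lp_pow Lp_finite]) measurable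
      have "\<bar>excess x\<bar> \<le> \<bar>mean_on (B j) (\<lambda>z. f (x + z)) - f x\<bar>"
        using means[of j x] by (auto simp: excess_def)
      then have "ennreal (\<bar>excess x\<bar> powr p) \<le> ennreal (\<bar>mean_on (B j) (\<lambda>z. f (x + z)) - f x\<bar> powr p)"
        using p_ge_1 by (intro ennreal_leI powr_mono2) auto
      also have "\<dots> \<le> (\<integral>\<^sup>+z\<in>B j. ennreal (\<bar>f (x + z) - f x\<bar> powr p) \<partial>lborel) / emeasure lborel (B j)"
        by (rule mean_on_diff_const_powr_le[OF p_ge_1 _ B_measure powr_integral_finite]) measurable
      finally show "ennreal (\<bar>excess x\<bar> powr p) \<le>
          (\<integral>\<^sup>+z\<in>B j. ennreal (\<bar>f (x + z) - f x\<bar> powr p) \<partial>lborel) / emeasure lborel (B j)" .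
    qed
    also have "\<dots> = (\<integral>\<^sup>+z\<in>B j. shift_energy p f z \<partial>lborel) / emeasure lborel (B j)"
      by (simp add: nn_integral_divide nn_integral_set_shift_energy)
    also have "\<dots> \<le> (\<integral>\<^sup>+z\<in>B j. c j \<partial>lborel) / emeasure lborel (B j)"
      using shift_energy_small
      by (intro divide_right_mono_ennreal nn_integral_mono) (auto split: split_indicator)
    also have "\<dots> = c j"
      using B_measure[of j] by (simp add: nn_integral_cmult mult_divide_eq_ennreal)
    finally show ?thesis .
  qed
  then have "Lp_pow p excess \<le> 0"
    using \<open>c \<longlonglongrightarrow> 0\<close> by (intro LIMSEQ_le_const) auto
  then have "AE x in lborel. excess x = 0"
    by (simp add: Lp_pow_def nn_integral_0_iff_AE)
  then show ?thesis by eventually_elim (simp add: excess_def max_def split: if_splits)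
qed

section \<open>Fractional gauges\<close>

definition gauge_weight :: "real \<Rightarrow> real \<Rightarrow> ennreal" where
  "gauge_weight q t = indicator {0<..} t * ennreal (t powr (- q) / t)"

lemma gauge_weight_measurable [measurable]: "gauge_weight q \<in> borel_measurable borel"
  unfolding gauge_weight_def[abs_def] by measurable

lemma gauge_weight_dilate:
  assumes "r > 0"
  shows "gauge_weight q (r * t) = ennreal (r powr (- q) / r) * gauge_weight q t"
  using assms
  by (auto simp: gauge_weight_def zero_less_mult_iff powr_mult simp flip: ennreal_mult'
      split: split_indicator)

lemma gauge_weight_mult_powr:
  "gauge_weight q t * ennreal (t powr a) = gauge_weight (q - a) t"
proof -
  have "t powr (- q) / t * t powr a = t powr (- (q - a)) / t"
    by (simp add: powr_add[symmetric])
  then show ?thesis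
    by (auto simp: gauge_weight_def simp flip: ennreal_mult'' split: split_indicator)
qed

lemma nn_integral_gauge_weight_atLeast:
  assumes "a > 0" "q > 0"
  shows "(\<integral>\<^sup>+t\<in>{a..}. gauge_weight q t \<partial>lborel) = ennreal (a powr (- q) / q)"
proof -
  have "(\<integral>\<^sup>+t\<in>{a..}. gauge_weight q t \<partial>lborel) = (\<integral>\<^sup>+t\<in>{a..}. ennreal (t powr (- q) / t) \<partial>lborel)"
    using assms by (intro nn_integral_cong) (auto simp: gauge_weight_def split: split_indicator)
  also have "\<dots> = ennreal (0 - (- (a powr (- q) / q)))"
  proof (rule nn_integral_FTC_atLeast)
    fix x assume "a \<le> x"
    then have "x > 0" using assms by simp
    then show "((\<lambda>t. - (t powr (- q) / q)) has_real_derivative x powr (- q) / x) (at x)"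
      using assms by (auto intro!: derivative_eq_intros simp: powr_diff field_simps)
    show "0 \<le> x powr (- q) / x" using \<open>x > 0\<close> by simp
  next
    have "((\<lambda>t. - (t powr (- q) / q)) \<longlongrightarrow> - (0 / q)) at_top"
      using assms by (intro tendsto_intros tendsto_neg_powr filterlim_ident) auto
    then show "((\<lambda>t. - (t powr (- q) / q)) \<longlongrightarrow> 0) at_top" by simp
  qed measurable
  finally show ?thesis by simp
qed

lemma nn_integral_gauge_weight_lessThan:
  assumes "T > 0" "q < 0"
  shows "(\<integral>\<^sup>+t\<in>{..<T}. gauge_weight q t \<partial>lborel) = ennreal (T powr (- q) / (- q))"
proof -
  let ?w = "\<lambda>t. indicator {0<..<T} t * (t powr (- q) / t)"
  have "((\<lambda>t. t powr (- q - 1)) has_integral (T powr (- q) / (- q))) {0..T}"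
    using has_integral_powr_from_0[of "- q - 1" T] assms by simp
  then have "(?w has_integral (T powr (- q) / (- q))) {0..T}"
    by (rule has_integral_spike[of "{0, T}", rotated 2]) (auto simp: powr_diff)
  moreover have "(\<lambda>t. if t \<in> {0..T} then ?w t else 0) = ?w"
    by (auto split: split_indicator)
  ultimately have "(?w has_integral (T powr (- q) / (- q))) UNIV"
    using has_integral_restrict_UNIV[of "{0..T}" ?w] by simp
  then have "(\<integral>\<^sup>+t. ennreal (?w t) \<partial>lborel) = ennreal (T powr (- q) / (- q))"
    by (intro nn_integral_has_integral_lborel) (auto split: split_indicator)
  moreover have "gauge_weight q t * indicator {..<T} t = ennreal (?w t)" for t
    by (auto simp: gauge_weight_def split: split_indicator)
  ultimately show ?thesis by simp
qed

definition frac_gauge_on :: "real set \<Rightarrow> real \<Rightarrow> real \<Rightarrow> ('a::euclidean_space \<Rightarrow> real) \<Rightarrow> 'a \<Rightarrow> ennreal" where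
  "frac_gauge_on I s p f \<xi> = (\<integral>\<^sup>+t\<in>I. gauge_weight (s * p) t * shift_energy p f (t *\<^sub>R \<xi>) \<partial>lborel)"

lemma frac_gauge_pow_eq:
  "frac_gauge_pow s p f \<xi> = (\<integral>\<^sup>+t. gauge_weight (s * p) t * shift_energy p f (t *\<^sub>R \<xi>) \<partial>lborel)"
  by (simp add: frac_gauge_pow_def gauge_weight_def shift_energy_def Lp_pow_def nn_integral_completion)

lemma frac_gauge_on_le: "frac_gauge_on I s p f \<xi> \<le> frac_gauge_pow s p f \<xi>"
  unfolding frac_gauge_on_def frac_gauge_pow_eq by (intro nn_integral_mono) (simp split: split_indicator)

lemma frac_gauge_pow_cong_AE:
  assumes "AE x in lborel. f x = f' x"
  shows "frac_gauge_pow s p f = frac_gauge_pow s p f'"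
  by (rule ext) (simp add: frac_gauge_pow_eq shift_energy_cong_AE[OF assms])

lemma frac_gauge_pow_measurable [measurable]:
  fixes f :: "'a::euclidean_space \<Rightarrow> real"
  assumes [measurable]: "f \<in> borel_measurable borel"
  shows "frac_gauge_pow s p f \<in> borel_measurable borel"
  unfolding frac_gauge_pow_eq[abs_def] by measurable

lemma frac_gauge_pow_scaleR:
  fixes f :: "'a::euclidean_space \<Rightarrow> real"
  assumes [measurable]: "f \<in> borel_measurable borel" and r_pos: "r > 0"
  shows "frac_gauge_pow s p f (r *\<^sub>R \<xi>) = ennreal (r powr (s * p)) * frac_gauge_pow s p f \<xi>"
proof -
  let ?q = "s * p"
  have "frac_gauge_pow s p f (r *\<^sub>R \<xi>) =
      ennreal \<bar>1 / r\<bar> *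
        (\<integral>\<^sup>+t. gauge_weight ?q (0 + 1 / r * t) * shift_energy p f ((0 + 1 / r * t) *\<^sub>R r *\<^sub>R \<xi>) \<partial>lborel)"
    unfolding frac_gauge_pow_eq using r_pos by (intro nn_integral_real_affine) auto
  also have "\<dots> = ennreal (1 / r) * (\<integral>\<^sup>+t. ennreal ((1 / r) powr (- ?q) / (1 / r)) *
      (gauge_weight ?q t * shift_energy p f (t *\<^sub>R \<xi>)) \<partial>lborel)"
    using r_pos gauge_weight_dilate[of "1 / r" ?q] by (simp add: mult.assoc)
  also have "\<dots> = ennreal (1 / r) * ennreal ((1 / r) powr (- ?q) / (1 / r)) * frac_gauge_pow s p f \<xi>"
    by (simp add: nn_integral_cmult frac_gauge_pow_eq mult.assoc)
  also have "ennreal (1 / r) * ennreal ((1 / r) powr (- ?q) / (1 / r)) = ennreal (r powr ?q)"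
    using r_pos by (simp add: powr_divide powr_minus_divide flip: ennreal_mult')
  finally show ?thesis .
qed

lemma frac_gauge_pow_diff_le:
  fixes f :: "'a::euclidean_space \<Rightarrow> real"
  assumes [measurable]: "f \<in> borel_measurable borel" and p_ge_1: "p \<ge> 1"
  shows "frac_gauge_pow s p f (\<xi> - \<eta>) \<le>
      ennreal (2 powr (p - 1)) * (frac_gauge_pow s p f \<xi> + frac_gauge_pow s p f \<eta>)"
proof -
  let ?w = "gauge_weight (s * p)"
  have "shift_energy p f (t *\<^sub>R (\<xi> - \<eta>)) \<le>
      ennreal (2 powr (p - 1)) * (shift_energy p f (t *\<^sub>R \<xi>) + shift_energy p f (t *\<^sub>R \<eta>))" for t
    using shift_energy_add_le[OF assms, of "t *\<^sub>R \<xi>" "- (t *\<^sub>R \<eta>)"] assms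
    by (simp add: scaleR_diff_right shift_energy_minus)
  then have "frac_gauge_pow s p f (\<xi> - \<eta>) \<le> (\<integral>\<^sup>+t. ?w t *
      (ennreal (2 powr (p - 1)) * (shift_energy p f (t *\<^sub>R \<xi>) + shift_energy p f (t *\<^sub>R \<eta>))) \<partial>lborel)"
    unfolding frac_gauge_pow_eq by (intro nn_integral_mono mult_left_mono) auto
  also have "\<dots> = (\<integral>\<^sup>+t. ennreal (2 powr (p - 1)) *
      (?w t * shift_energy p f (t *\<^sub>R \<xi>) + ?w t * shift_energy p f (t *\<^sub>R \<eta>)) \<partial>lborel)"
    by (simp add: distrib_left mult.left_commute)
  also have "\<dots> = ennreal (2 powr (p - 1)) * (frac_gauge_pow s p f \<xi> + frac_gauge_pow s p f \<eta>)"
    by (simp add: nn_integral_cmult nn_integral_add frac_gauge_pow_eq)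
  finally show ?thesis .
qed

lemma frac_gauge_on_double_le:
  assumes [measurable]: "f \<in> borel_measurable borel" and p_ge_1: "p \<ge> 1"
  shows "frac_gauge_on {..<2 * T} s p f \<xi> \<le>
      ennreal (2 powr (p * (1 - s))) * frac_gauge_on {..<T} s p f \<xi>"
proof -
  let ?w = "gauge_weight (s * p)" and ?\<phi> = "\<lambda>t. shift_energy p f (t *\<^sub>R \<xi>)"
  let ?c = "2 powr (- s * p) / 2 * 2 powr p"
  have dilate: "?w (2 * t) * ?\<phi> (2 * t) \<le> ennreal ?c * (?w t * ?\<phi> t)" for t
  proof -
    have "?w (2 * t) * ?\<phi> (2 * t) \<le>
        (ennreal (2 powr (- s * p) / 2) * ?w t) * (ennreal (2 powr p) * ?\<phi> t)"
      using shift_energy_double_le[OF assms, of "t *\<^sub>R \<xi>"] gauge_weight_dilate[of 2 "s * p" t]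
      by (simp add: mult_left_mono)
    also have "\<dots> = ennreal ?c * (?w t * ?\<phi> t)"
      by (subst ennreal_mult) (auto simp: mult_ac)
    finally show ?thesis .
  qed
  have "frac_gauge_on {..<2 * T} s p f \<xi> =
      ennreal \<bar>2\<bar> * (\<integral>\<^sup>+t. ?w (0 + 2 * t) * ?\<phi> (0 + 2 * t) * indicator {..<2 * T} (0 + 2 * t) \<partial>lborel)"
    unfolding frac_gauge_on_def by (rule nn_integral_real_affine) auto
  also have "\<dots> \<le> ennreal 2 * (\<integral>\<^sup>+t. ennreal ?c * (?w t * ?\<phi> t * indicator {..<T} t) \<partial>lborel)"
    using dilate by (auto intro!: mult_left_mono nn_integral_mono split: split_indicator)
  also have "\<dots> = ennreal 2 * ennreal ?c * frac_gauge_on {..<T} s p f \<xi>"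
    by (simp add: frac_gauge_on_def nn_integral_cmult mult.assoc)
  also have "ennreal 2 * ennreal ?c = ennreal (2 * ?c)"
    by (rule ennreal_mult[symmetric]) auto
  also have "2 * ?c = 2 powr (p * (1 - s))"
    by (simp add: algebra_simps flip: powr_add)
  finally show ?thesis .
qed

lemma shift_energy_le_frac_gauge_on:
  assumes [measurable]: "f \<in> borel_measurable borel" and p_ge_1: "p \<ge> 1" and s_pos: "s > 0"
  shows "shift_energy p f \<xi> \<le> ennreal (3 * 2 powr p) * frac_gauge_on {1/3<..<2/3} s p f \<xi>"
proof -
  let ?I = "{1/3<..<2/3} :: real set" and ?\<phi> = "\<lambda>t. shift_energy p f (t *\<^sub>R \<xi>)"
  have weight_ge: "1 \<le> gauge_weight (s * p) t" if "t \<in> ?I" for t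
  proof -
    have "1 \<le> t powr (- s * p)" using powr_mono'[of "- s * p" 0 t] that s_pos p_ge_1 by simp
    then show ?thesis using that by (simp add: gauge_weight_def le_divide_eq)
  qed
  have "shift_energy p f \<xi> = ennreal 3 * ennreal (1 / 3) * shift_energy p f \<xi>"
    using ennreal_mult[of 3 "1 / 3"] by simp
  also have "\<dots> = ennreal 3 * (\<integral>\<^sup>+t\<in>?I. shift_energy p f \<xi> \<partial>lborel)"
    by (simp add: nn_integral_cmult mult_ac)
  also have "\<dots> \<le>
      ennreal 3 *
        (\<integral>\<^sup>+t. ennreal (2 powr (p - 1)) * (?\<phi> t * indicator ?I t + ?\<phi> (1 - t) * indicator ?I t) \<partial>lborel)"
  proof (intro mult_left_mono nn_integral_mono)
    fix t :: real
    show "shift_energy p f \<xi> * indicator ?I t \<le>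
        ennreal (2 powr (p - 1)) * (?\<phi> t * indicator ?I t + ?\<phi> (1 - t) * indicator ?I t)"
      using shift_energy_add_le[OF assms(1) p_ge_1, of "t *\<^sub>R \<xi>" "(1 - t) *\<^sub>R \<xi>"]
      by (auto simp: scaleR_left.diff split: split_indicator)
  qed simp
  also have "\<dots> =
      ennreal 3 * (ennreal (2 powr (p - 1)) * ((\<integral>\<^sup>+t\<in>?I. ?\<phi> t \<partial>lborel) + (\<integral>\<^sup>+t\<in>?I. ?\<phi> (1 - t) \<partial>lborel)))"
    by (simp add: nn_integral_cmult nn_integral_add)
  also have "(\<integral>\<^sup>+t\<in>?I. ?\<phi> (1 - t) \<partial>lborel) = (\<integral>\<^sup>+t\<in>?I. ?\<phi> t \<partial>lborel)"
    by (subst (2) nn_integral_real_affine[where c = "-1" and t = 1])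
       (auto intro!: nn_integral_cong split: split_indicator)
  also have "(\<integral>\<^sup>+t\<in>?I. ?\<phi> t \<partial>lborel) \<le> frac_gauge_on ?I s p f \<xi>"
    unfolding frac_gauge_on_def using weight_ge mult_right_mono[of 1 "gauge_weight _ _" "?\<phi> _"]
    by (intro nn_integral_mono) (auto split: split_indicator)
  finally show ?thesis
    by (simp add: ennreal_two_powr_mult_add mult_left_mono add_mono ennreal_mult mult.assoc)
qed

lemma two_powr_minus_one_le:
  fixes p x :: real
  assumes "0 \<le> x" "x \<le> p"
  shows "2 powr x - 1 \<le> 2 powr p * x"
proof -
  have "1 - 2 powr (- x) \<le> x * ln 2"
    using exp_ge_add_one_self[of "- x * ln 2"] by (simp add: powr_def)
  also have "\<dots> \<le> x * 1"
    using assms ln_le_minus_one[of "2::real"] by (intro mult_left_mono) auto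
  finally have "2 powr x * (1 - 2 powr (- x)) \<le> 2 powr x * x"
    by (intro mult_left_mono) auto
  also have "\<dots> \<le> 2 powr p * x"
    using assms by (intro mult_right_mono) auto
  finally show ?thesis by (simp add: right_diff_distrib powr_add[symmetric])
qed

definition shift_const :: "real \<Rightarrow> real \<Rightarrow> real" where
  "shift_const s p = 3 * 4 powr p * p * (1 - s)"

text \<open>The factor \<open>1 - s\<close> reflects that every dyadic scale below \<open>\<xi>\<close> contributes to the gauge:
  the part below \<open>2/3\<close> is at most \<open>2 powr (p * (1 - s))\<close> times the part below \<open>1/3\<close>.\<close>
lemma shift_energy_le_frac_gauge_pow:
  fixes f :: "'a::euclidean_space \<Rightarrow> real"
  assumes [measurable]: "f \<in> borel_measurable borel" and p_ge_1: "p \<ge> 1" and s_bounds: "0 < s" "s < 1"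
  shows "shift_energy p f \<xi> \<le> ennreal (shift_const s p) * frac_gauge_pow s p f \<xi>"
proof -
  let ?H = "\<lambda>I. frac_gauge_on I s p f \<xi>"
  define a where "a = 2 powr (p * (1 - s)) - 1"
  have "p * (1 - s) > 0" using p_ge_1 s_bounds by simp
  then have a_pos: "a > 0" using powr_less_mono[of 0 "p * (1 - s)" 2] by (simp add: a_def)
  have a_bound: "a \<le> 2 powr p * (p * (1 - s))"
    unfolding a_def using p_ge_1 s_bounds by (intro two_powr_minus_one_le) (auto simp: algebra_simps)
  have "?H {..<1/3} + ?H {1/3<..<2/3} \<le> ?H {..<2 * (1/3)}"
    unfolding frac_gauge_on_def
    by (subst nn_integral_add[symmetric]) (auto intro!: nn_integral_mono split: split_indicator)
  also have "\<dots> \<le> ennreal (1 + a) * ?H {..<1/3}"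
    using frac_gauge_on_double_le[OF assms(1) p_ge_1, of "1/3" s \<xi>] by (simp add: a_def)
  also have "\<dots> = ?H {..<1/3} + ennreal a * ?H {..<1/3}"
    using a_pos by (simp add: distrib_right)
  finally have "?H {1/3<..<2/3} \<le> ennreal a * ?H {..<1/3}"
    using a_pos by (auto simp: ennreal_add_left_cancel_le ennreal_mult_top)
  also have "\<dots> \<le> ennreal (2 powr p * (p * (1 - s))) * frac_gauge_pow s p f \<xi>"
    using a_bound by (intro mult_mono ennreal_leI frac_gauge_on_le) auto
  finally have "shift_energy p f \<xi> \<le>
      ennreal (3 * 2 powr p) * (ennreal (2 powr p * (p * (1 - s))) * frac_gauge_pow s p f \<xi>)"
    using shift_energy_le_frac_gauge_on[OF assms(1) p_ge_1 s_bounds(1)]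
    by (meson mult_left_mono order_trans zero_le)
  also have "\<dots> = ennreal (3 * 2 powr p * (2 powr p * (p * (1 - s)))) * frac_gauge_pow s p f \<xi>"
    by (simp add: ennreal_mult' mult.assoc)
  also have "3 * 2 powr p * (2 powr p * (p * (1 - s))) = shift_const s p"
    using powr_mult[of 2 2 p] by (simp add: shift_const_def)
  finally show ?thesis .
qed

section \<open>The fractional polar projection body has positive volume\<close>

lemma frac_polar_proj_body_sets [measurable]:
  assumes [measurable]: "f \<in> borel_measurable borel"
  shows "frac_polar_proj_body s p f \<in> sets borel"
  unfolding frac_polar_proj_body_def by measurable

lemma gagliardo_eq_shift_energy:
  fixes f :: "'a::euclidean_space \<Rightarrow> real"
  assumes [measurable]: "f \<in> borel_measurable borel"
  shows "gagliardo s p f =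
      (\<integral>\<^sup>+z. shift_energy p f z * ennreal (norm z powr (- (s * p + real DIM('a)))) \<partial>lborel)"
proof -
  let ?q = "s * p + real DIM('a)"
  have "gagliardo s p f =
      (\<integral>\<^sup>+x. \<integral>\<^sup>+y. ennreal (\<bar>f x - f y\<bar> powr p / norm (x - y) powr ?q) \<partial>lborel \<partial>lborel)"
    by (simp add: gagliardo_def nn_integral_completion)
  also have "\<dots> =
      (\<integral>\<^sup>+x. \<integral>\<^sup>+z. ennreal (\<bar>f x - f (z + x)\<bar> powr p / norm (x - (z + x)) powr ?q) \<partial>lborel \<partial>lborel)"
    by (intro nn_integral_cong nn_integral_lborel_translate[symmetric]) measurable
  also have "\<dots> =
      (\<integral>\<^sup>+x. \<integral>\<^sup>+z. ennreal (\<bar>f (x + z) - f x\<bar> powr p) * ennreal (norm z powr (- ?q)) \<partial>lborel \<partial>lborel)"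
    by (intro nn_integral_cong)
       (simp add: abs_minus_commute add.commute powr_minus_divide flip: ennreal_mult' del: minus_add_distrib)
  also have "\<dots> =
      (\<integral>\<^sup>+z. \<integral>\<^sup>+x. ennreal (\<bar>f (x + z) - f x\<bar> powr p) * ennreal (norm z powr (- ?q)) \<partial>lborel \<partial>lborel)"
    by (rule lborel_pair.Fubini') measurable
  also have "\<dots> = (\<integral>\<^sup>+z. shift_energy p f z * ennreal (norm z powr (- ?q)) \<partial>lborel)"
    by (simp add: nn_integral_multc shift_energy_def Lp_pow_def)
  finally show ?thesis .
qed

lemma nn_integral_cball_dilate:
  fixes u :: "'a::euclidean_space \<Rightarrow> ennreal"
  assumes [measurable]: "u \<in> borel_measurable borel" and t_pos: "t > 0"
  shows "(\<integral>\<^sup>+z\<in>cball 0 t. u z \<partial>lborel) = ennreal (t ^ DIM('a)) * (\<integral>\<^sup>+\<xi>\<in>cball 0 1. u (t *\<^sub>R \<xi>) \<partial>lborel)"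
proof -
  have "(\<integral>\<^sup>+z\<in>cball 0 t. u z \<partial>lborel) =
      ennreal (\<bar>t\<bar> ^ DIM('a)) * (\<integral>\<^sup>+\<xi>. u (0 + t *\<^sub>R \<xi>) * indicator (cball 0 t) (0 + t *\<^sub>R \<xi>) \<partial>lborel)"
    using t_pos by (intro nn_integral_lborel_affine) auto
  also have "(\<integral>\<^sup>+\<xi>. u (0 + t *\<^sub>R \<xi>) * indicator (cball 0 t) (0 + t *\<^sub>R \<xi>) \<partial>lborel) =
      (\<integral>\<^sup>+\<xi>\<in>cball 0 1. u (t *\<^sub>R \<xi>) \<partial>lborel)"
    using t_pos by (intro nn_integral_cong) (auto split: split_indicator)
  finally show ?thesis using t_pos by simp
qed

lemma nn_integral_gauge_weight_dilate:
  fixes u :: "'a::euclidean_space \<Rightarrow> ennreal"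
  assumes [measurable]: "u \<in> borel_measurable borel"
  shows "(\<integral>\<^sup>+\<xi>\<in>cball 0 1. gauge_weight q t * u (t *\<^sub>R \<xi>) \<partial>lborel) =
    (\<integral>\<^sup>+z\<in>cball 0 t. gauge_weight (q + real DIM('a)) t * u z \<partial>lborel)"
proof (cases "t > 0")
  case True
  let ?w = "gauge_weight (q + real DIM('a)) t"
  have "(\<integral>\<^sup>+\<xi>\<in>cball 0 1. gauge_weight q t * u (t *\<^sub>R \<xi>) \<partial>lborel) =
      (\<integral>\<^sup>+\<xi>\<in>cball 0 1. ?w * ennreal (t ^ DIM('a)) * u (t *\<^sub>R \<xi>) \<partial>lborel)"
    using True gauge_weight_mult_powr[of "q + real DIM('a)" t "real DIM('a)"] by (simp add: powr_realpow)
  also have "\<dots> = ennreal (t ^ DIM('a)) * (\<integral>\<^sup>+\<xi>\<in>cball 0 1. ?w * u (t *\<^sub>R \<xi>) \<partial>lborel)"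
    by (subst nn_integral_cmult[symmetric]) (auto simp: mult_ac)
  also have "\<dots> = (\<integral>\<^sup>+z\<in>cball 0 t. ?w * u z \<partial>lborel)"
    using True by (intro nn_integral_cball_dilate[symmetric]) auto
  finally show ?thesis .
qed (simp add: gauge_weight_def)

text \<open>Polar coordinates are avoided by integrating the gauge over the unit ball and
  rescaling the ball for each fixed \<open>t\<close>.\<close>
lemma nn_integral_cball_frac_gauge_pow:
  fixes f :: "'a::euclidean_space \<Rightarrow> real"
  assumes [measurable]: "f \<in> borel_measurable borel" and sp_pos: "s * p > 0"
  shows "(\<integral>\<^sup>+\<xi>\<in>cball 0 1. frac_gauge_pow s p f \<xi> \<partial>lborel) =
    ennreal (1 / (s * p + real DIM('a))) * gagliardo s p f"
proof -
  let ?q = "s * p + real DIM('a)"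
  let ?\<phi> = "shift_energy p f"
  have "(\<integral>\<^sup>+\<xi>\<in>cball 0 1. frac_gauge_pow s p f \<xi> \<partial>lborel) =
      (\<integral>\<^sup>+\<xi>. \<integral>\<^sup>+t. gauge_weight (s * p) t * ?\<phi> (t *\<^sub>R \<xi>) * indicator (cball 0 1) \<xi> \<partial>lborel \<partial>lborel)"
    by (simp add: frac_gauge_pow_eq nn_integral_multc)
  also have "\<dots> = (\<integral>\<^sup>+t. (\<integral>\<^sup>+\<xi>\<in>cball 0 1. gauge_weight (s * p) t * ?\<phi> (t *\<^sub>R \<xi>) \<partial>lborel) \<partial>lborel)"
    by (rule lborel_pair.Fubini') measurable
  also have "\<dots> = (\<integral>\<^sup>+t. (\<integral>\<^sup>+z\<in>cball 0 t. gauge_weight ?q t * ?\<phi> z \<partial>lborel) \<partial>lborel)"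
    by (simp add: nn_integral_gauge_weight_dilate)
  also have "\<dots> = (\<integral>\<^sup>+t. \<integral>\<^sup>+z. gauge_weight ?q t * ?\<phi> z * indicator {norm z..} t \<partial>lborel \<partial>lborel)"
    by (intro nn_integral_cong) (simp add: indicator_def)
  also have "\<dots> = (\<integral>\<^sup>+z. \<integral>\<^sup>+t. gauge_weight ?q t * ?\<phi> z * indicator {norm z..} t \<partial>lborel \<partial>lborel)"
    by (rule lborel_pair.Fubini') (simp add: atLeast_def)
  also have "\<dots> = (\<integral>\<^sup>+z. ennreal (1 / ?q) * (?\<phi> z * ennreal (norm z powr (- ?q))) \<partial>lborel)"
  proof (rule nn_integral_cong_AE)
    show "AE z in lborel. (\<integral>\<^sup>+t. gauge_weight ?q t * ?\<phi> z * indicator {norm z..} t \<partial>lborel) =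
        ennreal (1 / ?q) * (?\<phi> z * ennreal (norm z powr (- ?q)))"
      using AE_lborel_singleton[of "0::'a"]
    proof eventually_elim
      case (elim z)
      have "(\<integral>\<^sup>+t. gauge_weight ?q t * ?\<phi> z * indicator {norm z..} t \<partial>lborel) =
          ?\<phi> z * (\<integral>\<^sup>+t\<in>{norm z..}. gauge_weight ?q t \<partial>lborel)"
        by (simp add: mult_ac flip: nn_integral_cmult)
      also have "(\<integral>\<^sup>+t\<in>{norm z..}. gauge_weight ?q t \<partial>lborel) =
          ennreal (1 / ?q) * ennreal (norm z powr (- ?q))"
        using elim sp_pos
        by (simp add: nn_integral_gauge_weight_atLeast add_pos_nonneg flip: ennreal_mult')
      finally show ?case by (simp add: mult_ac)
    qed
  qed
  also have "\<dots> = ennreal (1 / ?q) * gagliardo s p f"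
    by (simp add: nn_integral_cmult gagliardo_eq_shift_energy)
  finally show ?thesis .
qed

lemma emeasure_frac_polar_proj_body_pos:
  fixes f :: "'a::euclidean_space \<Rightarrow> real"
  assumes [measurable]: "f \<in> borel_measurable borel" and sp_pos: "s * p > 0"
    and gagliardo_finite: "gagliardo s p f < \<infinity>"
  shows "emeasure lborel (frac_polar_proj_body s p f) > 0"
proof (rule ccontr)
  assume "\<not> emeasure lborel (frac_polar_proj_body s p f) > 0"
  then have "emeasure lborel {\<xi>. frac_gauge_pow s p f \<xi> \<le> 1} = 0"
    by (simp add: frac_polar_proj_body_def)
  moreover have "s \<noteq> 0" "p \<noteq> 0" using sp_pos by auto
  ultimately have null_level: "emeasure lborel {\<xi>. frac_gauge_pow s p f \<xi> \<le> ennreal (real (Suc m))} = 0"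
    for m
    by (subst emeasure_lborel_homogeneous_sublevel[where q = "s * p"]) (auto simp: frac_gauge_pow_scaleR)
  have "AE \<xi> in lborel. \<not> frac_gauge_pow s p f \<xi> \<le> ennreal (real (Suc m))" for m
    by (rule AE_I[OF _ null_level[of m]]) auto
  then have "AE \<xi> in lborel. \<forall>m. \<not> frac_gauge_pow s p f \<xi> \<le> ennreal (real (Suc m))"
    by (simp add: AE_all_countable)
  moreover have "AE \<xi> in lborel. frac_gauge_pow s p f \<xi> * indicator (cball 0 1) \<xi> \<noteq> \<infinity>"
    using gagliardo_finite nn_integral_cball_frac_gauge_pow[OF assms(1) sp_pos]
    by (intro nn_integral_noteq_infinite) (auto simp: ennreal_mult_eq_top_iff)
  ultimately have "AE \<xi> in lborel. \<xi> \<notin> cball (0::'a) 1"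
  proof eventually_elim
    case (elim \<xi>)
    show ?case
    proof
      assume "\<xi> \<in> cball 0 1"
      then obtain h where gauge_eq: "frac_gauge_pow s p f \<xi> = ennreal h"
        using elim(2) by (cases "frac_gauge_pow s p f \<xi>") auto
      obtain m where "h \<le> real (Suc m)"
        by (metis real_arch_simple le_SucI of_nat_le_iff order_trans order_refl)
      with elim(1) gauge_eq show False by (auto simp del: of_nat_Suc simp: ennreal_leI)
    qed
  qed
  then have "emeasure lborel (cball (0::'a) 1) = 0"
    by (subst AE_iff_measurable[symmetric]) auto
  then show False
    using emeasure_cball[of 1 "0::'a"] unit_ball_vol_pos[of "real DIM('a)"]
    by (simp add: ennreal_eq_0_iff not_le[symmetric])
qed

section \<open>Homogeneous gauges that dominate the shift energy\<close>

locale shift_gauge =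
  fixes f :: "'a::euclidean_space \<Rightarrow> real" and p q \<kappa> :: real and H :: "'a \<Rightarrow> ennreal"
  assumes f_borel [measurable]: "f \<in> borel_measurable borel"
    and H_borel [measurable]: "H \<in> borel_measurable borel"
    and q_pos: "q > 0" and \<kappa>_pos: "\<kappa> > 0"
    and homogeneous: "\<And>r \<xi>. r > 0 \<Longrightarrow> H (r *\<^sub>R \<xi>) = ennreal (r powr q) * H \<xi>"
    and shift_energy_le: "\<And>z. shift_energy p f z \<le> ennreal \<kappa> * H z"
begin

definition level :: "real \<Rightarrow> 'a set" where
  "level c = {\<xi>. H \<xi> \<le> ennreal c}"

lemma level_sets [measurable]: "level c \<in> sets borel"
  unfolding level_def by measurable

lemma level_mono: "c \<le> d \<Longrightarrow> level c \<subseteq> level d"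
  unfolding level_def by (auto intro: order_trans ennreal_leI)

lemma emeasure_level:
  "c > 0 \<Longrightarrow> emeasure lborel (level c) = ennreal (c powr (real DIM('a) / q)) * emeasure lborel (level 1)"
  unfolding level_def
  using emeasure_lborel_homogeneous_sublevel[of H q c] homogeneous q_pos by simp

lemma shift_energy_le_on_level:
  assumes "z \<in> level c"
  shows "shift_energy p f z \<le> ennreal (\<kappa> * c)"
proof -
  have "ennreal \<kappa> * H z \<le> ennreal \<kappa> * ennreal c"
    using assms by (intro mult_left_mono) (auto simp: level_def)
  then show ?thesis
    using shift_energy_le[of z] \<kappa>_pos by (simp add: ennreal_mult')
qed

lemma Lp_pow_times_emeasure_level_le:
  assumes F_eq: "Lp_pow p f = ennreal F" "F > 0"
  shows "ennreal ((F / (2 * \<kappa>)) powr (real DIM('a) / q)) * emeasure lborel (level 1) \<le>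
      2 * emeasure lborel (supp_set f)"
proof -
  have "ennreal (\<kappa> * (F / (2 * \<kappa>))) = Lp_pow p f / 2"
    using F_eq \<kappa>_pos by (simp add: ennreal_divide_numeral)
  then have "level (F / (2 * \<kappa>)) \<subseteq> small_shifts p f"
    unfolding small_shifts_def using shift_energy_le_on_level by fastforce
  then have "emeasure lborel (level (F / (2 * \<kappa>))) \<le> emeasure lborel (small_shifts p f)"
    by (rule emeasure_mono) measurable
  also have "\<dots> \<le> 2 * emeasure lborel (supp_set f)"
    by (rule emeasure_small_shifts_le[OF f_borel])
       (use F_eq(2) in \<open>simp_all add: F_eq(1) ennreal_eq_0_iff\<close>)
  finally show ?thesis using F_eq \<kappa>_pos by (subst (asm) emeasure_level) auto
qed

lemma emeasure_level_finite:
  assumes "Lp_pow p f \<noteq> 0" "Lp_pow p f < \<infinity>" "emeasure lborel (supp_set f) < \<infinity>"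
  shows "emeasure lborel (level 1) < \<infinity>"
proof -
  obtain F where F_eq: "Lp_pow p f = ennreal F" "F > 0"
    using assms by (cases "Lp_pow p f") (auto simp: less_le)
  have "ennreal ((F / (2 * \<kappa>)) powr (real DIM('a) / q)) * emeasure lborel (level 1) < \<infinity>"
    using assms(3)
    by (intro le_less_trans[OF Lp_pow_times_emeasure_level_le[OF F_eq]]) (simp add: ennreal_mult_less_top)
  then show ?thesis using F_eq \<kappa>_pos by (auto simp: ennreal_mult_less_top)
qed

end

section \<open>Morrey's inequality for a quasi-subadditive gauge\<close>

locale morrey_gauge = shift_gauge +
  assumes p_ge_1: "p \<ge> 1" and dim_less_q: "real DIM('a) < q" and q_le_p: "q \<le> p"
    and diff_le: "\<And>\<xi> \<eta>. H (\<xi> - \<eta>) \<le> ennreal (2 powr (p - 1)) * (H \<xi> + H \<eta>)"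
    and Lp_finite: "Lp_pow p f < \<infinity>"
    and supp_positive: "0 < emeasure lborel (supp_set f)"
    and supp_finite: "emeasure lborel (supp_set f) < \<infinity>"
    and level_positive: "0 < emeasure lborel (level 1)"
begin

abbreviation supp_vol :: real where "supp_vol \<equiv> measure lborel (supp_set f)"
abbreviation unit_vol :: real where "unit_vol \<equiv> measure lborel (level 1)"

lemma emeasure_supp: "emeasure lborel (supp_set f) = ennreal supp_vol" "supp_vol > 0"
  using emeasure_eq_measure_if_pos_finite measure_pos_if_pos_finite supp_positive supp_finite by blast+

lemma emeasure_unit_level: "emeasure lborel (level 1) = ennreal unit_vol" "unit_vol > 0"
proof -
  have "Lp_pow p f \<noteq> 0" using supp_positive by (simp add: Lp_pow_eq_0_iff)
  then have "emeasure lborel (level 1) < \<infinity>"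
    by (rule emeasure_level_finite[OF _ Lp_finite supp_finite])
  then show "emeasure lborel (level 1) = ennreal unit_vol" "unit_vol > 0"
    using emeasure_eq_measure_if_pos_finite measure_pos_if_pos_finite level_positive by blast+
qed

definition level_vol :: "real \<Rightarrow> real" where
  "level_vol c = c powr (real DIM('a) / q) * unit_vol"

lemma level_vol_pos: "c > 0 \<Longrightarrow> level_vol c > 0"
  by (simp add: level_vol_def emeasure_unit_level)

lemma emeasure_level_eq: "c > 0 \<Longrightarrow> emeasure lborel (level c) = ennreal (level_vol c)"
  using emeasure_level[of c] emeasure_unit_level by (simp add: level_vol_def ennreal_mult')

lemma level_vol_dyadic:
  assumes "c > 0"
  shows "level_vol (2 powr p * c) \<le> 2 powr p * level_vol c"
    and "level_vol c / 2 powr p \<le> level_vol (c / 2 powr p)"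
proof -
  have "p * (real DIM('a) / q) \<le> p * 1"
    using dim_less_q q_pos p_ge_1 by (intro mult_left_mono) auto
  then have "(2 powr p) powr (real DIM('a) / q) \<le> 2 powr p"
    by (simp add: powr_powr)
  then have double: "level_vol (2 powr p * d) \<le> 2 powr p * level_vol d" if "d > 0" for d
    using that emeasure_unit_level by (simp add: level_vol_def powr_mult)
  show "level_vol (2 powr p * c) \<le> 2 powr p * level_vol c"
    by (rule double[OF assms])
  show "level_vol c / 2 powr p \<le> level_vol (c / 2 powr p)"
    using double[of "c / 2 powr p"] assms by (simp add: divide_le_eq mult.commute)
qed

lemma level_diff:
  assumes "z \<in> level c" "w \<in> level c"
  shows "z - w \<in> level (2 powr p * c)"
proof -
  have "H (z - w) \<le> ennreal (2 powr (p - 1)) * (ennreal c + ennreal c)"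
    using assms by (intro order_trans[OF diff_le] mult_left_mono add_mono) (auto simp: level_def)
  also have "\<dots> = ennreal (2 powr p * c)"
    by (simp add: ennreal_two_powr_mult_add ennreal_mult')
  finally show ?thesis by (simp add: level_def)
qed

definition oscillation :: "real \<Rightarrow> real" where
  "oscillation c = (8 powr p * \<kappa> * c / level_vol c) powr (1 / p)"

lemma mean_level_diff_le:
  assumes c_pos: "c > 0" and [measurable]: "D \<in> sets borel" and D_subset: "D \<subseteq> level c"
    and vol_D: "ennreal (level_vol c / 2 powr p) \<le> emeasure lborel D"
  shows "\<bar>mean_on (level c) (\<lambda>z. f (x + z)) - mean_on D (\<lambda>z. f (x + z))\<bar> \<le> oscillation c"
    (is "\<bar>?\<Delta>\<bar> \<le> _")
proof -
  let ?v = "level_vol c" and ?M = "\<kappa> * (2 powr p * c)"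
  have level_vol_c_pos: "?v > 0" by (rule level_vol_pos[OF c_pos])
  have "emeasure lborel D \<le> ennreal ?v"
    using emeasure_mono[OF D_subset, of lborel] c_pos by (simp add: emeasure_level_eq)
  then obtain d where D_eq: "emeasure lborel D = ennreal d" "?v / 2 powr p \<le> d"
    using vol_D level_vol_c_pos by (cases "emeasure lborel D") (auto simp: top_unique)
  have d_pos: "d > 0" using D_eq(2) level_vol_c_pos by (smt (verit) divide_pos_pos powr_gt_zero)
  have M_nonneg: "?M \<ge> 0" using \<kappa>_pos c_pos by (intro mult_nonneg_nonneg) auto
  have "ennreal (\<bar>?\<Delta>\<bar> powr p) \<le>
      ennreal ?M * emeasure lborel (level (2 powr p * c)) / emeasure lborel D / emeasure lborel (level c)"
    using level_vol_c_pos D_eq d_pos c_pos D_subset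
    by (intro mean_shift_diff_powr_le[OF f_borel p_ge_1 Lp_finite] level_diff shift_energy_le_on_level)
       (auto simp: emeasure_level_eq)
  also have "\<dots> = ennreal (?M * level_vol (2 powr p * c) / d / ?v)"
    using c_pos level_vol_c_pos D_eq d_pos M_nonneg level_vol_pos[of "2 powr p * c"]
    by (simp add: emeasure_level_eq divide_ennreal flip: ennreal_mult)
  finally have "\<bar>?\<Delta>\<bar> powr p \<le> ?M * level_vol (2 powr p * c) / d / ?v"
    using c_pos level_vol_c_pos d_pos M_nonneg level_vol_pos[of "2 powr p * c"]
    by (subst (asm) ennreal_le_iff) auto
  also have "\<dots> \<le> ?M * (2 powr p * ?v) / (?v / 2 powr p) / ?v"
    using c_pos level_vol_c_pos D_eq(2) d_pos M_nonneg
      level_vol_dyadic(1)[of c] level_vol_pos[of "2 powr p * c"]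
    by (intro divide_right_mono frac_le mult_left_mono) auto
  also have "\<dots> = 2 powr p * 2 powr p * 2 powr p * \<kappa> * c / ?v"
    using level_vol_c_pos by (simp add: field_simps)
  also have "2 powr p * 2 powr p * 2 powr p = (8::real) powr p"
    by (simp flip: powr_mult)
  finally have "(\<bar>?\<Delta>\<bar> powr p) powr (1 / p) \<le> oscillation c"
    unfolding oscillation_def using p_ge_1 by (intro powr_mono2) auto
  then show ?thesis using p_ge_1 by (simp add: powr_powr)
qed

text \<open>Inside a level set of twice the volume of the support, \<open>f (x + \<cdot>)\<close> vanishes on at least half
  of the points, and its mean over those is zero.\<close>
lemma mean_level_le_oscillation:
  assumes c_pos: "c > 0" and level_vol_eq: "level_vol c = 2 * supp_vol"
  shows "\<bar>mean_on (level c) (\<lambda>z. f (x + z))\<bar> \<le> oscillation c"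
proof -
  define D where "D = {w \<in> level c. f (x + w) = 0}"
  have [measurable]: "D \<in> sets borel" unfolding D_def by measurable
  have [measurable]: "supp_set f \<in> sets borel" unfolding supp_set_def by measurable
  have "emeasure lborel {w. w + x \<in> supp_set f} = (\<integral>\<^sup>+w. indicator (supp_set f) (w + x) \<partial>lborel)"
    using nn_integral_indicator[of "{w. w + x \<in> supp_set f}" lborel] by (simp add: indicator_def)
  also have "\<dots> = emeasure lborel (supp_set f)"
    by (subst nn_integral_lborel_translate) auto
  finally have translate: "emeasure lborel {w. w + x \<in> supp_set f} = ennreal supp_vol"
    by (simp add: emeasure_supp)
  have "emeasure lborel (level c) \<le> emeasure lborel (D \<union> {w. w + x \<in> supp_set f})"
    by (rule emeasure_mono) (auto simp: D_def supp_set_def add.commute)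
  also have "\<dots> \<le> emeasure lborel D + ennreal supp_vol"
    unfolding translate[symmetric] by (rule emeasure_subadditive) auto
  finally have "ennreal supp_vol + ennreal supp_vol \<le> ennreal supp_vol + emeasure lborel D"
    using emeasure_level_eq[OF c_pos] emeasure_supp
    by (simp add: level_vol_eq add.commute flip: ennreal_plus)
  then have "ennreal supp_vol \<le> emeasure lborel D"
    by (simp add: ennreal_add_left_cancel_le)
  moreover have "level_vol c / 2 powr p \<le> supp_vol"
    using powr_mono[of 1 p 2] p_ge_1 emeasure_supp by (simp add: level_vol_eq divide_le_eq)
  ultimately have "ennreal (level_vol c / 2 powr p) \<le> emeasure lborel D"
    by (metis ennreal_leI order_trans)
  then have "\<bar>mean_on (level c) (\<lambda>z. f (x + z)) - mean_on D (\<lambda>z. f (x + z))\<bar> \<le> oscillation c"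
    using c_pos by (intro mean_level_diff_le) (auto simp: D_def)
  moreover have "mean_on D (\<lambda>z. f (x + z)) = 0"
  proof -
    have "(\<integral>z\<in>D. f (x + z) \<partial>lborel) = (\<integral>z\<in>D. 0 \<partial>lborel)"
      by (rule set_lebesgue_integral_cong) (auto simp: D_def)
    then show ?thesis by (simp add: mean_on_def)
  qed
  ultimately show ?thesis by simp
qed

lemma mean_level_dyadic_diff_le:
  assumes "c > 0"
  shows "\<bar>mean_on (level c) (\<lambda>z. f (x + z)) - mean_on (level (c / 2 powr p)) (\<lambda>z. f (x + z))\<bar> \<le>
      oscillation c"
proof (rule mean_level_diff_le[OF assms])
  have "1 \<le> (2::real) powr p" using powr_mono[of 0 p "2::real"] p_ge_1 by simp
  then show "level (c / 2 powr p) \<subseteq> level c"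
    using assms by (intro level_mono) (simp add: divide_le_eq mult_le_cancel_left1)
  show "ennreal (level_vol c / 2 powr p) \<le> emeasure lborel (level (c / 2 powr p))"
    using assms level_vol_dyadic(2)[of c] by (simp add: emeasure_level_eq ennreal_leI)
qed measurable

definition decay :: real where
  "decay = 2 powr (real DIM('a) / q - 1)"

lemma decay_bounds: "0 < decay" "decay < 1"
  using dim_less_q q_pos powr_less_mono[of "real DIM('a) / q - 1" 0 2] by (auto simp: decay_def)

lemma oscillation_dyadic:
  assumes "c > 0"
  shows "oscillation (c / (2 powr p) ^ j) = oscillation c * decay ^ j"
proof -
  have oscillation_half: "oscillation (c / 2 powr p) = oscillation c * decay" if "c > 0" for c
  proof -
    have "8 powr p * \<kappa> * (c / 2 powr p) / level_vol (c / 2 powr p) =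
        (8 powr p * \<kappa> * c / level_vol c) * decay powr p"
      using that by (simp add: level_vol_def decay_def powr_divide powr_powr powr_diff field_simps)
    then have "oscillation (c / 2 powr p) =
        ((8 powr p * \<kappa> * c / level_vol c) * decay powr p) powr (1 / p)"
      by (simp only: oscillation_def)
    also have "\<dots> = oscillation c * (decay powr p) powr (1 / p)"
      unfolding oscillation_def by (rule powr_mult)
    finally show ?thesis
      using p_ge_1 decay_bounds by (simp add: powr_powr)
  qed
  show ?thesis
  proof (induction j)
    case (Suc j)
    then show ?case using oscillation_half[of "c / (2 powr p) ^ j"] assms by (simp add: mult_ac)
  qed simp
qed

lemma mean_level_dyadic_le:
  assumes c_pos: "c > 0" and level_vol_eq: "level_vol c = 2 * supp_vol"
  shows "\<bar>mean_on (level (c / (2 powr p) ^ j)) (\<lambda>z. f (x + z))\<bar> \<le> oscillation c * (1 + 1 / (1 - decay))"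
proof -
  let ?m = "\<lambda>j. mean_on (level (c / (2 powr p) ^ j)) (\<lambda>z. f (x + z))"
  have "\<bar>?m j\<bar> \<le> oscillation c + oscillation c * (\<Sum>i<j. decay ^ i)"
  proof (induction j)
    case 0
    then show ?case using mean_level_le_oscillation[OF assms] by simp
  next
    case (Suc j)
    have "\<bar>?m j - ?m (Suc j)\<bar> \<le> oscillation c * decay ^ j"
      using mean_level_dyadic_diff_le[of "c / (2 powr p) ^ j" x] c_pos
      by (simp add: oscillation_dyadic mult.commute)
    then show ?case using Suc by (simp add: algebra_simps)
  qed
  also have "\<dots> \<le> oscillation c + oscillation c * (1 / (1 - decay))"
    using geometric_sum_less[OF decay_bounds, of "{..<j}"] decay_bounds
    by (intro add_left_mono mult_left_mono) (auto simp: oscillation_def)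
  finally show ?thesis by (simp add: algebra_simps)
qed

lemma AE_abs_le_oscillation:
  assumes c_pos: "c > 0" and level_vol_eq: "level_vol c = 2 * supp_vol"
  shows "AE x in lborel. \<bar>f x\<bar> \<le> oscillation c * (1 + 1 / (1 - decay))"
proof (rule AE_abs_le_if_means_le[OF f_borel p_ge_1 Lp_finite, where B = "\<lambda>j. level (c / (2 powr p) ^ j)"])
  fix j
  show "emeasure lborel (level (c / (2 powr p) ^ j)) > 0"
    "emeasure lborel (level (c / (2 powr p) ^ j)) < \<infinity>"
    using c_pos level_vol_pos by (auto simp: emeasure_level_eq)
next
  show "\<bar>mean_on (level (c / (2 powr p) ^ j)) (\<lambda>z. f (x + z))\<bar> \<le>
      oscillation c * (1 + 1 / (1 - decay))" for j x
    by (rule mean_level_dyadic_le[OF assms])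
next
  show "shift_energy p f z \<le> ennreal (\<kappa> * (c / (2 powr p) ^ j))"
    if "z \<in> level (c / (2 powr p) ^ j)" for j z
    by (rule shift_energy_le_on_level[OF that])
next
  have "norm (1 / 2 powr p) < 1" using powr_less_mono[of 0 p "2::real"] p_ge_1 by simp
  then have "(\<lambda>j. ennreal (\<kappa> * (c * (1 / 2 powr p) ^ j))) \<longlonglongrightarrow> ennreal (\<kappa> * (c * 0))"
    by (intro tendsto_intros LIMSEQ_power_zero)
  then show "(\<lambda>j. ennreal (\<kappa> * (c / (2 powr p) ^ j))) \<longlonglongrightarrow> 0"
    by (simp add: power_divide)
qed

theorem morrey_inequality:
  "AE x in lborel. \<bar>f x\<bar> \<le>
    16 * \<kappa> powr (1 / p) * (1 + 1 / (1 - decay)) *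
    supp_vol powr (q / p / real DIM('a) - 1 / p) * unit_vol powr (- (q / p) / real DIM('a))"
proof -
  let ?\<sigma> = supp_vol and ?k = unit_vol and ?b = "q / real DIM('a)"
  note vols_pos = emeasure_supp(2) emeasure_unit_level(2)
  define c where "c = (2 * ?\<sigma> / ?k) powr ?b"
  have c_pos: "c > 0" using vols_pos by (simp add: c_def)
  have level_vol_eq: "level_vol c = 2 * ?\<sigma>"
    using vols_pos q_pos by (simp add: level_vol_def c_def powr_powr)
  have "q \<le> p * real DIM('a)"
    using q_le_p p_ge_1 by (simp add: mult_le_cancel_left1 order_trans DIM_positive Suc_leI)
  then have "2 powr ?b \<le> 2 powr p" by (intro powr_mono) (auto simp: divide_le_eq)
  have "8 powr p * \<kappa> * c / level_vol c =
      8 powr p * \<kappa> * (2 powr ?b * (?\<sigma> powr ?b * ?k powr (- ?b))) / (2 * ?\<sigma>)"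
    using vols_pos by (simp add: level_vol_eq) (simp add: c_def powr_mult powr_divide powr_minus_divide)
  also have "\<dots> \<le> 8 powr p * \<kappa> * (2 powr p * (?\<sigma> powr ?b * ?k powr (- ?b))) / ?\<sigma>"
    using vols_pos \<kappa>_pos \<open>2 powr ?b \<le> 2 powr p\<close>
    by (intro frac_le mult_left_mono mult_right_mono mult_nonneg_nonneg) auto
  also have "\<dots> = 16 powr p * \<kappa> * (?\<sigma> powr (?b - 1) * ?k powr (- ?b))"
    using vols_pos powr_mult[of 8 2 p] by (simp add: powr_diff)
  finally have "oscillation c \<le> (16 powr p * \<kappa> * (?\<sigma> powr (?b - 1) * ?k powr (- ?b))) powr (1 / p)"
    unfolding oscillation_def using p_ge_1 c_pos \<kappa>_pos level_vol_pos[OF c_pos] by (intro powr_mono2) auto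
  also have "\<dots> = 16 * \<kappa> powr (1 / p) * (?\<sigma> powr ((?b - 1) / p) * ?k powr (- ?b / p))"
    using p_ge_1 \<kappa>_pos by (simp add: powr_mult powr_powr)
  also have "(?b - 1) / p = q / p / real DIM('a) - 1 / p" by (simp add: diff_divide_distrib mult.commute)
  also have "- ?b / p = - (q / p) / real DIM('a)" by (simp add: mult.commute)
  finally have "oscillation c * (1 + 1 / (1 - decay)) \<le>
      (16 * \<kappa> powr (1 / p) * (?\<sigma> powr (q / p / real DIM('a) - 1 / p) * ?k powr (- (q / p) / real DIM('a)))) *
        (1 + 1 / (1 - decay))"
    using decay_bounds by (intro mult_right_mono) auto
  also have "\<dots> = 16 * \<kappa> powr (1 / p) * (1 + 1 / (1 - decay)) *
      ?\<sigma> powr (q / p / real DIM('a) - 1 / p) * ?k powr (- (q / p) / real DIM('a))"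
    by (simp only: mult_ac)
  finally have bound: "oscillation c * (1 + 1 / (1 - decay)) \<le> \<dots>" .
  show ?thesis
    using AE_abs_le_oscillation[OF c_pos level_vol_eq]
    by (rule eventually_mono) (rule order_trans[OF _ bound])
qed

end

section \<open>Bump functions\<close>

definition flat_exp :: "nat \<Rightarrow> real \<Rightarrow> real" where
  "flat_exp m t = (if t > 0 then exp (- (1 / t)) / t ^ m else 0)"

lemma abs_flat_exp_le: "\<bar>flat_exp m t\<bar> \<le> fact (m + 2) * t\<^sup>2"
proof (cases "t > 0")
  case True
  have "(1 / t) ^ (m + 2) / fact (m + 2) \<le> exp (1 / t)"
    using sum_le_suminf[OF summable_exp[of "1 / t"], of "{m + 2}"] True
    by (simp add: exp_def divide_inverse mult.commute)
  then have "1 / exp (1 / t) \<le> 1 / ((1 / t) ^ (m + 2) / fact (m + 2))"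
    using True by (intro divide_left_mono) auto
  then have "exp (- (1 / t)) \<le> fact (m + 2) * t ^ (m + 2)"
    using True
    by (simp add: exp_minus inverse_eq_divide power_divide mult.commute del: fact_Suc power_Suc)
  then have "exp (- (1 / t)) / t ^ m \<le> fact (m + 2) * t ^ (m + 2) / t ^ m"
    using True by (intro divide_right_mono) auto
  then show ?thesis using True by (simp add: flat_exp_def power_add power2_eq_square)
qed (simp add: flat_exp_def)

lemma flat_exp_has_derivative:
  "(flat_exp m has_real_derivative (- real m * flat_exp (m + 1) t + flat_exp (m + 2) t)) (at t)"
proof -
  consider (pos) "t > 0" | (neg) "t < 0" | (zero) "t = 0" by linarith
  then show ?thesis
  proof cases
    case pos
    have "((\<lambda>t. exp (- (1 / t)) / t ^ m) has_real_derivative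
        (- real m * flat_exp (m + 1) t + flat_exp (m + 2) t)) (at t)"
      using pos by (auto intro!: derivative_eq_intros
          simp: flat_exp_def field_simps power2_eq_square power_Suc[symmetric] simp del: power_Suc)
        (cases m; simp add: field_simps)
    then show ?thesis
      by (rule has_field_derivative_transform_within_open[of _ _ _ "{0<..}"])
         (use pos in \<open>auto simp: flat_exp_def\<close>)
  next
    case neg
    have "((\<lambda>t. 0) has_real_derivative (- real m * flat_exp (m + 1) t + flat_exp (m + 2) t)) (at t)"
      using neg by (auto simp: flat_exp_def)
    then show ?thesis
      by (rule has_field_derivative_transform_within_open[of _ _ _ "{..<0}"])
         (use neg in \<open>auto simp: flat_exp_def\<close>)
  next
    case zero
    have "((\<lambda>h. flat_exp m h / h) \<longlongrightarrow> 0) (at 0)"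
    proof (rule Lim_null_comparison)
      show "\<forall>\<^sub>F h in at 0. norm (flat_exp m h / h) \<le> fact (m + 2) * \<bar>h\<bar>"
        using abs_flat_exp_le[of m] unfolding eventually_at_filter
        by (auto simp: divide_le_eq power2_eq_square abs_mult mult.assoc intro!: always_eventually)
      have "((\<lambda>h. fact (m + 2) * \<bar>h\<bar>) \<longlongrightarrow> fact (m + 2) * \<bar>0::real\<bar>) (at 0)"
        by (intro tendsto_intros)
      then show "((\<lambda>h. fact (m + 2) * \<bar>h\<bar>) \<longlongrightarrow> (0::real)) (at 0)" by simp
    qed
    then show ?thesis using zero unfolding DERIV_def by (simp add: flat_exp_def)
  qed
qed

text \<open>An algebra that is closed under directional derivatives, so that coinduction shows its members
  to be smooth.\<close>
inductive bump_algebra :: "('a::euclidean_space \<Rightarrow> real) \<Rightarrow> bool" where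
  atom: "bump_algebra (\<lambda>x. flat_exp m (x \<bullet> v + b))"
| const: "bump_algebra (\<lambda>_. c)"
| add: "bump_algebra f \<Longrightarrow> bump_algebra g \<Longrightarrow> bump_algebra (\<lambda>x. f x + g x)"
| mult: "bump_algebra f \<Longrightarrow> bump_algebra g \<Longrightarrow> bump_algebra (\<lambda>x. f x * g x)"

lemma bump_algebra_ex_derivative:
  assumes "bump_algebra f"
  shows "\<exists>f'. (\<forall>x. (f has_derivative f' x) (at x)) \<and> (\<forall>w. bump_algebra (\<lambda>x. f' x w))"
  using assms
proof induction
  case (atom m v b)
  let ?f' = "\<lambda>x w. (- real m * flat_exp (m + 1) (x \<bullet> v + b) + flat_exp (m + 2) (x \<bullet> v + b)) * (w \<bullet> v)"
  have "((\<lambda>x. flat_exp m (x \<bullet> v + b)) has_derivative ?f' x) (at x)" for x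
  proof -
    have "((\<lambda>x. x \<bullet> v + b) has_derivative (\<lambda>w. w \<bullet> v)) (at x)"
      by (auto intro!: derivative_eq_intros)
    from has_derivative_compose[OF this flat_exp_has_derivative[unfolded has_field_derivative_def]]
    show ?thesis by (simp add: mult.commute)
  qed
  moreover have "bump_algebra (\<lambda>x. ?f' x w)" for w
    by (intro bump_algebra.intros)
  ultimately show ?case by (intro exI[of _ ?f']) blast
next
  case (const c)
  then show ?case by (intro exI[of _ "\<lambda>x w. 0"]) (auto intro: bump_algebra.const)
next
  case (add f g)
  then obtain f' g' where "\<forall>x. (f has_derivative f' x) (at x)" "\<forall>w. bump_algebra (\<lambda>x. f' x w)"
    "\<forall>x. (g has_derivative g' x) (at x)" "\<forall>w. bump_algebra (\<lambda>x. g' x w)" by blast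
  then show ?case
    by (intro exI[of _ "\<lambda>x w. f' x w + g' x w"]) (auto intro!: has_derivative_add bump_algebra.add)
next
  case (mult f g)
  then obtain f' g' where "\<forall>x. (f has_derivative f' x) (at x)" "\<forall>w. bump_algebra (\<lambda>x. f' x w)"
    "\<forall>x. (g has_derivative g' x) (at x)" "\<forall>w. bump_algebra (\<lambda>x. g' x w)" by blast
  then show ?case using mult.hyps
    by (intro exI[of _ "\<lambda>x w. f x * g' x w + f' x w * g x"])
       (auto intro!: has_derivative_mult bump_algebra.add bump_algebra.mult)
qed

lemma bump_algebra_derivative:
  assumes "bump_algebra f"
  shows bump_algebra_has_derivative: "(f has_derivative frechet_derivative f (at x)) (at x)"
    and bump_algebra_frechet_derivative: "bump_algebra (\<lambda>x. frechet_derivative f (at x) w)"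
proof -
  obtain f' where derivative: "\<forall>x. (f has_derivative f' x) (at x)" "\<forall>w. bump_algebra (\<lambda>x. f' x w)"
    using bump_algebra_ex_derivative[OF assms] by blast
  then have "frechet_derivative f (at x) = f' x" for x
    using frechet_derivative_at by metis
  then show "(f has_derivative frechet_derivative f (at x)) (at x)"
    "bump_algebra (\<lambda>x. frechet_derivative f (at x) w)" using derivative by simp_all
qed

lemma bump_algebra_smooth:
  assumes "bump_algebra f"
  shows "smooth_fun f"
  using assms
proof (coinduction arbitrary: f)
  case smooth_fun
  then show ?case
    using bump_algebra_derivative by (auto simp: differentiable_def)
qed

lemma bump_algebra_continuous: "bump_algebra f \<Longrightarrow> continuous_on UNIV f"
  by (meson bump_algebra_has_derivative continuous_at_imp_continuous_on has_derivative_continuous)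

lemma bump_algebra_translate:
  assumes "bump_algebra f"
  shows "bump_algebra (\<lambda>x. f (x + a))"
  using assms
proof induction
  case (atom m v b)
  have "bump_algebra (\<lambda>x. flat_exp m (x \<bullet> v + (a \<bullet> v + b)))" by (rule bump_algebra.atom)
  then show ?case by (simp add: inner_add_left add.assoc)
qed (auto intro: bump_algebra.intros)

lemma bump_algebra_prod:
  assumes "finite I" "\<And>i. i \<in> I \<Longrightarrow> bump_algebra (f i)"
  shows "bump_algebra (\<lambda>x. \<Prod>i\<in>I. f i x)"
  using assms by (induction I rule: finite_induct) (auto intro: bump_algebra.intros)

definition bump_fun :: "('a::euclidean_space \<Rightarrow> real) \<Rightarrow> bool" where
  "bump_fun \<eta> \<longleftrightarrow> bump_algebra \<eta> \<and> bounded {x. \<eta> x \<noteq> 0}"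

lemma bump_fun_test_fun: "bump_fun \<eta> \<Longrightarrow> test_fun \<eta>"
  by (simp add: bump_fun_def test_fun_def bump_algebra_smooth)

lemma bump_fun_borel: "bump_fun \<eta> \<Longrightarrow> \<eta> \<in> borel_measurable borel"
  by (simp add: bump_fun_def bump_algebra_continuous borel_measurable_continuous_onI)

lemma bump_fun_has_derivative:
  "bump_fun \<eta> \<Longrightarrow> (\<eta> has_derivative frechet_derivative \<eta> (at x)) (at x)"
  by (simp add: bump_fun_def bump_algebra_has_derivative)

lemma bump_fun_frechet_derivative:
  fixes \<eta> :: "'a::euclidean_space \<Rightarrow> real"
  assumes "bump_fun \<eta>"
  shows "bump_fun (\<lambda>x. frechet_derivative \<eta> (at x) w)"
proof -
  obtain R where support: "\<And>x. norm x > R \<Longrightarrow> \<eta> x = 0"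
    using assms unfolding bump_fun_def bounded_iff
    by (metis (mono_tags, lifting) linorder_not_le mem_Collect_eq)
  have "frechet_derivative \<eta> (at x) w = 0" if "norm x > R" for x
  proof -
    have "((\<lambda>_. 0) has_derivative (\<lambda>_. 0)) (at x)" by simp
    then have "(\<eta> has_derivative (\<lambda>_. 0)) (at x)"
      by (rule has_derivative_transform_within_open[of _ _ _ _ "- cball 0 R"]) (use that support in auto)
    then show ?thesis using frechet_derivative_at by metis
  qed
  then have "{x. frechet_derivative \<eta> (at x) w \<noteq> 0} \<subseteq> cball 0 R" by (auto simp: not_less[symmetric])
  then show ?thesis
    using assms bounded_subset[OF bounded_cball]
    by (auto simp: bump_fun_def bump_algebra_frechet_derivative)
qed

lemma bump_fun_translate:
  fixes \<eta> :: "'a::euclidean_space \<Rightarrow> real"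
  assumes "bump_fun \<eta>"
  shows "bump_fun (\<lambda>x. \<eta> (x + a))"
proof -
  have "{x. \<eta> (x + a) \<noteq> 0} = (\<lambda>x. x - a) ` {x. \<eta> x \<noteq> 0}"
    by (force simp: image_iff)
  then show ?thesis
    using assms by (simp add: bump_fun_def bump_algebra_translate bounded_translation_minus)
qed

lemma frechet_derivative_translate:
  assumes "bump_fun \<eta>"
  shows "frechet_derivative (\<lambda>x. \<eta> (x + a)) (at x) = frechet_derivative \<eta> (at (x + a))"
proof -
  have "((\<lambda>x. x + a) has_derivative (\<lambda>w. w)) (at x)" by (auto intro!: derivative_eq_intros)
  from has_derivative_compose[OF this bump_fun_has_derivative[OF assms]]
  show ?thesis by (metis frechet_derivative_at)
qed

lemma bump_fun_bounded:
  fixes \<eta> :: "'a::euclidean_space \<Rightarrow> real"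
  assumes "bump_fun \<eta>"
  obtains C R where "C \<ge> 0" "\<And>x. \<bar>\<eta> x\<bar> \<le> C * indicator (cball 0 R) x"
proof -
  obtain R where "{x. \<eta> x \<noteq> 0} \<subseteq> ball 0 R"
    using assms bounded_subset_ballD unfolding bump_fun_def by blast
  then have support: "{x. \<eta> x \<noteq> 0} \<subseteq> cball 0 R" by auto
  have "compact (\<eta> ` cball 0 R)"
    using assms unfolding bump_fun_def
    by (intro compact_continuous_image continuous_on_subset[OF bump_algebra_continuous]) auto
  then obtain C where "\<forall>y \<in> \<eta> ` cball 0 R. norm y \<le> C"
    using bounded_iff compact_imp_bounded by blast
  then have "\<bar>\<eta> x\<bar> \<le> max C 0 * indicator (cball 0 R) x" for x
    using support by (cases "x \<in> cball 0 R") (auto simp: le_max_iff_disj)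
  then show thesis by (intro that[of "max C 0" R]) auto
qed

lemma integrable_mult_bump_fun:
  fixes u \<eta> :: "'a::euclidean_space \<Rightarrow> real"
  assumes [measurable]: "u \<in> borel_measurable borel" and p_ge_1: "p \<ge> 1" and Lp_finite: "Lp_pow p u < \<infinity>"
    and bump: "bump_fun \<eta>"
  shows "integrable lborel (\<lambda>x. u x * \<eta> x)"
proof -
  note [measurable] = bump_fun_borel[OF bump]
  obtain C R where "\<And>x. \<bar>\<eta> x\<bar> \<le> C * indicator (cball 0 R) x"
    using bump_fun_bounded[OF bump] by blast
  moreover have "(\<integral>\<^sup>+x\<in>cball 0 R. ennreal (\<bar>u x\<bar> powr p) \<partial>lborel) < \<infinity>"
    by (rule le_less_trans[OF set_nn_integral_le_Lp_pow Lp_finite])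
  ultimately show ?thesis
    using emeasure_lborel_cball_finite[of "0::'a" R]
    by (intro integrable_mult_if_powr_integral_finite[OF _ _ _ p_ge_1]) auto
qed

definition box_bump :: "'a::euclidean_space \<Rightarrow> 'a \<Rightarrow> nat \<Rightarrow> 'a \<Rightarrow> real" where
  "box_bump a b k x =
    (\<Prod>i\<in>Basis. flat_exp 0 (real k * (x \<bullet> i - a \<bullet> i)) * flat_exp 0 (real k * (b \<bullet> i - x \<bullet> i)))"

lemma box_bump_support:
  assumes "x \<notin> box a b"
  shows "box_bump a b k x = 0"
proof -
  obtain i where "i \<in> Basis" "x \<bullet> i \<le> a \<bullet> i \<or> b \<bullet> i \<le> x \<bullet> i"
    using assms by (auto simp: box_def not_less)
  then show ?thesis unfolding box_bump_def
    by (intro prod_zero bexI[of _ i]) (auto simp: flat_exp_def zero_less_mult_iff)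
qed

lemma box_bump_bounds: "0 \<le> box_bump a b k x" "box_bump a b k x \<le> 1"
  unfolding box_bump_def by (auto intro!: prod_nonneg prod_le_1 mult_le_one simp: flat_exp_def)

lemma bump_fun_box_bump:
  fixes a b :: "'a::euclidean_space"
  shows "bump_fun (box_bump a b k)"
proof -
  have "bump_algebra (\<lambda>x. flat_exp 0 (x \<bullet> (real k *\<^sub>R i) + - (real k * (a \<bullet> i))) *
      flat_exp 0 (x \<bullet> (- real k *\<^sub>R i) + real k * (b \<bullet> i)))" for i :: 'a
    by (intro bump_algebra.intros)
  then have "bump_algebra
      (\<lambda>x. flat_exp 0 (real k * (x \<bullet> i - a \<bullet> i)) * flat_exp 0 (real k * (b \<bullet> i - x \<bullet> i)))"
    for i :: 'a
    by (simp add: algebra_simps)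
  then have "bump_algebra (box_bump a b k)"
    unfolding box_bump_def[abs_def] by (intro bump_algebra_prod) auto
  moreover have "{x. box_bump a b k x \<noteq> 0} \<subseteq> box a b"
    using box_bump_support by blast
  ultimately show ?thesis
    using bounded_subset[OF bounded_box] by (auto simp: bump_fun_def)
qed

lemma box_bump_tendsto: "(\<lambda>k. box_bump a b k x) \<longlonglongrightarrow> indicator (box a b) x"
proof (cases "x \<in> box a b")
  case True
  have flat_exp_tendsto: "(\<lambda>k. flat_exp 0 (real k * t)) \<longlonglongrightarrow> 1" if "t > 0" for t
  proof -
    have "(\<lambda>k. exp (- (1 / real k * (1 / t)))) \<longlonglongrightarrow> exp (- (0 * (1 / t)))"
      by (intro tendsto_intros lim_1_over_n)
    then have "(\<lambda>k. exp (- (1 / real k * (1 / t)))) \<longlonglongrightarrow> 1" by simp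
    then show ?thesis
      by (rule Lim_transform_eventually)
        (use that in \<open>auto simp: flat_exp_def intro!: eventually_mono[OF eventually_gt_at_top[of 0]]\<close>)
  qed
  have "(\<lambda>k. box_bump a b k x) \<longlonglongrightarrow> (\<Prod>i\<in>(Basis :: 'a set). 1 * 1)"
    unfolding box_bump_def using True by (intro tendsto_prod tendsto_mult flat_exp_tendsto) (auto simp: box_def)
  then show ?thesis using True by simp
qed (simp add: box_bump_support)

section \<open>The fundamental lemma of the calculus of variations\<close>

lemma AE_zero_if_box_integrals_zero:
  fixes u :: "'a::euclidean_space \<Rightarrow> real"
  assumes [measurable]: "u \<in> borel_measurable borel"
    and locally_integrable: "\<And>a b. set_integrable lborel (cbox a b) u"
    and integrals_zero: "\<And>a b. (\<integral>x\<in>box a b. u x \<partial>lborel) = 0"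
  shows "AE x in lborel. u x = 0"
proof -
  have integral_cbox_zero: "u integrable_on cbox a b" "integral (cbox a b) u = 0" for a b
  proof -
    have "AE x in lborel. x \<notin> cbox a b - box a b"
      by (rule AE_not_in[OF null_sets_cbox_Diff_box])
    then have "AE x in lborel. x \<in> cbox a b \<longleftrightarrow> x \<in> box a b"
      by eventually_elim (auto dest: box_subset_cbox[THEN subsetD])
    then have "(\<integral>x\<in>cbox a b. u x \<partial>lborel) = (\<integral>x\<in>box a b. u x \<partial>lborel)"
      unfolding set_lebesgue_integral_def by (intro integral_cong_AE) (auto simp: indicator_def)
    then show "u integrable_on cbox a b" "integral (cbox a b) u = 0"
      using set_borel_integral_eq_integral[OF locally_integrable] integrals_zero by auto
  qed
  obtain N where N_null: "negligible N"
    "\<And>x e. x \<notin> N \<Longrightarrow> 0 < e \<Longrightarrow> \<exists>d>0. \<forall>h. 0 < h \<and> h < d \<longrightarrow>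
      norm (integral (cbox x (x + h *\<^sub>R One)) u /\<^sub>R h ^ DIM('a) - u x) < e"
    using integrable_ccontinuous_explicit[of u] integral_cbox_zero by metis
  have "u x = 0" if x_notin_N: "x \<notin> N" for x
  proof (rule ccontr)
    assume "u x \<noteq> 0"
    then obtain d where modulus: "d > 0" "\<forall>h. 0 < h \<and> h < d \<longrightarrow>
        norm (integral (cbox x (x + h *\<^sub>R One)) u /\<^sub>R h ^ DIM('a) - u x) < \<bar>u x\<bar>"
      using N_null(2)[OF x_notin_N, of "\<bar>u x\<bar>"] by auto
    from modulus(2)[rule_format, of "d / 2"] modulus(1) show False by (simp add: integral_cbox_zero)
  qed
  moreover have "AE x in lebesgue. x \<notin> N"
    using N_null(1) by (intro AE_not_in) (simp add: negligible_iff_null_sets)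
  ultimately have "AE x in lebesgue. u x = 0" by (auto elim: eventually_mono)
  then show ?thesis by (simp add: AE_completion_iff)
qed

lemma AE_zero_if_bump_integrals_zero:
  fixes u :: "'a::euclidean_space \<Rightarrow> real"
  assumes [measurable]: "u \<in> borel_measurable borel"
    and locally_integrable: "\<And>A. A \<in> sets borel \<Longrightarrow> bounded A \<Longrightarrow> set_integrable lborel A u"
    and integrals_zero: "\<And>\<eta>. bump_fun \<eta> \<Longrightarrow> (\<integral>x. u x * \<eta> x \<partial>lborel) = 0"
  shows "AE x in lborel. u x = 0"
proof (rule AE_zero_if_box_integrals_zero)
  fix a b :: 'a
  have [measurable]: "box_bump a b k \<in> borel_measurable borel" for k
    by (rule bump_fun_borel[OF bump_fun_box_bump])
  have "(\<lambda>k. \<integral>x. u x * box_bump a b k x \<partial>lborel) \<longlonglongrightarrow> (\<integral>x. u x * indicator (box a b) x \<partial>lborel)"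
  proof (rule integral_dominated_convergence[where w = "\<lambda>x. \<bar>indicator (box a b) x *\<^sub>R u x\<bar>"])
    show "integrable lborel (\<lambda>x. \<bar>indicator (box a b) x *\<^sub>R u x\<bar>)"
      using locally_integrable[of "box a b"] unfolding set_integrable_def by (intro integrable_abs) auto
    show "AE x in lborel. (\<lambda>k. u x * box_bump a b k x) \<longlonglongrightarrow> u x * indicator (box a b) x"
      by (intro AE_I2 tendsto_intros box_bump_tendsto)
    show "AE x in lborel. norm (u x * box_bump a b k x) \<le> \<bar>indicator (box a b) x *\<^sub>R u x\<bar>" for k
      using box_bump_bounds[of a b k] box_bump_support[of _ a b k]
      by (intro AE_I2) (auto simp: abs_mult mult_left_le split: split_indicator)
  qed measurable
  then show "(\<integral>x\<in>box a b. u x \<partial>lborel) = 0"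
    by (simp add: integrals_zero[OF bump_fun_box_bump] LIMSEQ_const_iff
        set_lebesgue_integral_def mult.commute)
qed (auto intro: locally_integrable)

section \<open>Means along segments\<close>

definition line_mean :: "('a::euclidean_space \<Rightarrow> real) \<Rightarrow> 'a \<Rightarrow> 'a \<Rightarrow> real" where
  "line_mean u z x = mean_on {0..1} (\<lambda>t. u (x + t *\<^sub>R z))"

lemma line_mean_eq: "line_mean u z x = (\<integral>t\<in>{0..1}. u (x + t *\<^sub>R z) \<partial>lborel)"
  by (simp add: line_mean_def mean_on_def)

lemma line_mean_measurable [measurable]:
  assumes [measurable]: "u \<in> borel_measurable borel"
  shows "line_mean u z \<in> borel_measurable borel"
  unfolding line_mean_eq[abs_def] set_lebesgue_integral_def by measurable

lemma line_mean_cmult: "line_mean (\<lambda>x. c * u x) z = (\<lambda>x. c * line_mean u z x)"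
  by (simp add: line_mean_eq fun_eq_iff)

lemma abs_line_mean_powr_le:
  assumes [measurable]: "u \<in> borel_measurable borel" and p_ge_1: "p \<ge> 1"
  shows "ennreal (\<bar>line_mean u z x\<bar> powr p) \<le> (\<integral>\<^sup>+t\<in>{0..1}. ennreal (\<bar>u (x + t *\<^sub>R z)\<bar> powr p) \<partial>lborel)"
proof -
  interpret prob_space "uniform_measure lborel {0..1::real}"
    by (intro prob_space_uniform_measure) auto
  have "ennreal (\<bar>line_mean u z x\<bar> powr p) \<le>
      (\<integral>\<^sup>+t. ennreal (\<bar>u (x + t *\<^sub>R z)\<bar> powr p) \<partial>uniform_measure lborel {0..1})"
    unfolding line_mean_def
    by (subst mean_on_eq_integral_uniform_measure) (auto intro!: abs_expectation_powr_le[OF p_ge_1])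
  then show ?thesis by (simp add: nn_integral_uniform_measure divide_ennreal_def)
qed

lemma nn_integral_line:
  fixes u :: "'a::euclidean_space \<Rightarrow> ennreal"
  assumes [measurable]: "u \<in> borel_measurable borel" "I \<in> sets borel"
  shows "(\<integral>\<^sup>+x. (\<integral>\<^sup>+t\<in>I. u (x + t *\<^sub>R z) \<partial>lborel) \<partial>lborel) = emeasure lborel I * (\<integral>\<^sup>+x. u x \<partial>lborel)"
proof -
  have "(\<integral>\<^sup>+x. (\<integral>\<^sup>+t\<in>I. u (x + t *\<^sub>R z) \<partial>lborel) \<partial>lborel) =
      (\<integral>\<^sup>+t. (\<integral>\<^sup>+x. u (x + t *\<^sub>R z) * indicator I t \<partial>lborel) \<partial>lborel)"
    by (rule lborel_pair.Fubini') measurable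
  also have "\<dots> = (\<integral>\<^sup>+t. (\<integral>\<^sup>+x. u x \<partial>lborel) * indicator I t \<partial>lborel)"
    by (simp add: nn_integral_multc nn_integral_lborel_translate)
  also have "\<dots> = (\<integral>\<^sup>+x. u x \<partial>lborel) * emeasure lborel I"
    by (rule nn_integral_cmult_indicator) measurable
  finally show ?thesis by (simp only: mult.commute)
qed

lemma Lp_pow_line_mean_le:
  fixes u :: "'a::euclidean_space \<Rightarrow> real"
  assumes [measurable]: "u \<in> borel_measurable borel" and p_ge_1: "p \<ge> 1"
  shows "Lp_pow p (line_mean u z) \<le> Lp_pow p u"
proof -
  have "Lp_pow p (line_mean u z) \<le>
      (\<integral>\<^sup>+x. (\<integral>\<^sup>+t\<in>{0..1}. ennreal (\<bar>u (x + t *\<^sub>R z)\<bar> powr p) \<partial>lborel) \<partial>lborel)"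
    unfolding Lp_pow_def by (intro nn_integral_mono abs_line_mean_powr_le p_ge_1) measurable
  also have "\<dots> = emeasure lborel {0..1::real} * Lp_pow p u"
    unfolding Lp_pow_def by (rule nn_integral_line) auto
  finally show ?thesis by simp
qed

lemma integral_line_mean_mult:
  fixes u v :: "'a::euclidean_space \<Rightarrow> real" and \<alpha> \<beta> :: "'a \<Rightarrow> ennreal"
  assumes [measurable]: "u \<in> borel_measurable borel" "v \<in> borel_measurable borel"
      "\<alpha> \<in> borel_measurable borel" "\<beta> \<in> borel_measurable borel"
    and integrals_finite: "(\<integral>\<^sup>+x. \<alpha> x \<partial>lborel) < \<infinity>" "(\<integral>\<^sup>+x. \<beta> x \<partial>lborel) < \<infinity>"
    and bound: "\<And>x y. ennreal \<bar>u y * v x\<bar> \<le> \<alpha> y + \<beta> x"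
  shows "(\<integral>x. line_mean u z x * v x \<partial>lborel) = (\<integral>t\<in>{0..1}. (\<integral>x. u (x + t *\<^sub>R z) * v x \<partial>lborel) \<partial>lborel)"
proof -
  let ?w = "\<lambda>x t. indicator {0..1} t * (u (x + t *\<^sub>R z) * v x)"
  have "(\<integral>\<^sup>+y. ennreal (norm (case_prod ?w y)) \<partial>(lborel \<Otimes>\<^sub>M lborel)) =
      (\<integral>\<^sup>+x. \<integral>\<^sup>+t. ennreal \<bar>?w x t\<bar> \<partial>lborel \<partial>lborel)"
    by (subst lborel.nn_integral_fst[symmetric]) auto
  also have "\<dots> \<le>
      (\<integral>\<^sup>+x. (\<integral>\<^sup>+t. \<alpha> (x + t *\<^sub>R z) * indicator {0..1} t + \<beta> x * indicator {0..1} t \<partial>lborel) \<partial>lborel)"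
    using bound by (intro nn_integral_mono) (auto simp: abs_mult split: split_indicator)
  also have "\<dots> = (\<integral>\<^sup>+x. \<alpha> x \<partial>lborel) + (\<integral>\<^sup>+x. \<beta> x \<partial>lborel)"
    by (simp add: nn_integral_add nn_integral_line nn_integral_cmult)
  also have "\<dots> < \<infinity>" using integrals_finite by simp
  finally have integrable: "integrable (lborel \<Otimes>\<^sub>M lborel) (case_prod ?w)"
    by (intro integrableI_bounded) auto
  have "(\<integral>x. line_mean u z x * v x \<partial>lborel) = (\<integral>x. \<integral>t. ?w x t \<partial>lborel \<partial>lborel)"
    by (simp add: line_mean_eq set_lebesgue_integral_def mult.assoc[symmetric])
  also have "\<dots> = (\<integral>t. \<integral>x. ?w x t \<partial>lborel \<partial>lborel)"
    using lborel_pair.Fubini_integral[OF integrable] by simp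
  finally show ?thesis by (simp add: set_lebesgue_integral_def)
qed

lemma ennreal_abs_mult_le_powr:
  assumes "\<And>x. \<bar>\<eta> x\<bar> \<le> C * indicator A x" and p_ge_1: "p \<ge> 1" and C_nonneg: "C \<ge> 0"
  shows "ennreal \<bar>\<eta> x * a\<bar> \<le> ennreal C * indicator A x + ennreal C * ennreal (\<bar>a\<bar> powr p)"
proof -
  have "\<bar>\<eta> x\<bar> * \<bar>a\<bar> \<le> (C * indicator A x) * (1 + \<bar>a\<bar> powr p)"
    using assms by (intro mult_mono le_one_plus_powr) auto
  also have "\<dots> \<le> C * indicator A x + C * \<bar>a\<bar> powr p"
    using C_nonneg by (auto simp: algebra_simps split: split_indicator)
  finally have "ennreal \<bar>\<eta> x * a\<bar> \<le> ennreal (C * indicator A x + C * \<bar>a\<bar> powr p)"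
    by (intro ennreal_leI) (simp add: abs_mult)
  then show ?thesis using C_nonneg by (simp add: ennreal_mult' ennreal_indicator)
qed

lemma
  fixes u \<eta> :: "'a::euclidean_space \<Rightarrow> real"
  assumes [measurable]: "u \<in> borel_measurable borel" and p_ge_1: "p \<ge> 1" and Lp_finite: "Lp_pow p u < \<infinity>"
    and bump: "bump_fun \<eta>"
  shows integral_line_mean_mult_bump:
      "(\<integral>x. line_mean u z x * \<eta> x \<partial>lborel) =
          (\<integral>t\<in>{0..1}. (\<integral>x. u (x + t *\<^sub>R z) * \<eta> x \<partial>lborel) \<partial>lborel)" (is ?left)
    and integral_line_mean_bump_mult:
      "(\<integral>x. line_mean \<eta> z x * u x \<partial>lborel) =
          (\<integral>t\<in>{0..1}. (\<integral>x. \<eta> (x + t *\<^sub>R z) * u x \<partial>lborel) \<partial>lborel)" (is ?right)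
proof -
  note [measurable] = bump_fun_borel[OF bump]
  obtain C R where C_nonneg: "C \<ge> 0" and bound: "\<And>x. \<bar>\<eta> x\<bar> \<le> C * indicator (cball 0 R) x"
    using bump_fun_bounded[OF bump] by blast
  let ?\<alpha> = "\<lambda>x::'a. ennreal C * ennreal (\<bar>u x\<bar> powr p)"
    and ?\<beta> = "\<lambda>x::'a. ennreal C * indicator (cball 0 R) x"
  have "(\<integral>\<^sup>+x. ?\<alpha> x \<partial>lborel) < \<infinity>" "(\<integral>\<^sup>+x. ?\<beta> x \<partial>lborel) < \<infinity>"
    using Lp_finite emeasure_lborel_cball_finite[of "0::'a" R]
    by (simp_all add: nn_integral_cmult Lp_pow_def ennreal_mult_less_top)
  note weights_finite = this
  note split_le = ennreal_abs_mult_le_powr[OF bound p_ge_1 C_nonneg]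
  show ?left
    by (rule integral_line_mean_mult[of _ _ ?\<alpha> ?\<beta>])
       (use weights_finite in \<open>auto simp: add.commute[of "?\<alpha> _"] mult.commute[of "u _"] intro: split_le\<close>)
  show ?right
    by (rule integral_line_mean_mult[of _ _ ?\<beta> ?\<alpha>]) (use weights_finite split_le in auto)
qed

lemma bump_fun_diff_eq_line_mean:
  fixes \<eta> :: "'a::euclidean_space \<Rightarrow> real"
  assumes bump: "bump_fun \<eta>"
  shows "\<eta> (x + z) - \<eta> x = line_mean (\<lambda>y. frechet_derivative \<eta> (at y) z) z x"
proof -
  let ?D = "\<lambda>y. frechet_derivative \<eta> (at y) z"
  have "(\<integral>t. ?D (x + t *\<^sub>R z) * indicator {0..1} t \<partial>lborel) = \<eta> (x + 1 *\<^sub>R z) - \<eta> (x + 0 *\<^sub>R z)"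
  proof (rule integral_FTC_Icc_real)
    fix t :: real
    have "((\<lambda>t. x + t *\<^sub>R z) has_derivative (\<lambda>h. h *\<^sub>R z)) (at t)"
      by (auto intro!: derivative_eq_intros)
    from has_derivative_compose[OF this bump_fun_has_derivative[OF bump]]
    have "((\<lambda>t. \<eta> (x + t *\<^sub>R z)) has_derivative
        (\<lambda>h. frechet_derivative \<eta> (at (x + t *\<^sub>R z)) (h *\<^sub>R z))) (at t)" .
    moreover have "linear (frechet_derivative \<eta> (at (x + t *\<^sub>R z)))"
      using bump_fun_has_derivative[OF bump] has_derivative_linear by blast
    then have "(\<lambda>h. frechet_derivative \<eta> (at (x + t *\<^sub>R z)) (h *\<^sub>R z)) = (*) (?D (x + t *\<^sub>R z))"
      by (simp add: fun_eq_iff linear_cmul)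
    ultimately show "((\<lambda>t. \<eta> (x + t *\<^sub>R z)) has_real_derivative ?D (x + t *\<^sub>R z)) (at t)"
      unfolding has_field_derivative_def by simp
    have "continuous_on UNIV ?D"
      using bump_fun_frechet_derivative[OF bump] by (simp add: bump_fun_def bump_algebra_continuous)
    then have "continuous_on UNIV (\<lambda>t. ?D (x + t *\<^sub>R z))"
      by (rule continuous_on_compose2) (auto intro!: continuous_intros)
    then show "isCont (\<lambda>t. ?D (x + t *\<^sub>R z)) t"
      by (simp add: continuous_on_eq_continuous_at)
  qed simp
  then show ?thesis by (simp add: line_mean_eq set_lebesgue_integral_def mult.commute)
qed

section \<open>Lebesgue differentiation along lines\<close>

lemma AE_interval_means_tendsto:
  fixes v :: "real \<Rightarrow> real"
  assumes locally_integrable: "\<And>a b. set_integrable lborel {a..b} v"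
    and h_to_0: "\<And>k. h k > 0" "h \<longlonglongrightarrow> 0"
  shows "AE \<tau> in lborel. (\<lambda>k. mean_on {\<tau>..\<tau> + h k} v) \<longlonglongrightarrow> v \<tau>"
proof -
  have "v integrable_on cbox a b" for a b
    using set_borel_integral_eq_integral(1)[OF locally_integrable] by (simp add: cbox_interval)
  then obtain N where N_null: "negligible N"
    "\<And>\<tau> e. \<tau> \<notin> N \<Longrightarrow> 0 < e \<Longrightarrow> \<exists>d>0. \<forall>h. 0 < h \<and> h < d \<longrightarrow>
      norm (integral (cbox \<tau> (\<tau> + h *\<^sub>R One)) v /\<^sub>R h ^ DIM(real) - v \<tau>) < e"
    using integrable_ccontinuous_explicit[of v] by metis
  have mean_eq: "mean_on {\<tau>..\<tau> + h k} v =
      integral (cbox \<tau> (\<tau> + h k *\<^sub>R One)) v /\<^sub>R h k ^ DIM(real)" for \<tau> k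
    using set_borel_integral_eq_integral(2)[OF locally_integrable[of \<tau> "\<tau> + h k"]] h_to_0(1)[of k]
    by (simp add: mean_on_def cbox_interval divide_inverse mult.commute)
  have means_tendsto: "(\<lambda>k. mean_on {\<tau>..\<tau> + h k} v) \<longlonglongrightarrow> v \<tau>" if \<tau>_notin_N: "\<tau> \<notin> N" for \<tau>
  proof (rule LIMSEQ_I)
    fix e :: real
    assume "e > 0"
    then obtain d where modulus: "d > 0" "\<And>h. 0 < h \<Longrightarrow> h < d \<Longrightarrow>
        norm (integral (cbox \<tau> (\<tau> + h *\<^sub>R One)) v /\<^sub>R h ^ DIM(real) - v \<tau>) < e"
      using N_null(2)[OF \<tau>_notin_N] by metis
    obtain k0 where "\<And>k. k \<ge> k0 \<Longrightarrow> norm (h k - 0) < d"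
      using LIMSEQ_D[OF h_to_0(2) modulus(1)] by blast
    then have "\<And>k. k \<ge> k0 \<Longrightarrow> h k < d" by fastforce
    then show "\<exists>k0. \<forall>k\<ge>k0. norm (mean_on {\<tau>..\<tau> + h k} v - v \<tau>) < e"
      unfolding mean_eq using modulus(2)[OF h_to_0(1)] by blast
  qed
  have "AE \<tau> in lebesgue. \<tau> \<notin> N"
    using N_null(1) by (intro AE_not_in) (simp add: negligible_iff_null_sets)
  then have "AE \<tau> in lebesgue. (\<lambda>k. mean_on {\<tau>..\<tau> + h k} v) \<longlonglongrightarrow> v \<tau>"
    by (rule eventually_mono) (rule means_tendsto)
  then show ?thesis by (simp add: AE_completion_iff)
qed

lemma line_mean_eq_mean_on:
  assumes "h > 0"
  shows "line_mean u (h *\<^sub>R \<xi>) (x + \<tau> *\<^sub>R \<xi>) = mean_on {\<tau>..\<tau> + h} (\<lambda>\<sigma>. u (x + \<sigma> *\<^sub>R \<xi>))"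
proof -
  have "(\<integral>\<sigma>\<in>{\<tau>..\<tau> + h}. u (x + \<sigma> *\<^sub>R \<xi>) \<partial>lborel) =
      h * (\<integral>t. indicator {\<tau>..\<tau> + h} (\<tau> + h * t) * u (x + (\<tau> + h * t) *\<^sub>R \<xi>) \<partial>lborel)"
    using lborel_integral_real_affine[of h "\<lambda>\<sigma>. indicator {\<tau>..\<tau> + h} \<sigma> * u (x + \<sigma> *\<^sub>R \<xi>)" \<tau>] assms
    by (simp add: set_lebesgue_integral_def)
  also have "(\<integral>t. indicator {\<tau>..\<tau> + h} (\<tau> + h * t) * u (x + (\<tau> + h * t) *\<^sub>R \<xi>) \<partial>lborel) =
      line_mean u (h *\<^sub>R \<xi>) (x + \<tau> *\<^sub>R \<xi>)"
    unfolding line_mean_eq set_lebesgue_integral_def using assms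
    by (intro Bochner_Integration.integral_cong)
       (auto simp: scaleR_left_distrib add.assoc mult.commute zero_le_mult_iff mult_le_cancel_left1
           split: split_indicator)
  finally show ?thesis using assms by (simp add: mean_on_def)
qed

lemma tendsto_iff_limsup_dist_eq_0:
  fixes X :: "nat \<Rightarrow> real"
  shows "X \<longlonglongrightarrow> L \<longleftrightarrow> limsup (\<lambda>k. ennreal \<bar>X k - L\<bar>) = 0"
proof
  assume "X \<longlonglongrightarrow> L"
  then have "(\<lambda>k. ennreal \<bar>X k - L\<bar>) \<longlonglongrightarrow> ennreal 0"
    by (intro tendsto_ennrealI) (simp add: LIM_zero tendsto_rabs_zero)
  then show "limsup (\<lambda>k. ennreal \<bar>X k - L\<bar>) = 0"
    by (intro lim_imp_Limsup) auto
next
  assume "limsup (\<lambda>k. ennreal \<bar>X k - L\<bar>) = 0"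
  then have "(\<lambda>k. ennreal \<bar>X k - L\<bar>) \<longlonglongrightarrow> ennreal 0"
    using tendsto_0_if_Limsup_eq_0_ennreal by simp
  then have "(\<lambda>k. \<bar>X k - L\<bar>) \<longlonglongrightarrow> 0"
    by (subst (asm) tendsto_ennreal_iff) auto
  then show "X \<longlonglongrightarrow> L" by (simp add: tendsto_rabs_zero_iff LIM_zero_iff)
qed

lemma AE_locally_integrable_along_lines:
  fixes u :: "'a::euclidean_space \<Rightarrow> real"
  assumes [measurable]: "u \<in> borel_measurable borel" and p_ge_1: "p \<ge> 1" and Lp_finite: "Lp_pow p u < \<infinity>"
  shows "AE x in lborel. \<forall>a b. set_integrable lborel {a..b} (\<lambda>\<tau>. u (x + \<tau> *\<^sub>R \<xi>))"
proof -
  have "AE x in lborel. (\<integral>\<^sup>+\<tau>\<in>{- real m..real m}. ennreal (\<bar>u (x + \<tau> *\<^sub>R \<xi>)\<bar> powr p) \<partial>lborel) \<noteq> \<infinity>" for m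
  proof (rule nn_integral_noteq_infinite)
    have "(\<integral>\<^sup>+x. (\<integral>\<^sup>+\<tau>\<in>{- real m..real m}. ennreal (\<bar>u (x + \<tau> *\<^sub>R \<xi>)\<bar> powr p) \<partial>lborel) \<partial>lborel) =
        emeasure lborel {- real m..real m} * Lp_pow p u"
      unfolding Lp_pow_def by (rule nn_integral_line) auto
    also have "\<dots> < \<infinity>" using Lp_finite by (simp add: ennreal_mult_less_top)
    finally show "(\<integral>\<^sup>+x. (\<integral>\<^sup>+\<tau>\<in>{- real m..real m}. ennreal (\<bar>u (x + \<tau> *\<^sub>R \<xi>)\<bar> powr p) \<partial>lborel) \<partial>lborel) \<noteq> \<infinity>"
      by simp
  qed measurable
  then have "AE x in lborel. \<forall>m. (\<integral>\<^sup>+\<tau>\<in>{- real m..real m}. ennreal (\<bar>u (x + \<tau> *\<^sub>R \<xi>)\<bar> powr p) \<partial>lborel) \<noteq> \<infinity>"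
    by (simp add: AE_all_countable)
  then show ?thesis
  proof eventually_elim
    case (elim x)
    have "set_integrable lborel {- real m..real m} (\<lambda>\<tau>. u (x + \<tau> *\<^sub>R \<xi>))" for m
    proof -
      have "integrable lborel (\<lambda>\<tau>. u (x + \<tau> *\<^sub>R \<xi>) * indicator {- real m..real m} \<tau>)"
        using elim[rule_format, of m] p_ge_1
        by (intro integrable_mult_if_powr_integral_finite[of _ _ "{- real m..real m}" p 1])
           (auto simp: less_top)
      then show ?thesis by (simp add: set_integrable_def mult.commute)
    qed
    note centered = this
    have "set_integrable lborel {a..b} (\<lambda>\<tau>. u (x + \<tau> *\<^sub>R \<xi>))" for a b
    proof -
      obtain m where "max \<bar>a\<bar> \<bar>b\<bar> \<le> real m" using real_arch_simple by blast
      then show ?thesis by (intro set_integrable_subset[OF centered[of m]]) auto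
    qed
    then show ?case by blast
  qed
qed

lemma AE_line_mean_tendsto:
  fixes u :: "'a::euclidean_space \<Rightarrow> real"
  assumes [measurable]: "u \<in> borel_measurable borel" and p_ge_1: "p \<ge> 1" and Lp_finite: "Lp_pow p u < \<infinity>"
    and h_to_0: "\<And>k. h k > 0" "h \<longlonglongrightarrow> 0"
  shows "AE x in lborel. (\<lambda>k. line_mean u (h k *\<^sub>R \<xi>) x) \<longlonglongrightarrow> u x"
proof -
  define B where "B = {x. limsup (\<lambda>k. ennreal \<bar>line_mean u (h k *\<^sub>R \<xi>) x - u x\<bar>) \<noteq> 0}"
  have [measurable]: "B \<in> sets borel" unfolding B_def by measurable
  have B_iff: "x \<notin> B \<longleftrightarrow> (\<lambda>k. line_mean u (h k *\<^sub>R \<xi>) x) \<longlonglongrightarrow> u x" for x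
    by (simp add: B_def tendsto_iff_limsup_dist_eq_0)
  have "AE x in lborel. (\<integral>\<^sup>+\<tau>\<in>{0..1}. indicator B (x + \<tau> *\<^sub>R \<xi>) \<partial>lborel) = (0::ennreal)"
    using AE_locally_integrable_along_lines[OF assms(1) p_ge_1 Lp_finite, of \<xi>]
  proof eventually_elim
    case (elim x)
    then have "AE \<tau> in lborel. (\<lambda>k. mean_on {\<tau>..\<tau> + h k} (\<lambda>\<sigma>. u (x + \<sigma> *\<^sub>R \<xi>))) \<longlonglongrightarrow> u (x + \<tau> *\<^sub>R \<xi>)"
      by (intro AE_interval_means_tendsto h_to_0) blast
    then have "AE \<tau> in lborel. x + \<tau> *\<^sub>R \<xi> \<notin> B"
      by (simp add: B_iff line_mean_eq_mean_on h_to_0)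
    then show ?case by (subst nn_integral_0_iff_AE) (auto elim: eventually_mono)
  qed
  then have "(\<integral>\<^sup>+x. (\<integral>\<^sup>+\<tau>\<in>{0..1}. indicator B (x + \<tau> *\<^sub>R \<xi>) \<partial>lborel) \<partial>lborel) = (0::ennreal)"
    by (subst nn_integral_0_iff_AE) auto
  then have "B \<in> null_sets lborel"
    by (simp add: nn_integral_line null_sets_def)
  from AE_not_in[OF this] show ?thesis by (simp add: B_iff)
qed

section \<open>The fractional polar projection body as a level set\<close>

lemma shift_gauge_frac_gauge_pow:
  assumes "f \<in> borel_measurable borel" "p \<ge> 1" "0 < s" "s < 1"
  shows "shift_gauge f p (s * p) (shift_const s p) (frac_gauge_pow s p f)"
  using assms
  by unfold_locales
    (auto simp: shift_const_def frac_gauge_pow_scaleR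
        shift_energy_le_frac_gauge_pow[unfolded shift_const_def])

lemma emeasure_frac_gauge_pow_level:
  fixes f :: "'a::euclidean_space \<Rightarrow> real"
  assumes "f \<in> borel_measurable borel" "s * p \<noteq> 0" "c > 0"
  shows "emeasure lborel {\<xi>. frac_gauge_pow s p f \<xi> \<le> ennreal c} =
    ennreal (c powr (real DIM('a) / (s * p))) * emeasure lborel (frac_polar_proj_body s p f)"
  using assms emeasure_lborel_homogeneous_sublevel[of "frac_gauge_pow s p f" "s * p" c]
  by (simp add: frac_gauge_pow_scaleR frac_polar_proj_body_def)

lemma emeasure_frac_polar_proj_body_finite:
  fixes f :: "'a::euclidean_space \<Rightarrow> real"
  assumes f_borel: "f \<in> borel_measurable borel" and p_ge_1: "p \<ge> 1" and s_bounds: "0 < s" "s < 1"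
    and Lp_finite: "Lp_pow p f < \<infinity>"
    and supp_pos_finite: "0 < emeasure lborel (supp_set f)" "emeasure lborel (supp_set f) < \<infinity>"
  shows "emeasure lborel (frac_polar_proj_body s p f) < \<infinity>"
proof -
  interpret shift_gauge f p "s * p" "shift_const s p" "frac_gauge_pow s p f"
    by (rule shift_gauge_frac_gauge_pow[OF f_borel p_ge_1 s_bounds])
  show ?thesis
    using emeasure_level_finite Lp_finite supp_pos_finite f_borel
    by (simp add: level_def frac_polar_proj_body_def Lp_pow_eq_0_iff)
qed

definition morrey_const :: "'a::euclidean_space itself \<Rightarrow> real \<Rightarrow> real \<Rightarrow> real" where
  "morrey_const _ s0 p = 16 * (3 * 4 powr p * p) powr (1 / p) *
      (1 + 1 / (1 - 2 powr (real DIM('a) / (s0 * p) - 1)))"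

lemma inverse_one_minus_two_powr_mono:
  fixes n q q0 :: real
  assumes "0 < n" "n < q0" "q0 \<le> q"
  shows "1 / (1 - 2 powr (n / q - 1)) \<le> 1 / (1 - 2 powr (n / q0 - 1))"
proof -
  have mono: "2 powr (n / q - 1) \<le> 2 powr (n / q0 - 1)"
    using assms by (intro powr_mono diff_right_mono divide_left_mono) auto
  have "2 powr (n / q0 - 1) < 2 powr 0"
    using assms by (intro powr_less_mono) auto
  with mono show ?thesis by (intro divide_left_mono mult_pos_pos) (auto simp del: powr_le_cancel_iff)
qed

theorem fractional_morrey:
  fixes f :: "'a::euclidean_space \<Rightarrow> real"
  assumes f_borel [measurable]: "f \<in> borel_measurable borel" and dim_less_p: "real DIM('a) < p"
    and s_bounds: "real DIM('a) / p < s0" "s0 < s" "s < 1"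
    and seminorms_finite: "Lp_pow p f < \<infinity>" "gagliardo s p f < \<infinity>"
    and supp_pos_finite: "0 < emeasure lborel (supp_set f)" "emeasure lborel (supp_set f) < \<infinity>"
  shows "AE x in lborel. \<bar>f x\<bar> \<le> morrey_const TYPE('a) s0 p *
    measure lborel (supp_set f) powr (s / real DIM('a) - 1 / p) * (1 - s) powr (1 / p) *
    measure lborel (frac_polar_proj_body s p f) powr (- s / real DIM('a))"
proof -
  let ?n = "real DIM('a)"
  let ?\<sigma> = "measure lborel (supp_set f)" and ?k = "measure lborel (frac_polar_proj_body s p f)"
  have p_gt_1: "p > 1" using dim_less_p DIM_positive[where 'a = 'a] by linarith
  have "0 < ?n / p" using p_gt_1 by simp
  then have s_pos: "0 < s0" "0 < s" using s_bounds by linarith+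
  have "?n < s0 * p" "s0 * p < s * p"
    using s_bounds p_gt_1 by (auto simp: divide_less_eq)
  then have n_less: "?n < s0 * p" "?n < s * p" "s0 * p < s * p" by linarith+
  interpret shift_gauge f p "s * p" "shift_const s p" "frac_gauge_pow s p f"
    using p_gt_1 s_pos s_bounds by (intro shift_gauge_frac_gauge_pow) auto
  have level_one_eq: "level 1 = frac_polar_proj_body s p f"
    by (simp add: level_def frac_polar_proj_body_def)
  interpret morrey_gauge f p "s * p" "shift_const s p" "frac_gauge_pow s p f"
    using p_gt_1 s_pos s_bounds n_less(2) seminorms_finite supp_pos_finite
      emeasure_frac_polar_proj_body_pos[OF f_borel, of s p]
    by unfold_locales (auto simp: frac_gauge_pow_diff_le level_one_eq)
  have "1 / (1 - decay) \<le> 1 / (1 - 2 powr (?n / (s0 * p) - 1))"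
    unfolding decay_def using n_less by (intro inverse_one_minus_two_powr_mono) auto
  then have "16 * shift_const s p powr (1 / p) * (1 + 1 / (1 - decay)) \<le>
      16 * shift_const s p powr (1 / p) * (1 + 1 / (1 - 2 powr (?n / (s0 * p) - 1)))"
    by (intro mult_left_mono add_left_mono) auto
  also have "\<dots> = morrey_const TYPE('a) s0 p * (1 - s) powr (1 / p)"
    by (simp add: morrey_const_def shift_const_def powr_mult mult_ac)
  finally have const_le: "16 * shift_const s p powr (1 / p) * (1 + 1 / (1 - decay)) \<le>
      morrey_const TYPE('a) s0 p * (1 - s) powr (1 / p)" .
  have "16 * shift_const s p powr (1 / p) * (1 + 1 / (1 - decay)) *
        ?\<sigma> powr (s / ?n - 1 / p) * ?k powr (- s / ?n) \<le>
      morrey_const TYPE('a) s0 p * (1 - s) powr (1 / p) * ?\<sigma> powr (s / ?n - 1 / p) * ?k powr (- s / ?n)"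
    by (intro mult_right_mono const_le) auto
  then show ?thesis
    using morrey_inequality p_gt_1
    by (auto simp: level_one_eq mult_ac elim!: eventually_mono order_trans[rotated])
qed

section \<open>Two-sided bounds for the fractional gauge\<close>

lemma frac_gauge_pow_le_interpolation:
  fixes f :: "'a::euclidean_space \<Rightarrow> real"
  assumes [measurable]: "f \<in> borel_measurable borel" and p_ge_1: "p \<ge> 1" and s_bounds: "0 < s" "s < 1"
    and small_scale_bound: "N > 0" "\<And>t. t > 0 \<Longrightarrow> shift_energy p f (t *\<^sub>R \<xi>) \<le> ennreal (t powr p * N)"
    and large_scale_bound: "M > 0" "\<And>z. shift_energy p f z \<le> ennreal M"
  shows "frac_gauge_pow s p f \<xi> \<le> ennreal (N powr s * M powr (1 - s) / (p * s * (1 - s)))"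
proof -
  define T where "T = (M / N) powr (1 / p)"
  have T_pos: "T > 0" using large_scale_bound small_scale_bound by (simp add: T_def)
  have sp_bounds: "s * p - p < 0" "s * p > 0" "0 \<le> p - s * p" using s_bounds p_ge_1 by auto
  let ?w = "gauge_weight (s * p)" and ?v = "gauge_weight (s * p - p)"
  have "frac_gauge_pow s p f \<xi> \<le>
      (\<integral>\<^sup>+t. ?v t * indicator {..<T} t * ennreal N + ?w t * indicator {T..} t * ennreal M \<partial>lborel)"
    unfolding frac_gauge_pow_eq
  proof (rule nn_integral_mono)
    fix t :: real
    consider (nonpos) "t \<le> 0" | (small) "0 < t" "t < T" | (large) "T \<le> t" by linarith
    then show "?w t * shift_energy p f (t *\<^sub>R \<xi>) \<le>
        ?v t * indicator {..<T} t * ennreal N + ?w t * indicator {T..} t * ennreal M"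
    proof cases
      case small
      have "?w t * shift_energy p f (t *\<^sub>R \<xi>) \<le> ?w t * (ennreal (t powr p) * ennreal N)"
        using small_scale_bound small by (intro mult_left_mono) (auto simp: ennreal_mult')
      also have "\<dots> = ?v t * ennreal N"
        by (simp add: mult.assoc[symmetric] gauge_weight_mult_powr)
      finally show ?thesis using small by simp
    next
      case large
      then show ?thesis using large_scale_bound(2)[of "t *\<^sub>R \<xi>"] by (simp add: mult_left_mono)
    qed (simp add: gauge_weight_def)
  qed
  also have "\<dots> = ennreal (T powr (p - s * p) / (p - s * p)) * ennreal N +
      ennreal (T powr (- (s * p)) / (s * p)) * ennreal M"
    using nn_integral_gauge_weight_lessThan[OF T_pos sp_bounds(1)]
      nn_integral_gauge_weight_atLeast[OF T_pos sp_bounds(2)]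
    by (simp add: nn_integral_add nn_integral_multc)
  also have "\<dots> = ennreal (T powr (p - s * p) * N / (p - s * p) + T powr (- (s * p)) * M / (s * p))"
    using large_scale_bound small_scale_bound sp_bounds by (simp flip: ennreal_mult' ennreal_plus)
  also have "T powr (p - s * p) * N = N powr s * M powr (1 - s)"
    using large_scale_bound small_scale_bound p_ge_1
    by (simp add: T_def powr_powr powr_divide powr_diff diff_divide_distrib)
  also have "T powr (- (s * p)) * M = N powr s * M powr (1 - s)"
    using large_scale_bound small_scale_bound p_ge_1
    by (simp add: T_def powr_powr powr_divide powr_diff powr_minus_divide)
  also have "x / (p - s * p) + x / (s * p) = x / (p * s * (1 - s))" for x
    using p_ge_1 s_bounds by (simp add: divide_simps) (simp add: algebra_simps)
  finally show ?thesis .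
qed

lemma frac_gauge_pow_ge:
  assumes [measurable]: "f \<in> borel_measurable borel" and p_pos: "p > 0" and s_less_1: "s < 1"
    and c_nonneg: "c \<ge> 0" and \<delta>_pos: "\<delta> > 0"
    and shift_energy_ge: "\<And>t. 0 < t \<Longrightarrow> t < \<delta> \<Longrightarrow> ennreal (c * t powr p) \<le> shift_energy p f (t *\<^sub>R \<xi>)"
  shows "ennreal (c * \<delta> powr (p * (1 - s)) / (p * (1 - s))) \<le> frac_gauge_pow s p f \<xi>"
proof -
  have sp_less_p: "s * p - p < 0" using s_less_1 p_pos by simp
  have "ennreal (c * \<delta> powr (p * (1 - s)) / (p * (1 - s))) =
      ennreal (\<delta> powr (- (s * p - p)) / (- (s * p - p))) * ennreal c"
    using c_nonneg by (simp add: algebra_simps flip: ennreal_mult')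
  also have "\<dots> = (\<integral>\<^sup>+t. gauge_weight (s * p - p) t * indicator {..<\<delta>} t * ennreal c \<partial>lborel)"
    by (simp add: nn_integral_multc nn_integral_gauge_weight_lessThan[OF \<delta>_pos sp_less_p])
  also have "\<dots> \<le> frac_gauge_pow s p f \<xi>"
    unfolding frac_gauge_pow_eq
  proof (rule nn_integral_mono)
    fix t :: real
    show "gauge_weight (s * p - p) t * indicator {..<\<delta>} t * ennreal c \<le>
        gauge_weight (s * p) t * shift_energy p f (t *\<^sub>R \<xi>)"
    proof (cases "0 < t \<and> t < \<delta>")
      case True
      have "gauge_weight (s * p - p) t * ennreal c = gauge_weight (s * p) t * ennreal (c * t powr p)"
        using c_nonneg by (simp add: ennreal_mult mult_ac flip: gauge_weight_mult_powr)
      also have "\<dots> \<le> gauge_weight (s * p) t * shift_energy p f (t *\<^sub>R \<xi>)"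
        using True by (intro mult_left_mono shift_energy_ge) auto
      finally show ?thesis using True by simp
    qed (auto simp: gauge_weight_def)
  qed
  finally show ?thesis .
qed

section \<open>Gradient energies\<close>

definition grad_energy :: "real \<Rightarrow> ('a::euclidean_space \<Rightarrow> 'a) \<Rightarrow> 'a \<Rightarrow> ennreal" where
  "grad_energy p g z = Lp_pow p (\<lambda>x. g x \<bullet> z)"

lemma polar_proj_body_eq: "polar_proj_body p g = {\<xi>. grad_energy p g \<xi> \<le> 1}"
  by (simp add: polar_proj_body_def grad_energy_def Lp_pow_def nn_integral_completion)

lemma grad_energy_measurable [measurable]:
  assumes [measurable]: "g \<in> borel_measurable borel"
  shows "grad_energy p g \<in> borel_measurable borel"
  unfolding grad_energy_def[abs_def] by measurable

lemma polar_proj_body_sets [measurable]: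
  assumes [measurable]: "g \<in> borel_measurable borel"
  shows "polar_proj_body p g \<in> sets borel"
  unfolding polar_proj_body_eq by measurable

lemma grad_energy_scaleR:
  assumes [measurable]: "g \<in> borel_measurable borel"
  shows "grad_energy p g (r *\<^sub>R z) = ennreal (\<bar>r\<bar> powr p) * grad_energy p g z"
  by (simp add: grad_energy_def Lp_pow_cmult)

lemma grad_energy_le:
  assumes [measurable]: "g \<in> borel_measurable borel" and "p \<ge> 0"
  shows "grad_energy p g z \<le> ennreal (norm z powr p) * Lp_pow p (\<lambda>x. norm (g x))"
proof -
  have "\<bar>g x \<bullet> z\<bar> \<le> norm z * norm (g x)" for x
    using Cauchy_Schwarz_ineq2[of "g x" z] by (simp add: mult.commute)
  then have "grad_energy p g z \<le> Lp_pow p (\<lambda>x. norm z * norm (g x))"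
    unfolding grad_energy_def Lp_pow_def using \<open>p \<ge> 0\<close>
    by (intro nn_integral_mono ennreal_leI powr_mono2) (auto simp: abs_mult)
  then show ?thesis by (simp add: Lp_pow_cmult)
qed

lemma emeasure_polar_proj_body_pos:
  fixes g :: "'a::euclidean_space \<Rightarrow> 'a"
  assumes [measurable]: "g \<in> borel_measurable borel" and p_pos: "p > 0"
    and Lp_norm_finite: "Lp_pow p (\<lambda>x. norm (g x)) < \<infinity>"
  shows "emeasure lborel (polar_proj_body p g) > 0"
proof -
  obtain b where b_eq: "b \<ge> 0" "Lp_pow p (\<lambda>x. norm (g x)) = ennreal b"
    using Lp_norm_finite by (cases "Lp_pow p (\<lambda>x. norm (g x))") auto
  define \<rho> where "\<rho> = (1 / (b + 1)) powr (1 / p)"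
  have \<rho>_root: "\<rho> > 0" "\<rho> powr p = 1 / (b + 1)" using b_eq p_pos by (auto simp: \<rho>_def powr_powr)
  have "cball 0 \<rho> \<subseteq> polar_proj_body p g"
  proof
    fix \<xi> :: 'a
    assume "\<xi> \<in> cball 0 \<rho>"
    then have "norm \<xi> powr p \<le> 1 / (b + 1)"
      using p_pos powr_mono2[of p "norm \<xi>" \<rho>] by (simp add: \<rho>_root)
    then have "norm \<xi> powr p * b \<le> 1 / (b + 1) * b"
      using b_eq by (intro mult_right_mono)
    also have "\<dots> \<le> 1" using b_eq by simp
    finally have "ennreal (norm \<xi> powr p) * ennreal b \<le> 1"
      using b_eq by (simp flip: ennreal_mult)
    then show "\<xi> \<in> polar_proj_body p g"
      using grad_energy_le[OF assms(1), of p \<xi>] p_pos b_eq by (simp add: polar_proj_body_eq order_trans)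
  qed
  then have "emeasure lborel (cball (0::'a) \<rho>) \<le> emeasure lborel (polar_proj_body p g)"
    by (intro emeasure_mono) auto
  moreover have "emeasure lborel (cball (0::'a) \<rho>) > 0"
    using emeasure_cball[of \<rho> "0::'a"] \<rho>_root(1) unit_ball_vol_pos[of "real DIM('a)"]
    by (simp add: ennreal_zero_less_mult_iff)
  ultimately show ?thesis by (rule less_le_trans[rotated])
qed

section \<open>Shifts of Sobolev functions\<close>

locale sobolev_pair =
  fixes p :: real and f :: "'a::euclidean_space \<Rightarrow> real" and g :: "'a \<Rightarrow> 'a"
  assumes f_borel [measurable]: "f \<in> borel_measurable borel"
    and g_borel [measurable]: "g \<in> borel_measurable borel"
    and p_ge_1: "p \<ge> 1" and W1p: "W1p_grad p f g"
begin

lemma Lp_finite: "Lp_pow p f < \<infinity>"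
  using W1p
  by (auto simp: W1p_grad_def Lp_fun_def Lp_pow_def integrable_iff_bounded nn_integral_completion)

lemma Lp_norm_grad_finite: "Lp_pow p (\<lambda>x. norm (g x)) < \<infinity>"
  using W1p by (auto simp: W1p_grad_def Lp_pow_def integrable_iff_bounded nn_integral_completion)

lemma grad_energy_finite: "grad_energy p g z < \<infinity>"
  using p_ge_1 Lp_norm_grad_finite
  by (intro le_less_trans[OF grad_energy_le[OF g_borel]]) (auto simp: ennreal_mult_less_top)

lemma integral_mult_bump_derivative:
  assumes bump: "bump_fun \<eta>"
  shows "(\<integral>x. f x * frechet_derivative \<eta> (at x) z \<partial>lborel) = - (\<integral>x. (g x \<bullet> z) * \<eta> x \<partial>lborel)"
proof -
  let ?D = "\<lambda>x. frechet_derivative \<eta> (at x)"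
  note [measurable] = bump_fun_borel[OF bump] bump_fun_borel[OF bump_fun_frechet_derivative[OF bump]]
  have basis: "(\<integral>x. f x * ?D x i \<partial>lborel) = - (\<integral>x. (g x \<bullet> i) * \<eta> x \<partial>lborel)" if "i \<in> Basis" for i
  proof -
    have "(\<integral>x. f x * ?D x i \<partial>lebesgue) = - (\<integral>x. (g x \<bullet> i) * \<eta> x \<partial>lebesgue)"
      using W1p bump_fun_test_fun[OF bump] that unfolding W1p_grad_def weak_gradient_def by blast
    then show ?thesis by (subst (asm) (1 2) integral_completion) auto
  qed
  have "?D x z = (\<Sum>i\<in>Basis. (z \<bullet> i) * ?D x i)" for x
  proof -
    have "linear (?D x)" using bump_fun_has_derivative[OF bump] has_derivative_linear by blast
    then have "?D x (\<Sum>i\<in>Basis. (z \<bullet> i) *\<^sub>R i) = (\<Sum>i\<in>Basis. (z \<bullet> i) * ?D x i)"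
      by (simp add: linear_sum linear_cmul)
    then show ?thesis by (simp add: euclidean_representation)
  qed
  then have "(\<integral>x. f x * ?D x z \<partial>lborel) = (\<integral>x. (\<Sum>i\<in>Basis. (z \<bullet> i) * (f x * ?D x i)) \<partial>lborel)"
    by (simp add: sum_distrib_left mult_ac)
  also have "\<dots> = (\<Sum>i\<in>Basis. (z \<bullet> i) * (\<integral>x. f x * ?D x i \<partial>lborel))"
    by (subst Bochner_Integration.integral_sum)
       (auto intro!: integrable_mult_bump_fun[OF _ p_ge_1] Lp_finite bump_fun_frechet_derivative bump)
  also have "\<dots> = - (\<Sum>i\<in>Basis. (z \<bullet> i) * (\<integral>x. (g x \<bullet> i) * \<eta> x \<partial>lborel))"
    by (simp add: basis sum_negf)
  also have "(\<Sum>i\<in>Basis. (z \<bullet> i) * (\<integral>x. (g x \<bullet> i) * \<eta> x \<partial>lborel)) =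
      (\<integral>x. (\<Sum>i\<in>Basis. (z \<bullet> i) * ((g x \<bullet> i) * \<eta> x)) \<partial>lborel)"
    using grad_energy_finite unfolding grad_energy_def
    by (subst Bochner_Integration.integral_sum) (auto intro!: integrable_mult_bump_fun[OF _ p_ge_1] bump)
  also have "\<dots> = (\<integral>x. (g x \<bullet> z) * \<eta> x \<partial>lborel)"
    by (rule Bochner_Integration.integral_cong)
       (auto simp: euclidean_inner[of "g _" z] sum_distrib_left mult_ac)
  finally show ?thesis .
qed

lemma integral_shift_diff_mult_bump:
  assumes bump: "bump_fun \<eta>"
  shows "(\<integral>x. (f (x + z) - f x) * \<eta> x \<partial>lborel) = (\<integral>x. line_mean (\<lambda>x. g x \<bullet> z) z x * \<eta> x \<partial>lborel)"
proof -
  let ?D = "\<lambda>x. frechet_derivative \<eta> (at x) (- z)"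
  note [measurable] = bump_fun_borel[OF bump]
  have shifted: "bump_fun (\<lambda>x. \<eta> (x + a))" for a by (rule bump_fun_translate[OF bump])
  have "(\<integral>x. (f (x + z) - f x) * \<eta> x \<partial>lborel) = (\<integral>x. f (x + z) * \<eta> x \<partial>lborel) - (\<integral>x. f x * \<eta> x \<partial>lborel)"
    using integrable_mult_bump_fun[OF _ p_ge_1 _ bump] Lp_finite
    by (simp add: left_diff_distrib Lp_pow_translate)
  also have "(\<integral>x. f (x + z) * \<eta> x \<partial>lborel) = (\<integral>x. f x * \<eta> (x + - z) \<partial>lborel)"
    using integral_lborel_translate[of "\<lambda>x. f x * \<eta> (x + - z)" z] by simp
  also have "\<dots> - (\<integral>x. f x * \<eta> x \<partial>lborel) = (\<integral>x. f x * (\<eta> (x + - z) - \<eta> x) \<partial>lborel)"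
    using integrable_mult_bump_fun[OF _ p_ge_1 _ bump]
      integrable_mult_bump_fun[OF _ p_ge_1 _ shifted[of "- z"]] Lp_finite
    by (simp add: right_diff_distrib)
  also have "\<dots> = (\<integral>x. line_mean ?D (- z) x * f x \<partial>lborel)"
    by (simp only: bump_fun_diff_eq_line_mean[OF bump] mult.commute)
  also have "\<dots> = (\<integral>t\<in>{0..1}. (\<integral>x. ?D (x + t *\<^sub>R (- z)) * f x \<partial>lborel) \<partial>lborel)"
    by (rule integral_line_mean_bump_mult[OF _ p_ge_1 Lp_finite])
       (auto intro: bump_fun_frechet_derivative bump)
  also have "\<dots> = (\<integral>t\<in>{0..1}. (\<integral>x. (g (x + t *\<^sub>R z) \<bullet> z) * \<eta> x \<partial>lborel) \<partial>lborel)"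
  proof (rule set_lebesgue_integral_cong)
    show "\<forall>t. t \<in> {0..1} \<longrightarrow> (\<integral>x. ?D (x + t *\<^sub>R (- z)) * f x \<partial>lborel) =
        (\<integral>x. (g (x + t *\<^sub>R z) \<bullet> z) * \<eta> x \<partial>lborel)"
    proof (intro allI impI)
      fix t :: real
      have "(\<integral>x. ?D (x + t *\<^sub>R (- z)) * f x \<partial>lborel) = (\<integral>x. (g x \<bullet> z) * \<eta> (x + t *\<^sub>R (- z)) \<partial>lborel)"
        using integral_mult_bump_derivative[OF shifted[of "t *\<^sub>R (- z)"], of "- z"]
        by (simp only: frechet_derivative_translate[OF bump] mult.commute[of "f _"]) simp
      then show "(\<integral>x. ?D (x + t *\<^sub>R (- z)) * f x \<partial>lborel) = (\<integral>x. (g (x + t *\<^sub>R z) \<bullet> z) * \<eta> x \<partial>lborel)"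
        using integral_lborel_translate[of "\<lambda>x. (g x \<bullet> z) * \<eta> (x + t *\<^sub>R (- z))" "t *\<^sub>R z"] by simp
    qed
  qed simp
  also have "\<dots> = (\<integral>x. line_mean (\<lambda>x. g x \<bullet> z) z x * \<eta> x \<partial>lborel)"
    using grad_energy_finite[of z] unfolding grad_energy_def
    by (intro integral_line_mean_mult_bump[OF _ p_ge_1 _ bump, symmetric]) auto
  finally show ?thesis .
qed

lemma AE_shift_diff_eq_line_mean: "AE x in lborel. f (x + z) - f x = line_mean (\<lambda>x. g x \<bullet> z) z x"
proof -
  define L where "L = line_mean (\<lambda>x. g x \<bullet> z) z"
  have [measurable]: "L \<in> borel_measurable borel" unfolding L_def by measurable
  have L_finite: "Lp_pow p L < \<infinity>"
    unfolding L_def using p_ge_1 grad_energy_finite[of z]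
    by (intro le_less_trans[OF Lp_pow_line_mean_le]) (auto simp: grad_energy_def)
  have shift_finite: "Lp_pow p (\<lambda>x. f (x + z)) < \<infinity>"
    using Lp_finite by (simp add: Lp_pow_translate)
  have "AE x in lborel. f (x + z) - f x - L x = 0"
  proof (rule AE_zero_if_bump_integrals_zero)
    fix A :: "'a set"
    assume A_borel [measurable]: "A \<in> sets borel" and "bounded A"
    have "integrable lborel (\<lambda>x. u x * indicator A x)"
      if [measurable]: "u \<in> borel_measurable borel" and u_finite: "Lp_pow p u < \<infinity>" for u :: "'a \<Rightarrow> real"
      using le_less_trans[OF set_nn_integral_le_Lp_pow u_finite, of A]
        emeasure_bounded_finite[OF \<open>bounded A\<close>]
      by (intro integrable_mult_if_powr_integral_finite[OF _ _ A_borel p_ge_1, of _ _ 1]) auto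
    from this[OF _ shift_finite] this[OF _ Lp_finite] this[OF _ L_finite]
    show "set_integrable lborel A (\<lambda>x. f (x + z) - f x - L x)"
      by (simp add: set_integrable_def right_diff_distrib mult.commute)
  next
    fix \<eta> :: "'a \<Rightarrow> real"
    assume bump: "bump_fun \<eta>"
    have "(\<integral>x. (f (x + z) - f x - L x) * \<eta> x \<partial>lborel) =
        (\<integral>x. (f (x + z) - f x) * \<eta> x \<partial>lborel) - (\<integral>x. L x * \<eta> x \<partial>lborel)"
      using integrable_mult_bump_fun[OF _ p_ge_1 _ bump] shift_finite Lp_finite L_finite
      by (simp add: left_diff_distrib)
    then show "(\<integral>x. (f (x + z) - f x - L x) * \<eta> x \<partial>lborel) = 0"
      by (simp add: integral_shift_diff_mult_bump[OF bump] L_def)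
  qed measurable
  then show ?thesis by eventually_elim (simp add: L_def)
qed

lemma shift_energy_eq_line_mean: "shift_energy p f z = Lp_pow p (line_mean (\<lambda>x. g x \<bullet> z) z)"
  unfolding shift_energy_def by (rule Lp_pow_cong_AE[OF AE_shift_diff_eq_line_mean])

lemma shift_energy_le_grad_energy: "shift_energy p f z \<le> grad_energy p g z"
  unfolding shift_energy_eq_line_mean grad_energy_def by (rule Lp_pow_line_mean_le) (auto intro: p_ge_1)

lemma grad_energy_le_liminf:
  assumes h_to_0: "\<And>k. h k > 0" "h \<longlonglongrightarrow> 0"
  shows "grad_energy p g \<xi> \<le> liminf (\<lambda>k. shift_energy p f (h k *\<^sub>R \<xi>) / ennreal (h k powr p))"
proof -
  let ?u = "\<lambda>x. g x \<bullet> \<xi>"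
  let ?L = "\<lambda>k. line_mean ?u (h k *\<^sub>R \<xi>)"
  have quotient_eq: "shift_energy p f (h k *\<^sub>R \<xi>) / ennreal (h k powr p) = Lp_pow p (?L k)" for k
  proof -
    have "shift_energy p f (h k *\<^sub>R \<xi>) = Lp_pow p (?L k) * ennreal (h k powr p)"
      using h_to_0(1)[of k]
      by (simp add: shift_energy_eq_line_mean line_mean_cmult Lp_pow_cmult mult.commute)
    then show ?thesis using h_to_0(1)[of k] by (simp add: mult_divide_eq_ennreal)
  qed
  have "AE x in lborel. (\<lambda>k. ?L k x) \<longlonglongrightarrow> ?u x"
    using grad_energy_finite[of \<xi>]
    by (intro AE_line_mean_tendsto[OF _ p_ge_1 _ h_to_0]) (auto simp: grad_energy_def)
  then have "AE x in lborel. ennreal (\<bar>?u x\<bar> powr p) = liminf (\<lambda>k. ennreal (\<bar>?L k x\<bar> powr p))"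
  proof eventually_elim
    case (elim x)
    then have "(\<lambda>k. ennreal (\<bar>?L k x\<bar> powr p)) \<longlonglongrightarrow> ennreal (\<bar>?u x\<bar> powr p)"
      using p_ge_1 by (intro tendsto_ennrealI tendsto_powr' tendsto_rabs tendsto_const) auto
    then show ?case by (rule lim_imp_Liminf[OF sequentially_bot, symmetric])
  qed
  then have "grad_energy p g \<xi> = (\<integral>\<^sup>+x. liminf (\<lambda>k. ennreal (\<bar>?L k x\<bar> powr p)) \<partial>lborel)"
    unfolding grad_energy_def Lp_pow_def by (rule nn_integral_cong_AE)
  also have "\<dots> \<le> liminf (\<lambda>k. Lp_pow p (?L k))"
    unfolding Lp_pow_def by (rule nn_integral_liminf) measurable
  finally show ?thesis by (simp add: quotient_eq)
qed

lemma eventually_shift_energy_ge: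
  assumes c_bounds: "ennreal c < grad_energy p g \<xi>" "c \<ge> 0"
  shows "\<forall>\<^sub>F t in at_right 0. ennreal (c * t powr p) \<le> shift_energy p f (t *\<^sub>R \<xi>)"
proof (rule sequentially_imp_eventually_at_right[of 0 1])
  fix h :: "nat \<Rightarrow> real"
  assume h_to_0: "\<And>k. 0 < h k" "h \<longlonglongrightarrow> 0"
  have "\<forall>\<^sub>F k in sequentially. ennreal c < shift_energy p f (h k *\<^sub>R \<xi>) / ennreal (h k powr p)"
    using less_le_trans[OF c_bounds(1) grad_energy_le_liminf[OF h_to_0]] by (rule less_LiminfD)
  then show "\<forall>\<^sub>F k in sequentially. ennreal (c * h k powr p) \<le> shift_energy p f (h k *\<^sub>R \<xi>)"
  proof eventually_elim
    case (elim k)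
    have "ennreal c * ennreal (h k powr p) \<le>
        shift_energy p f (h k *\<^sub>R \<xi>) / ennreal (h k powr p) * ennreal (h k powr p)"
      using elim by (intro mult_right_mono) auto
    also have "\<dots> = shift_energy p f (h k *\<^sub>R \<xi>)"
      using h_to_0(1)[of k] by (simp add: ennreal_divide_times)
    finally show ?case using c_bounds by (simp add: ennreal_mult)
  qed
qed simp

sublocale grad: shift_gauge f p p 1 "grad_energy p g"
  using p_ge_1 shift_energy_le_grad_energy by unfold_locales (auto simp: grad_energy_scaleR)

lemma grad_level_one: "grad.level 1 = polar_proj_body p g"
  by (simp add: grad.level_def polar_proj_body_eq)

end

section \<open>Comparison with the polar projection body\<close>

locale nonzero_sobolev_pair = sobolev_pair +
  assumes supp_positive: "0 < emeasure lborel (supp_set f)"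
    and supp_finite: "emeasure lborel (supp_set f) < \<infinity>"
begin

abbreviation supp_vol :: real where
  "supp_vol \<equiv> measure lborel (supp_set f)"

abbreviation polar_vol :: real where
  "polar_vol \<equiv> measure lborel (polar_proj_body p g)"

abbreviation frac_vol :: "real \<Rightarrow> real" where
  "frac_vol s \<equiv> measure lborel (frac_polar_proj_body s p f)"

definition Lp_norm :: real where
  "Lp_norm = enn2real (Lp_pow p f) powr (1 / p)"

lemma Lp_pow_nonzero: "Lp_pow p f \<noteq> 0"
  using supp_positive by (simp add: Lp_pow_eq_0_iff)

lemma
  shows Lp_norm_pos: "Lp_norm > 0"
    and Lp_pow_eq_Lp_norm_powr: "Lp_pow p f = ennreal (Lp_norm powr p)"
proof -
  have "enn2real (Lp_pow p f) > 0"
    using Lp_pow_nonzero Lp_finite by (simp add: enn2real_positive_iff zero_less_iff_neq_zero)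
  then show "Lp_norm > 0" "Lp_pow p f = ennreal (Lp_norm powr p)"
    using p_ge_1 Lp_finite by (auto simp: Lp_norm_def powr_powr)
qed

lemma emeasure_supp: "emeasure lborel (supp_set f) = ennreal supp_vol" "supp_vol > 0"
  using emeasure_eq_measure_if_pos_finite measure_pos_if_pos_finite supp_positive supp_finite by blast+

lemma emeasure_polar: "emeasure lborel (polar_proj_body p g) = ennreal polar_vol" "polar_vol > 0"
proof -
  have "emeasure lborel (polar_proj_body p g) < \<infinity>"
    using grad.emeasure_level_finite[OF Lp_pow_nonzero Lp_finite supp_finite]
    by (simp add: grad_level_one)
  moreover have "emeasure lborel (polar_proj_body p g) > 0"
    using p_ge_1 by (intro emeasure_polar_proj_body_pos Lp_norm_grad_finite) auto
  ultimately show "emeasure lborel (polar_proj_body p g) = ennreal polar_vol" "polar_vol > 0"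
    using emeasure_eq_measure_if_pos_finite measure_pos_if_pos_finite by blast+
qed

lemma emeasure_frac:
  assumes "0 < s" "s < 1"
  shows "emeasure lborel (frac_polar_proj_body s p f) = ennreal (frac_vol s)"
  using emeasure_frac_polar_proj_body_finite[OF f_borel p_ge_1 assms Lp_finite supp_positive supp_finite]
  by (intro emeasure_eq_ennreal_measure) auto

theorem affine_poincare: "Lp_norm \<le> 4 * (supp_vol / polar_vol) powr (1 / real DIM('a))"
proof -
  let ?n = "real DIM('a)" and ?F = "Lp_norm powr p / 2"
  note vols_pos = Lp_norm_pos emeasure_supp(2) emeasure_polar(2)
  have "ennreal (?F powr (?n / p)) * emeasure lborel (polar_proj_body p g) \<le>
      2 * emeasure lborel (supp_set f)"
    using grad.Lp_pow_times_emeasure_level_le[OF Lp_pow_eq_Lp_norm_powr] vols_pos by (simp add: grad_level_one)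
  then have "ennreal (?F powr (?n / p) * polar_vol) \<le> ennreal (2 * supp_vol)"
    by (simp add: emeasure_polar emeasure_supp ennreal_mult')
  then have "?F powr (?n / p) \<le> 2 * supp_vol / polar_vol"
    using vols_pos by (simp add: pos_le_divide_eq)
  then have "(?F powr (?n / p)) powr (1 / ?n) \<le> (2 * (supp_vol / polar_vol)) powr (1 / ?n)"
    by (intro powr_mono2) auto
  also have "\<dots> = 2 powr (1 / ?n) * (supp_vol / polar_vol) powr (1 / ?n)"
    by (rule powr_mult)
  also have "\<dots> \<le> 2 * (supp_vol / polar_vol) powr (1 / ?n)"
    using powr_mono[of "1 / ?n" 1 2] by (intro mult_right_mono) (auto simp: Suc_le_eq)
  also have "(?F powr (?n / p)) powr (1 / ?n) = Lp_norm / 2 powr (1 / p)"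
    using vols_pos p_ge_1 by (simp add: powr_powr powr_divide)
  finally have "Lp_norm \<le> 2 powr (1 / p) * (2 * (supp_vol / polar_vol) powr (1 / ?n))"
    by (simp add: pos_divide_le_eq mult.commute)
  also have "\<dots> \<le> 2 * (2 * (supp_vol / polar_vol) powr (1 / ?n))"
    using powr_mono[of "1 / p" 1 2] p_ge_1 by (intro mult_right_mono) auto
  finally show ?thesis by simp
qed

lemma frac_gauge_pow_le_grad_energy:
  assumes s_bounds: "0 < s" "s < 1" and grad_energy_bound: "grad_energy p g \<xi> \<le> ennreal N" "N > 0"
  shows "frac_gauge_pow s p f \<xi> \<le>
      ennreal (N powr s * (2 * Lp_norm) powr (p * (1 - s)) / (p * s * (1 - s)))"
proof -
  have "shift_energy p f (t *\<^sub>R \<xi>) \<le> ennreal (t powr p * N)" if "t > 0" for t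
  proof -
    have "shift_energy p f (t *\<^sub>R \<xi>) \<le> ennreal (t powr p) * grad_energy p g \<xi>"
      using shift_energy_le_grad_energy[of "t *\<^sub>R \<xi>"] that by (simp add: grad_energy_scaleR)
    also have "\<dots> \<le> ennreal (t powr p) * ennreal N" by (intro mult_left_mono grad_energy_bound) auto
    finally show ?thesis by (simp add: ennreal_mult')
  qed
  moreover have "shift_energy p f z \<le> ennreal ((2 * Lp_norm) powr p)" for z
    using shift_energy_le_Lp_pow[OF f_borel p_ge_1, of z] by (simp add: Lp_pow_eq_Lp_norm_powr powr_mult ennreal_mult')
  ultimately have "frac_gauge_pow s p f \<xi> \<le>
      ennreal (N powr s * ((2 * Lp_norm) powr p) powr (1 - s) / (p * s * (1 - s)))"
    using Lp_norm_pos
    by (intro frac_gauge_pow_le_interpolation[OF f_borel p_ge_1 s_bounds grad_energy_bound(2)]) auto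
  then show ?thesis by (simp add: powr_powr)
qed

definition inner_level :: "real \<Rightarrow> real" where
  "inner_level s = p * s * (1 - s) / (2 * Lp_norm) powr (p * (1 - s))"

lemma inner_level_pos: "0 < s \<Longrightarrow> s < 1 \<Longrightarrow> inner_level s > 0"
  using p_ge_1 Lp_norm_pos by (simp add: inner_level_def)

lemma grad_level_subset_frac_polar_proj_body:
  assumes s_bounds: "0 < s" "s < 1"
  shows "grad.level (inner_level s powr (1 / s)) \<subseteq> frac_polar_proj_body s p f"
proof
  fix \<xi>
  let ?N = "inner_level s powr (1 / s)"
  assume "\<xi> \<in> grad.level ?N"
  then have "frac_gauge_pow s p f \<xi> \<le>
      ennreal (?N powr s * (2 * Lp_norm) powr (p * (1 - s)) / (p * s * (1 - s)))"
    using inner_level_pos[OF s_bounds]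
    by (intro frac_gauge_pow_le_grad_energy s_bounds) (auto simp: grad.level_def)
  also have "?N powr s * (2 * Lp_norm) powr (p * (1 - s)) / (p * s * (1 - s)) = 1"
    using inner_level_pos[OF s_bounds] p_ge_1 s_bounds Lp_norm_pos
    by (simp add: powr_powr) (simp add: inner_level_def)
  finally show "\<xi> \<in> frac_polar_proj_body s p f" by (simp add: frac_polar_proj_body_def)
qed

lemma polar_vol_le_frac_vol:
  assumes s_bounds: "0 < s" "s < 1"
  shows "inner_level s powr (real DIM('a) / (s * p)) * polar_vol \<le> frac_vol s"
proof -
  have "emeasure lborel (grad.level (inner_level s powr (1 / s))) \<le>
      emeasure lborel (frac_polar_proj_body s p f)"
    using grad_level_subset_frac_polar_proj_body[OF s_bounds] by (intro emeasure_mono) auto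
  then have "ennreal (inner_level s powr (real DIM('a) / (s * p)) * polar_vol) \<le> ennreal (frac_vol s)"
    using inner_level_pos[OF s_bounds] grad.emeasure_level[of "inner_level s powr (1 / s)"]
    by (simp add: powr_powr grad_level_one emeasure_polar emeasure_frac s_bounds ennreal_mult')
  then show ?thesis by simp
qed

lemma frac_vol_pos:
  assumes s_bounds: "0 < s" "s < 1"
  shows "frac_vol s > 0"
  using inner_level_pos[OF s_bounds] emeasure_polar(2)
  by (intro less_le_trans[OF _ polar_vol_le_frac_vol[OF s_bounds]] mult_pos_pos) auto

lemma frac_vol_powr_le:
  assumes s_bounds: "0 < s" "s < 1"
  shows "(s * (1 - s)) powr (1 / p) * frac_vol s powr (- s / real DIM('a)) \<le>
    p powr (- 1 / p) * (2 * Lp_norm) powr (1 - s) * polar_vol powr (- s / real DIM('a))"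
proof -
  let ?n = "real DIM('a)" and ?w = "s * (1 - s)"
  have "frac_vol s powr (- s / ?n) \<le> (inner_level s powr (?n / (s * p)) * polar_vol) powr (- s / ?n)"
    using inner_level_pos[OF s_bounds] s_bounds emeasure_polar(2)
    by (intro powr_mono2' polar_vol_le_frac_vol mult_pos_pos) (auto simp: divide_nonneg_pos)
  also have "\<dots> = inner_level s powr (- 1 / p) * polar_vol powr (- s / ?n)"
    using s_bounds p_ge_1 by (simp add: powr_mult powr_powr)
  also have "inner_level s powr (- 1 / p) =
      ?w powr (- 1 / p) * (p powr (- 1 / p) * (2 * Lp_norm) powr (1 - s))"
    using s_bounds p_ge_1 Lp_norm_pos
    by (simp add: inner_level_def powr_divide powr_mult powr_powr powr_minus_divide)
  finally have "?w powr (1 / p) * frac_vol s powr (- s / ?n) \<le>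
      ?w powr (1 / p) *
        (?w powr (- 1 / p) * (p powr (- 1 / p) * (2 * Lp_norm) powr (1 - s)) * polar_vol powr (- s / ?n))"
    by (intro mult_left_mono) auto
  then show ?thesis
    using s_bounds by (simp add: powr_minus_divide)
qed

theorem frac_polar_le_polar:
  assumes s_bounds: "0 < s" "s < 1"
  shows "(s * (1 - s)) powr (1 / p) * supp_vol powr (s / real DIM('a)) *
      frac_vol s powr (- s / real DIM('a)) \<le>
    8 * supp_vol powr (1 / real DIM('a)) * polar_vol powr (- 1 / real DIM('a))"
proof -
  let ?n = "real DIM('a)"
  note vols_pos = emeasure_supp(2) emeasure_polar(2)
  define X where "X = (supp_vol / polar_vol) powr (1 / ?n)"
  have X_pos: "X > 0" using vols_pos by (simp add: X_def)
  have "(2 * Lp_norm) powr (1 - s) \<le> (8 * X) powr (1 - s)"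
    using affine_poincare Lp_norm_pos s_bounds by (intro powr_mono2) (auto simp: X_def)
  also have "\<dots> \<le> 8 * X powr (1 - s)"
    using powr_mono[of "1 - s" 1 8] s_bounds by (simp add: powr_mult mult_right_mono)
  finally have norm_le: "(2 * Lp_norm) powr (1 - s) \<le> 8 * X powr (1 - s)" .
  have "p powr (- 1 / p) \<le> 1"
    using p_ge_1 powr_mono[of "- 1 / p" 0 p] by simp
  then have "p powr (- 1 / p) * (2 * Lp_norm) powr (1 - s) \<le> 1 * (8 * X powr (1 - s))"
    by (intro mult_mono norm_le) auto
  then have "p powr (- 1 / p) * (2 * Lp_norm) powr (1 - s) * polar_vol powr (- s / ?n) \<le>
      8 * X powr (1 - s) * polar_vol powr (- s / ?n)"
    by (intro mult_right_mono) auto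
  with frac_vol_powr_le[OF s_bounds]
  have "supp_vol powr (s / ?n) * ((s * (1 - s)) powr (1 / p) * frac_vol s powr (- s / ?n)) \<le>
      supp_vol powr (s / ?n) * (8 * X powr (1 - s) * polar_vol powr (- s / ?n))"
    by (intro mult_left_mono) auto
  also have "\<dots> = 8 * ((supp_vol powr (s / ?n) * polar_vol powr (- s / ?n)) * X powr (1 - s))"
    by (simp only: mult_ac)
  also have "supp_vol powr (s / ?n) * polar_vol powr (- s / ?n) = X powr s"
    using vols_pos by (simp add: X_def powr_powr powr_divide powr_minus_divide)
  also have "X powr s * X powr (1 - s) = X" using X_pos by (simp flip: powr_add)
  also have "X = supp_vol powr (1 / ?n) * polar_vol powr (- 1 / ?n)"
    using vols_pos by (simp add: X_def powr_divide powr_minus_divide)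
  finally show ?thesis by (simp add: mult_ac)
qed

section \<open>The limit \<open>s \<rightarrow> 1\<close>\<close>

definition normalized_body :: "real \<Rightarrow> 'a set" where
  "normalized_body s = {\<xi>. frac_gauge_pow s p f \<xi> \<le> ennreal (1 / (p * (1 - s)))}"

lemma normalized_body_sets [measurable]: "normalized_body s \<in> sets borel"
  unfolding normalized_body_def by measurable

lemma measure_normalized_body:
  assumes "0 < s" "s < 1"
  shows "measure lborel (normalized_body s) =
      (1 / (p * (1 - s))) powr (real DIM('a) / (s * p)) * frac_vol s"
  using assms p_ge_1 emeasure_frac_gauge_pow_level[OF f_borel, of s p "1 / (p * (1 - s))"]
  by (simp add: normalized_body_def measure_def enn2real_mult)

lemma scaled_normalized_body_small_shift:
  assumes s_bounds: "1 / 2 < s" "s < 1" and r_bounds: "0 < r" "r \<le> 1"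
    and r_small: "3 * 4 powr p * r powr (p / 2) \<le> Lp_norm powr p / 2"
    and \<xi>_normalized: "\<xi> \<in> normalized_body s"
  shows "r *\<^sub>R \<xi> \<in> small_shifts p f"
proof -
  have "shift_energy p f (r *\<^sub>R \<xi>) \<le> ennreal (shift_const s p) * frac_gauge_pow s p f (r *\<^sub>R \<xi>)"
    using s_bounds by (intro shift_energy_le_frac_gauge_pow[OF f_borel p_ge_1]) auto
  also have "\<dots> \<le> ennreal (shift_const s p) * (ennreal (r powr (s * p)) * ennreal (1 / (p * (1 - s))))"
    using \<xi>_normalized r_bounds by (simp add: frac_gauge_pow_scaleR normalized_body_def mult_left_mono)
  also have "\<dots> = ennreal (3 * 4 powr p * r powr (s * p))"
    using p_ge_1 s_bounds by (simp add: shift_const_def flip: ennreal_mult')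
  also have "\<dots> \<le> ennreal (Lp_norm powr p / 2)"
  proof (rule ennreal_leI)
    have "r powr (s * p) \<le> r powr (p / 2)" using r_bounds p_ge_1 s_bounds by (intro powr_mono') auto
    then have "3 * 4 powr p * r powr (s * p) \<le> 3 * 4 powr p * r powr (p / 2)" by simp
    then show "3 * 4 powr p * r powr (s * p) \<le> Lp_norm powr p / 2" using r_small by linarith
  qed
  finally show ?thesis by (simp add: Lp_pow_eq_Lp_norm_powr small_shifts_def ennreal_divide_numeral)
qed

lemma normalized_body_subset:
  obtains D where "D \<in> sets borel" "emeasure lborel D < \<infinity>"
    "\<And>s. 1 / 2 < s \<Longrightarrow> s < 1 \<Longrightarrow> normalized_body s \<subseteq> D"
proof -
  define F where "F = Lp_norm powr p"
  have F_pos: "F > 0" using Lp_norm_pos by (simp add: F_def)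
  define r where "r = min 1 ((F / (6 * 4 powr p)) powr (2 / p))"
  have r_bounds: "0 < r" "r \<le> 1" using F_pos by (auto simp: r_def)
  have "r powr (p / 2) \<le> ((F / (6 * 4 powr p)) powr (2 / p)) powr (p / 2)"
    using p_ge_1 r_bounds by (intro powr_mono2) (auto simp: r_def)
  also have "\<dots> = F / (6 * 4 powr p)" using p_ge_1 F_pos by (simp add: powr_powr)
  finally have r_small: "3 * 4 powr p * r powr (p / 2) \<le> Lp_norm powr p / 2"
    by (simp add: F_def field_simps)
  define D where "D = {\<xi>. r *\<^sub>R \<xi> \<in> small_shifts p f}"
  have [measurable]: "D \<in> sets borel" unfolding D_def by measurable
  have "ennreal (r ^ DIM('a)) * emeasure lborel D = emeasure lborel (small_shifts p f)"
    using nn_integral_lborel_affine[of "indicator (small_shifts p f)" r 0] r_bounds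
    by (simp add: D_def indicator_def[abs_def] flip: nn_integral_indicator)
  also have "\<dots> < \<infinity>"
    using supp_finite
    by (intro le_less_trans[OF emeasure_small_shifts_le[OF f_borel Lp_pow_nonzero Lp_finite]])
       (simp add: ennreal_mult_less_top)
  finally have "emeasure lborel D < \<infinity>" using r_bounds by (auto simp: ennreal_mult_less_top)
  moreover have "normalized_body s \<subseteq> D" if "1 / 2 < s" "s < 1" for s
    using scaled_normalized_body_small_shift[OF that r_bounds r_small] by (auto simp: D_def)
  ultimately show thesis by (intro that[of D]) auto
qed

lemma eventually_notin_normalized_body:
  assumes "\<xi> \<notin> polar_proj_body p g"
  shows "\<forall>\<^sub>F s in at_left 1. \<xi> \<notin> normalized_body s"
proof -
  have "1 < grad_energy p g \<xi>" using assms by (simp add: polar_proj_body_eq not_le)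
  then obtain e where e_between: "1 < e" "e < grad_energy p g \<xi>" using dense by blast
  then obtain c where c_eq: "e = ennreal c" "c \<ge> 0" by (cases e) auto
  with e_between have c_gt: "c > 1" and c_less: "ennreal c < grad_energy p g \<xi>"
    by (auto simp: ennreal_less_iff simp flip: ennreal_1)
  obtain \<delta> where \<delta>_window: "\<delta> > 0"
    "\<And>t. 0 < t \<Longrightarrow> t < \<delta> \<Longrightarrow> ennreal (c * t powr p) \<le> shift_energy p f (t *\<^sub>R \<xi>)"
    using eventually_shift_energy_ge[OF c_less c_eq(2)]
    unfolding eventually_at_right[OF zero_less_one] by auto
  have "((\<lambda>s. c * \<delta> powr (p * (1 - s))) \<longlongrightarrow> c * \<delta> powr (p * (1 - 1))) (at_left 1)"
    using \<delta>_window by (intro tendsto_intros) auto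
  then have "\<forall>\<^sub>F s in at_left 1. 1 < c * \<delta> powr (p * (1 - s))"
    using c_gt \<delta>_window by (intro order_tendstoD(1)) auto
  moreover have "\<forall>\<^sub>F s in at_left (1::real). s < 1" by (simp add: eventually_at_filter)
  ultimately show ?thesis
  proof eventually_elim
    case (elim s)
    have "ennreal (1 / (p * (1 - s))) < ennreal (c * \<delta> powr (p * (1 - s)) / (p * (1 - s)))"
      using elim p_ge_1
      by (intro ennreal_lessI divide_strict_right_mono) (auto intro!: divide_pos_pos mult_pos_pos)
    also have "\<dots> \<le> frac_gauge_pow s p f \<xi>"
      using elim p_ge_1 c_gt by (intro frac_gauge_pow_ge \<delta>_window) auto
    finally show ?case by (simp add: normalized_body_def)
  qed
qed

lemma measure_normalized_body_Un_tendsto: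
  "((\<lambda>s. measure lborel (normalized_body s \<union> polar_proj_body p g)) \<longlongrightarrow> polar_vol) (at_left 1)"
proof (rule tendsto_at_left_sequentially[of "1 / 2"])
  let ?Q = "polar_proj_body p g"
  fix S :: "nat \<Rightarrow> real"
  assume S_to_1: "\<And>m. S m < 1" "\<And>m. 1 / 2 < S m" "S \<longlonglongrightarrow> 1"
  then have S_at_left: "filterlim S (at_left 1) sequentially"
    by (auto simp: filterlim_at less_imp_neq intro!: always_eventually)
  obtain D where [measurable]: "D \<in> sets borel" and D_dominates: "emeasure lborel D < \<infinity>"
    "\<And>s. 1 / 2 < s \<Longrightarrow> s < 1 \<Longrightarrow> normalized_body s \<subseteq> D"
    using normalized_body_subset by blast
  have "emeasure lborel (D \<union> ?Q) < \<infinity>"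
    by (rule le_less_trans[OF emeasure_subadditive]) (use D_dominates emeasure_polar in auto)
  then have "integrable lborel (indicator (D \<union> ?Q) :: 'a \<Rightarrow> real)"
    by (intro integrable_real_indicator) auto
  then have "(\<lambda>m. \<integral>\<xi>. indicator (normalized_body (S m) \<union> ?Q) \<xi> \<partial>lborel) \<longlonglongrightarrow>
      (\<integral>\<xi>. (indicator ?Q \<xi> :: real) \<partial>lborel)"
  proof (rule integral_dominated_convergence[rotated 2])
    show "AE \<xi> in lborel. norm (indicator (normalized_body (S m) \<union> ?Q) \<xi> :: real) \<le>
        indicator (D \<union> ?Q) \<xi>" for m
      using D_dominates(2)[of "S m"] S_to_1 by (intro AE_I2) (auto split: split_indicator)
    show "AE \<xi> in lborel. (\<lambda>m. indicator (normalized_body (S m) \<union> ?Q) \<xi> :: real) \<longlonglongrightarrow> indicator ?Q \<xi>"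
    proof (rule AE_I2)
      fix \<xi> :: 'a
      show "(\<lambda>m. indicator (normalized_body (S m) \<union> ?Q) \<xi> :: real) \<longlonglongrightarrow> indicator ?Q \<xi>"
      proof (cases "\<xi> \<in> ?Q")
        case False
        have "\<forall>\<^sub>F m in sequentially. \<xi> \<notin> normalized_body (S m)"
          using eventually_notin_normalized_body[OF False] S_at_left
          by (rule eventually_compose_filterlim)
        then have "\<forall>\<^sub>F m in sequentially. indicator (normalized_body (S m) \<union> ?Q) \<xi> =
            (indicator ?Q \<xi> :: real)"
          by eventually_elim (simp add: False)
        then show ?thesis by (rule tendsto_eventually)
      qed simp
    qed
  qed measurable
  then show "(\<lambda>m. measure lborel (normalized_body (S m) \<union> ?Q)) \<longlonglongrightarrow> polar_vol" by simp
qed simp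

lemma normalized_body_powr_le:
  assumes s_near_1: "1 / 2 < s" "s < 1"
  shows "p powr (- 1 / p) *
      measure lborel (normalized_body s \<union> polar_proj_body p g) powr (- s / real DIM('a)) \<le>
    (1 - s) powr (1 / p) * frac_vol s powr (- s / real DIM('a))"
proof -
  let ?n = "real DIM('a)" and ?B = "normalized_body s" and ?Q = "polar_proj_body p g"
  have s_bounds: "0 < s" "s < 1" using s_near_1 by auto
  obtain D where "D \<in> sets borel" "emeasure lborel D < \<infinity>" "?B \<subseteq> D"
    using normalized_body_subset s_near_1 by metis
  then have "emeasure lborel ?B < \<infinity>"
    by (metis emeasure_mono le_less_trans sets_lborel)
  then have "emeasure lborel (?B \<union> ?Q) < \<infinity>"
    by (intro le_less_trans[OF emeasure_subadditive]) (auto simp: emeasure_polar)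
  then have "measure lborel ?B \<le> measure lborel (?B \<union> ?Q)"
    by (intro measure_mono_fmeasurable) (auto simp: fmeasurable_def)
  moreover have "0 < measure lborel ?B"
    using s_bounds p_ge_1 frac_vol_pos[OF s_bounds] by (simp add: measure_normalized_body)
  ultimately have "measure lborel (?B \<union> ?Q) powr (- s / ?n) \<le> measure lborel ?B powr (- s / ?n)"
    using s_bounds by (intro powr_mono2') (auto simp: divide_nonneg_pos)
  also have "\<dots> = (p * (1 - s)) powr (1 / p) * frac_vol s powr (- s / ?n)"
    using s_bounds p_ge_1
    by (simp add: measure_normalized_body powr_mult powr_powr powr_divide powr_minus_divide)
  finally have "p powr (- 1 / p) * measure lborel (?B \<union> ?Q) powr (- s / ?n) \<le>
      p powr (- 1 / p) * ((p * (1 - s)) powr (1 / p) * frac_vol s powr (- s / ?n))"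
    by (rule mult_left_mono) simp
  also have "\<dots> = (1 - s) powr (1 / p) * frac_vol s powr (- s / ?n)"
    using p_ge_1 by (simp add: powr_mult powr_minus_divide)
  finally show ?thesis .
qed

theorem frac_polar_tendsto_polar:
  "((\<lambda>s. (1 - s) powr (1 / p) * frac_vol s powr (- s / real DIM('a))) \<longlongrightarrow>
    p powr (- 1 / p) * polar_vol powr (- 1 / real DIM('a))) (at_left 1)"
proof (rule tendsto_sandwich)
  let ?n = "real DIM('a)" and ?Q = "polar_proj_body p g"
  let ?upper = "\<lambda>s. s powr (- 1 / p) *
      (p powr (- 1 / p) * (2 * Lp_norm) powr (1 - s) * polar_vol powr (- s / ?n))"
  have near_1: "\<forall>\<^sub>F s in at_left (1::real). 1 / 2 < s \<and> s < 1"
    using eventually_at_left_real[of "1 / 2" 1] by simp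
  show "((\<lambda>s. p powr (- 1 / p) * measure lborel (normalized_body s \<union> ?Q) powr (- s / ?n)) \<longlongrightarrow>
      p powr (- 1 / p) * polar_vol powr (- 1 / ?n)) (at_left 1)"
    using emeasure_polar(2) by (intro tendsto_intros measure_normalized_body_Un_tendsto) auto
  show "\<forall>\<^sub>F s in at_left 1. p powr (- 1 / p) * measure lborel (normalized_body s \<union> ?Q) powr (- s / ?n) \<le>
      (1 - s) powr (1 / p) * frac_vol s powr (- s / ?n)"
    using near_1 by (rule eventually_mono) (rule normalized_body_powr_le; simp)
  have "(?upper \<longlongrightarrow> 1 powr (- 1 / p) *
      (p powr (- 1 / p) * (2 * Lp_norm) powr (1 - 1) * polar_vol powr (- 1 / ?n))) (at_left 1)"
    using emeasure_polar(2) Lp_norm_pos by (intro tendsto_intros) auto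
  then show "(?upper \<longlongrightarrow> p powr (- 1 / p) * polar_vol powr (- 1 / ?n)) (at_left 1)"
    using Lp_norm_pos by simp
  show "\<forall>\<^sub>F s in at_left 1. (1 - s) powr (1 / p) * frac_vol s powr (- s / ?n) \<le> ?upper s"
    using near_1
  proof eventually_elim
    case (elim s)
    have "(1 - s) powr (1 / p) * frac_vol s powr (- s / ?n) =
        s powr (- 1 / p) * ((s * (1 - s)) powr (1 / p) * frac_vol s powr (- s / ?n))"
      using elim by (simp add: powr_mult powr_minus_divide)
    also have "\<dots> \<le> ?upper s"
      using elim by (intro mult_left_mono frac_vol_powr_le) auto
    finally show ?case .
  qed
qed

end

section \<open>Borel representatives\<close>

lemma completion_ex_borel_measurable_euclidean:
  fixes g :: "'a \<Rightarrow> 'b::euclidean_space"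
  assumes [measurable]: "g \<in> borel_measurable (completion M)"
  shows "\<exists>g'\<in>borel_measurable M. AE x in M. g x = g' x"
proof -
  have "\<exists>h\<in>borel_measurable M. AE x in M. g x \<bullet> i = h x" for i
    by (rule completion_ex_borel_measurable_real) measurable
  then obtain h where h_component: "\<And>i. h i \<in> borel_measurable M" "\<And>i. AE x in M. g x \<bullet> i = h i x"
    by metis
  have "AE x in M. \<forall>i\<in>Basis. g x \<bullet> i = h i x"
    using h_component(2) by (intro AE_finite_allI) auto
  then have "AE x in M. g x = (\<Sum>i\<in>Basis. h i x *\<^sub>R i)"
  proof eventually_elim
    case (elim x)
    have "g x = (\<Sum>i\<in>Basis. (g x \<bullet> i) *\<^sub>R i)" by (simp add: euclidean_representation)
    then show ?case using elim by simp
  qed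
  then show ?thesis
    using h_component(1) by (intro bexI[of _ "\<lambda>x. \<Sum>i\<in>Basis. h i x *\<^sub>R i"]) auto
qed

lemma emeasure_supp_set_cong_AE:
  assumes [measurable]: "f \<in> borel_measurable lebesgue" "f' \<in> borel_measurable borel"
    and AE_eq: "AE x in lborel. f x = f' x"
  shows "emeasure lebesgue (supp_set f) = emeasure lborel (supp_set f')"
proof -
  have supp_borel: "supp_set f' \<in> sets lborel" unfolding supp_set_def by measurable
  have "{x \<in> space lebesgue. f x \<noteq> 0} \<in> sets lebesgue" by measurable
  then have "emeasure lebesgue (supp_set f) = emeasure lebesgue (supp_set f')"
    using supp_borel AE_completion[OF AE_eq]
    by (intro emeasure_eq_AE) (auto simp: supp_set_def sets_completionI_sets elim!: eventually_mono)
  then show ?thesis using supp_borel by (simp add: emeasure_completion)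
qed

lemma frac_polar_proj_body_cong_AE:
  assumes "AE x in lborel. f x = f' x"
  shows "frac_polar_proj_body s p f = frac_polar_proj_body s p f'"
  by (simp add: frac_polar_proj_body_def frac_gauge_pow_cong_AE[OF assms])

lemma polar_proj_body_cong_AE:
  assumes "AE x in lborel. g x = g' x"
  shows "polar_proj_body p g = polar_proj_body p g'"
proof -
  have "grad_energy p g \<xi> = grad_energy p g' \<xi>" for \<xi>
    unfolding grad_energy_def using assms by (intro Lp_pow_cong_AE) auto
  then show ?thesis by (simp add: polar_proj_body_eq)
qed

lemma gagliardo_cong_AE:
  assumes "AE x in lborel. f x = f' x"
  shows "gagliardo s p f = gagliardo s p f'"
  unfolding gagliardo_def nn_integral_completion
proof (rule nn_integral_cong_AE)
  show "AE x in lborel.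
      (\<integral>\<^sup>+y. ennreal (\<bar>f x - f y\<bar> powr p / norm (x - y) powr (s * p + real DIM('a))) \<partial>lborel) =
      (\<integral>\<^sup>+y. ennreal (\<bar>f' x - f' y\<bar> powr p / norm (x - y) powr (s * p + real DIM('a))) \<partial>lborel)"
    using assms
  proof eventually_elim
    case (elim x)
    show ?case using assms elim by (intro nn_integral_cong_AE) auto
  qed
qed

lemma Lp_fun_cong_AE:
  assumes "Lp_fun p f" "f' \<in> borel_measurable lebesgue" "AE x in lborel. f x = f' x"
  shows "Lp_fun p f'"
  using assms AE_completion[OF assms(3)] unfolding Lp_fun_def
  by (auto elim!: integrable_cong_AE_imp elim: eventually_mono)

lemma smooth_fun_borel:
  assumes "smooth_fun \<phi>"
  shows "\<phi> \<in> borel_measurable borel"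
    and "i \<in> Basis \<Longrightarrow> (\<lambda>x. frechet_derivative \<phi> (at x) i) \<in> borel_measurable borel"
proof -
  have borel: "\<psi> \<in> borel_measurable borel" if "smooth_fun \<psi>" for \<psi> :: "'a \<Rightarrow> real"
    using that
    by (cases rule: smooth_fun.cases)
       (auto intro!: borel_measurable_continuous_onI differentiable_imp_continuous_on
         simp: differentiable_on_def intro: differentiable_at_withinI)
  show "\<phi> \<in> borel_measurable borel" by (rule borel[OF assms])
  show "(\<lambda>x. frechet_derivative \<phi> (at x) i) \<in> borel_measurable borel" if "i \<in> Basis"
    using assms that by (cases rule: smooth_fun.cases) (auto intro: borel)
qed

lemma weak_gradient_cong_AE:
  fixes f f' :: "'a::euclidean_space \<Rightarrow> real" and g g' :: "'a \<Rightarrow> 'a"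
  assumes weak: "weak_gradient f g"
    and [measurable]: "f \<in> borel_measurable lebesgue" "f' \<in> borel_measurable lebesgue"
      "g \<in> borel_measurable lebesgue" "g' \<in> borel_measurable lebesgue"
    and AE_eqs: "AE x in lborel. f x = f' x" "AE x in lborel. g x = g' x"
  shows "weak_gradient f' g'"
  unfolding weak_gradient_def
proof (intro allI impI ballI)
  fix \<phi> :: "'a \<Rightarrow> real" and i :: 'a
  assume test: "test_fun \<phi>" and i_Basis: "i \<in> Basis"
  then have [measurable]: "\<phi> \<in> borel_measurable lebesgue"
    "(\<lambda>x. frechet_derivative \<phi> (at x) i) \<in> borel_measurable lebesgue"
    using smooth_fun_borel[of \<phi>] by (auto simp: test_fun_def intro: measurable_completion)
  have "(\<integral>x. f' x * frechet_derivative \<phi> (at x) i \<partial>lebesgue) =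
      (\<integral>x. f x * frechet_derivative \<phi> (at x) i \<partial>lebesgue)"
    using AE_completion[OF AE_eqs(1)] by (intro integral_cong_AE) (measurable, auto)
  also have "\<dots> = - (\<integral>x. (g x \<bullet> i) * \<phi> x \<partial>lebesgue)"
    using weak test i_Basis unfolding weak_gradient_def by blast
  also have "(\<integral>x. (g x \<bullet> i) * \<phi> x \<partial>lebesgue) = (\<integral>x. (g' x \<bullet> i) * \<phi> x \<partial>lebesgue)"
    using AE_completion[OF AE_eqs(2)] by (intro integral_cong_AE) (measurable, auto)
  finally show "(\<integral>x. f' x * frechet_derivative \<phi> (at x) i \<partial>lebesgue) =
      - (\<integral>x. (g' x \<bullet> i) * \<phi> x \<partial>lebesgue)" .
qed

lemma W1p_grad_cong_AE:
  fixes f f' :: "'a::euclidean_space \<Rightarrow> real" and g g' :: "'a \<Rightarrow> 'a"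
  assumes f_W1p: "W1p_grad p f g"
    and lebesgue: "f' \<in> borel_measurable lebesgue" "g' \<in> borel_measurable lebesgue"
    and AE_eqs: "AE x in lborel. f x = f' x" "AE x in lborel. g x = g' x"
  shows "W1p_grad p f' g'"
proof -
  have "integrable lebesgue (\<lambda>x. norm (g' x) powr p)"
    using f_W1p lebesgue AE_completion[OF AE_eqs(2)] unfolding W1p_grad_def
    by (auto elim!: integrable_cong_AE_imp elim: eventually_mono)
  then show ?thesis
    using f_W1p lebesgue Lp_fun_cong_AE[OF _ lebesgue(1) AE_eqs(1)]
      weak_gradient_cong_AE[OF _ _ lebesgue(1) _ lebesgue(2) AE_eqs]
    by (auto simp: W1p_grad_def Lp_fun_def)
qed

lemma vol_borel: "A \<in> sets borel \<Longrightarrow> vol A = measure lborel A"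
  by (simp add: vol_def)

lemma W1p_grad_borel_representative:
  fixes f :: "'a::euclidean_space \<Rightarrow> real" and g :: "'a \<Rightarrow> 'a"
  assumes f_W1p: "W1p_grad p f g" and p_ge_1: "p \<ge> 1"
    and supp_pos_finite: "0 < emeasure lebesgue (supp_set f)" "emeasure lebesgue (supp_set f) < \<infinity>"
  obtains f' :: "'a \<Rightarrow> real" and g' :: "'a \<Rightarrow> 'a" where "nonzero_sobolev_pair p f' g'"
    "vol (supp_set f) = measure lborel (supp_set f')"
    "vol (polar_proj_body p g) = measure lborel (polar_proj_body p g')"
    "\<And>s. vol (frac_polar_proj_body s p f) = measure lborel (frac_polar_proj_body s p f')"
proof -
  have f_lebesgue: "f \<in> borel_measurable lebesgue" and g_lebesgue: "g \<in> borel_measurable lebesgue"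
    using f_W1p by (auto simp: W1p_grad_def Lp_fun_def)
  obtain f' where f'_borel [measurable]: "f' \<in> borel_measurable borel"
    and AE_f_eq: "AE x in lborel. f x = f' x"
    using completion_ex_borel_measurable_euclidean[OF f_lebesgue] by auto
  obtain g' where g'_borel [measurable]: "g' \<in> borel_measurable borel"
    and AE_g_eq: "AE x in lborel. g x = g' x"
    using completion_ex_borel_measurable_euclidean[OF g_lebesgue] by auto
  have supp_eq: "emeasure lebesgue (supp_set f) = emeasure lborel (supp_set f')"
    by (rule emeasure_supp_set_cong_AE[OF f_lebesgue f'_borel AE_f_eq])
  have "W1p_grad p f' g'"
    by (rule W1p_grad_cong_AE[OF f_W1p _ _ AE_f_eq AE_g_eq]) (auto intro: measurable_completion)
  then have "nonzero_sobolev_pair p f' g'"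
    using p_ge_1 supp_pos_finite by unfold_locales (auto simp: supp_eq)
  moreover have "vol (supp_set f) = measure lborel (supp_set f')"
    by (simp add: vol_def measure_def supp_eq)
  ultimately show thesis
    by (rule that)
       (simp_all add: vol_borel polar_proj_body_cong_AE[OF AE_g_eq] frac_polar_proj_body_cong_AE[OF AE_f_eq])
qed

theorem W1p_frac_polar_le_polar:
  fixes f :: "'a::euclidean_space \<Rightarrow> real" and g :: "'a \<Rightarrow> 'a"
  assumes f_W1p: "W1p_grad p f g" and p_ge_1: "p \<ge> 1"
    and supp_pos_finite: "0 < emeasure lebesgue (supp_set f)" "emeasure lebesgue (supp_set f) < \<infinity>"
    and s_bounds: "0 < s" "s < 1"
  shows "(s * (1 - s)) powr (1 / p) * vol (supp_set f) powr (s / real DIM('a)) *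
    vol (frac_polar_proj_body s p f) powr (- s / real DIM('a)) \<le>
    8 * vol (supp_set f) powr (1 / real DIM('a)) * vol (polar_proj_body p g) powr (- 1 / real DIM('a))"
proof -
  obtain f' :: "'a \<Rightarrow> real" and g' :: "'a \<Rightarrow> 'a" where "nonzero_sobolev_pair p f' g'"
    and vol_eqs: "vol (supp_set f) = measure lborel (supp_set f')"
      "vol (polar_proj_body p g) = measure lborel (polar_proj_body p g')"
      "\<And>s. vol (frac_polar_proj_body s p f) = measure lborel (frac_polar_proj_body s p f')"
    using W1p_grad_borel_representative[OF f_W1p p_ge_1 supp_pos_finite] by blast
  then interpret nonzero_sobolev_pair p f' g' by simp
  show ?thesis unfolding vol_eqs by (rule frac_polar_le_polar[OF s_bounds])
qed

theorem W1p_frac_polar_tendsto_polar: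
  fixes f :: "'a::euclidean_space \<Rightarrow> real" and g :: "'a \<Rightarrow> 'a"
  assumes f_W1p: "W1p_grad p f g" and p_ge_1: "p \<ge> 1"
    and supp_pos_finite: "0 < emeasure lebesgue (supp_set f)" "emeasure lebesgue (supp_set f) < \<infinity>"
  shows "((\<lambda>s. (1 - s) powr (1 / p) * vol (supp_set f) powr (s / real DIM('a) - 1 / p) *
      vol (frac_polar_proj_body s p f) powr (- s / real DIM('a))) \<longlongrightarrow>
    p powr (- 1 / p) * vol (supp_set f) powr (1 / real DIM('a) - 1 / p) *
      vol (polar_proj_body p g) powr (- 1 / real DIM('a))) (at_left 1)"
proof -
  obtain f' :: "'a \<Rightarrow> real" and g' :: "'a \<Rightarrow> 'a" where "nonzero_sobolev_pair p f' g'"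
    and vol_eqs: "vol (supp_set f) = measure lborel (supp_set f')"
      "vol (polar_proj_body p g) = measure lborel (polar_proj_body p g')"
      "\<And>s. vol (frac_polar_proj_body s p f) = measure lborel (frac_polar_proj_body s p f')"
    using W1p_grad_borel_representative[OF f_W1p p_ge_1 supp_pos_finite] by blast
  then interpret nonzero_sobolev_pair p f' g' by simp
  have "((\<lambda>s. supp_vol powr (s / real DIM('a) - 1 / p)) \<longlongrightarrow>
      supp_vol powr (1 / real DIM('a) - 1 / p)) (at_left 1)"
    using emeasure_supp(2) p_ge_1 by (intro tendsto_intros) auto
  from tendsto_mult[OF this frac_polar_tendsto_polar] show ?thesis
    unfolding vol_eqs by (simp only: mult_ac)
qed

lemma Linf_norm_le:
  assumes "f \<in> borel_measurable lebesgue" "AE x in lborel. \<bar>f x\<bar> \<le> C"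
  shows "Linf_norm f \<le> ereal C"
  unfolding Linf_norm_def
proof (rule esssup_I)
  show "(\<lambda>x. ereal \<bar>f x\<bar>) \<in> borel_measurable lebesgue" using assms(1) by measurable
  show "AE x in lebesgue. ereal \<bar>f x\<bar> \<le> ereal C"
    using AE_completion[OF assms(2)] by simp
qed

theorem Linf_norm_le_frac_polar:
  fixes f :: "'a::euclidean_space \<Rightarrow> real"
  assumes dim_less_p: "real DIM('a) < p" and s_bounds: "real DIM('a) / p < s0" "s0 < s" "s < 1"
    and f_W_frac: "W_frac s p f" and supp_finite: "emeasure lebesgue (supp_set f) < \<infinity>"
  shows "Linf_norm f \<le> ereal (morrey_const TYPE('a) s0 p *
    vol (supp_set f) powr (s / real DIM('a) - 1 / p) * (1 - s) powr (1 / p) *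
    vol (frac_polar_proj_body s p f) powr (- s / real DIM('a)))"
    (is "_ \<le> ereal ?C")
proof -
  have f_Lp: "Lp_fun p f" and gagliardo: "gagliardo s p f < \<infinity>"
    and f_lebesgue: "f \<in> borel_measurable lebesgue"
    using f_W_frac by (auto simp: W_frac_def Lp_fun_def)
  obtain f' where f'_borel [measurable]: "f' \<in> borel_measurable borel"
    and AE_eq: "AE x in lborel. f x = f' x"
    using completion_ex_borel_measurable_euclidean[OF f_lebesgue] by auto
  have supp_eq: "emeasure lebesgue (supp_set f) = emeasure lborel (supp_set f')"
    by (rule emeasure_supp_set_cong_AE[OF f_lebesgue f'_borel AE_eq])
  have vol_eqs: "vol (supp_set f) = measure lborel (supp_set f')"
    "vol (frac_polar_proj_body s p f) = measure lborel (frac_polar_proj_body s p f')"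
    by (simp_all add: vol_def measure_def supp_eq frac_polar_proj_body_cong_AE[OF AE_eq] emeasure_completion)
  have "Lp_fun p f'"
    by (rule Lp_fun_cong_AE[OF f_Lp _ AE_eq]) (auto intro: measurable_completion)
  then have seminorms_finite: "Lp_pow p f' < \<infinity>" "gagliardo s p f' < \<infinity>"
    using gagliardo
    by (auto simp: Lp_fun_def Lp_pow_def integrable_iff_bounded
        nn_integral_completion gagliardo_cong_AE[OF AE_eq])
  have "AE x in lborel. \<bar>f' x\<bar> \<le> ?C"
  proof (cases "emeasure lborel (supp_set f') = 0")
    case True
    then have "Lp_pow p f' = 0" by (simp add: Lp_pow_eq_0_iff)
    then have "AE x in lborel. f' x = 0" by (simp add: Lp_pow_def nn_integral_0_iff_AE)
    then show ?thesis using True by (simp add: vol_eqs measure_def)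
  next
    case False
    then show ?thesis
      unfolding vol_eqs using supp_finite
      by (intro fractional_morrey[OF f'_borel dim_less_p s_bounds seminorms_finite])
         (auto simp: supp_eq zero_less_iff_neq_zero)
  qed
  then have "AE x in lborel. \<bar>f x\<bar> \<le> ?C"
    using AE_eq by eventually_elim simp
  then show ?thesis by (rule Linf_norm_le[OF f_lebesgue])
qed

theorem theorem1p5:
  fixes p :: real
  assumes "DIM('a::euclidean_space) \<ge> 2" and "p > real DIM('a)"
  shows
   "(\<forall>s0 \<in> {real DIM('a) / p <..< 1}. \<exists>C::real. \<forall>s \<in> {s0<..<1}. \<forall>f :: 'a \<Rightarrow> real.
        W_frac s p f \<and> emeasure lebesgue (supp_set f) < \<infinity> \<longrightarrow>
        Linf_norm f \<le> ereal (C * vol (supp_set f) powr (s / DIM('a) - 1 / p) * (1 - s) powr (1 / p)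
                               * vol (frac_polar_proj_body s p f) powr (- s / DIM('a)))) \<and>
    (\<exists>c::real. \<forall>(f :: 'a \<Rightarrow> real) g s. W1p_grad p f g \<and> emeasure lebesgue (supp_set f) > 0 \<and>
        emeasure lebesgue (supp_set f) < \<infinity> \<and> s \<in> {0<..<1} \<longrightarrow>
        (s * (1 - s)) powr (1 / p) * vol (supp_set f) powr (s / DIM('a))
          * vol (frac_polar_proj_body s p f) powr (- s / DIM('a))
        \<le> c * vol (supp_set f) powr (1 / DIM('a)) * vol (polar_proj_body p g) powr (- 1 / DIM('a))) \<and>
    (\<forall>(f :: 'a \<Rightarrow> real) g. W1p_grad p f g \<and> emeasure lebesgue (supp_set f) > 0 \<and>
        emeasure lebesgue (supp_set f) < \<infinity> \<longrightarrow>
        ((\<lambda>s. (1 - s) powr (1 / p) * vol (supp_set f) powr (s / DIM('a) - 1 / p)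
               * vol (frac_polar_proj_body s p f) powr (- s / DIM('a)))
         \<longlongrightarrow> p powr (- 1 / p) * vol (supp_set f) powr (1 / DIM('a) - 1 / p)
               * vol (polar_proj_body p g) powr (- 1 / DIM('a))) (at_left 1))"
  (is "?Morrey \<and> ?comparison \<and> ?limit")
proof (intro conjI)
  have p_ge_1: "p \<ge> 1" using assms by linarith
  show ?Morrey
    by (intro ballI exI[of _ "morrey_const TYPE('a) _ p"] allI impI Linf_norm_le_frac_polar)
       (use assms(2) in auto)
  show ?comparison
    by (intro exI[of _ 8] allI impI) (use W1p_frac_polar_le_polar[OF _ p_ge_1] in auto)
  show ?limit
    using W1p_frac_polar_tendsto_polar[OF _ p_ge_1] by blast
qed

end
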